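(* Let $\varphi[a_1,a_2,a_3,a_4](z)\in M_2(\Gamma_0(24))$ be any of the 11 theta products with $(a_1,a_2,a_3,a_4)$ in the table below. Then $$\varphi[a_1,a_2,a_3,a_4](z)=b_2L_2(q)+b_3L_3(q)+b_4L_4(q)+b_6L_6(q)+b_8L_8(q)+b_{12}L_{12}(q)+b_{24}L_{24}(q)+xA(q),$$ where the coefficients are given by the corresponding row: $$\begin{array}{c|cccccccc} (a_1,a_2,a_3,a_4)&b_2&b_3&b_4&b_6&b_8&b_{12}&b_{24}&x\\ \hline (1,1,1,1)&0&0&8&0&0&0&0&0\\ (1,1,2,2)&2&0&-2&0&4&0&0&0\\ (1,1,3,3)&4&4&-4&-4&0&4&0&0\\ (1,1,6,6)&1&2&1&-1&-2&-1&2&2\\ (1,2,3,6)&1/2&-1&-1/2&1/2&1&-1/2&1&1\\ (2,2,2,2)&-4&0&0&0&4&0&0&0\\ (2,2,3,3)&1&2&1&-1&-2&-1&2&-2\\ (2,2,6,6)&-2&0&2&2&-2&-2&2&0\\ (3,3,3,3)&0&-8/3&0&0&0&8/3&0&0\\ (3,3,6,6)&0&-4/3&0&2/3&0&-2/3&4/3&0\\ (6,6,6,6)&0&0&0&-4/3&0&0&4/3&0 \end{array}$$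
   Context: Here $z\in\mathbb{H}$ (upper half plane) and $q=e^{2\pi i z}$; series in $q$ are regarded as functions of $z$. $M_2(\Gamma_0(24))$ is the space of weight 2 modular forms for $\Gamma_0(24)$ with trivial character. Ramanujan's theta function is $\varphi(z)=\sum_{n=-\infty}^{\infty}q^{n^2}$, and $\varphi[a_1,a_2,a_3,a_4](z)=\varphi(a_1z)\varphi(a_2z)\varphi(a_3z)\varphi(a_4z)$. With $\sigma(n)=\sum_{1\le m\mid n}m$, put $L(q)=-\frac1{24}+\sum_{n=1}^\infty\sigma(n)q^n$ and, for $1<d\mid24$, $L_d(q)=L(q)-dL(q^d)$. The Dedekind eta function is $\eta(z)=e^{\pi i z/12}\prod_{n=1}^\infty(1-e^{2\pi i n z})$, and $A(q)=\eta(2z)\eta(4z)\eta(6z)\eta(12z)$. *)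

theory Defs
  imports "HOL-Analysis.Analysis"
begin

definition upper_half_plane :: "complex set" where
  "upper_half_plane = {z. Im z > 0}"

definition nome :: "complex \<Rightarrow> complex" where
  "nome z = exp (2 * of_real pi * \<i> * z)"

definition SL2Z :: "(int ^ 2 ^ 2) set" where
  "SL2Z = {\<gamma>. det \<gamma> = 1}"

definition Gamma0 :: "nat \<Rightarrow> (int ^ 2 ^ 2) set" where
  "Gamma0 N = {\<gamma> \<in> SL2Z. int N dvd \<gamma> $ 2 $ 1}"

definition slash :: "int \<Rightarrow> int ^ 2 ^ 2 \<Rightarrow> (complex \<Rightarrow> complex) \<Rightarrow> complex \<Rightarrow> complex" where
  "slash k \<gamma> f z =
     (of_int (\<gamma> $ 2 $ 1) * z + of_int (\<gamma> $ 2 $ 2)) powi (- k) *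
     f ((of_int (\<gamma> $ 1 $ 1) * z + of_int (\<gamma> $ 1 $ 2)) /
        (of_int (\<gamma> $ 2 $ 1) * z + of_int (\<gamma> $ 2 $ 2)))"

definition bounded_at_ii_inf :: "(complex \<Rightarrow> complex) \<Rightarrow> bool" where
  "bounded_at_ii_inf f \<longleftrightarrow> (\<exists>B Y. \<forall>z. Im z > Y \<longrightarrow> norm (f z) \<le> B)"

text \<open>
  Forms are total functions on the complex numbers of which only the values on the upper half
  plane matter. The last condition, for all of \<open>SL\<^sub>2(\<int>)\<close> and not only for \<open>\<Gamma>\<^sub>0(N)\<close>, is
  holomorphy at every cusp: the slashed function has a Fourier expansion in
  \<open>exp (2 \<pi> \<i> z / N)\<close>, and it is bounded as \<open>Im z \<rightarrow> \<infinity>\<close> iff no negative powers occur.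
\<close>

definition modular_forms :: "int \<Rightarrow> nat \<Rightarrow> (complex \<Rightarrow> complex) set" where
  "modular_forms k N =
     {f. f holomorphic_on upper_half_plane \<and>
         (\<forall>\<gamma>\<in>Gamma0 N. \<forall>z\<in>upper_half_plane. slash k \<gamma> f z = f z) \<and>
         (\<forall>\<gamma>\<in>SL2Z. bounded_at_ii_inf (slash k \<gamma> f))}"

definition theta_phi :: "complex \<Rightarrow> complex" where
  "theta_phi z = (\<Sum>\<^sub>\<infinity>n\<in>(UNIV :: int set). nome z powi (n ^ 2))"

definition theta_prod :: "nat \<times> nat \<times> nat \<times> nat \<Rightarrow> complex \<Rightarrow> complex" where
  "theta_prod = (\<lambda>(a1, a2, a3, a4) z.
     theta_phi (of_nat a1 * z) * theta_phi (of_nat a2 * z) *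
     theta_phi (of_nat a3 * z) * theta_phi (of_nat a4 * z))"

definition sigma :: "nat \<Rightarrow> nat" where
  "sigma n = (\<Sum>m | 1 \<le> m \<and> m dvd n. m)"

definition eis_L :: "complex \<Rightarrow> complex" where
  "eis_L q = - 1 / 24 + (\<Sum>n. of_nat (sigma (Suc n)) * q ^ Suc n)"

definition eis_Ld :: "nat \<Rightarrow> complex \<Rightarrow> complex" where
  "eis_Ld d q = eis_L q - of_nat d * eis_L (q ^ d)"

definition dedekind_eta :: "complex \<Rightarrow> complex" where
  "dedekind_eta z =
     exp (of_real pi * \<i> * z / 12) *
     (\<Prod>n. 1 - exp (2 * of_real pi * \<i> * of_nat (Suc n) * z))"

text \<open>Written \<open>A(q)\<close> in the literature, but a function of \<open>z\<close> here.\<close>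

definition cusp_A :: "complex \<Rightarrow> complex" where
  "cusp_A z = dedekind_eta (2 * z) * dedekind_eta (4 * z) *
              dedekind_eta (6 * z) * dedekind_eta (12 * z)"

text \<open>
  Rows \<open>((a\<^sub>1, a\<^sub>2, a\<^sub>3, a\<^sub>4), (b\<^sub>2, b\<^sub>3, b\<^sub>4, b\<^sub>6, b\<^sub>8, b\<^sub>1\<^sub>2, b\<^sub>2\<^sub>4, x))\<close>.
\<close>

definition coeff_table ::
  "((nat \<times> nat \<times> nat \<times> nat) \<times>
    (complex \<times> complex \<times> complex \<times> complex \<times> complex \<times> complex \<times> complex \<times> complex)) set" where
  "coeff_table =
    {((1,1,1,1), (0, 0, 8, 0, 0, 0, 0, 0)),
     ((1,1,2,2), (2, 0, -2, 0, 4, 0, 0, 0)),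
     ((1,1,3,3), (4, 4, -4, -4, 0, 4, 0, 0)),
     ((1,1,6,6), (1, 2, 1, -1, -2, -1, 2, 2)),
     ((1,2,3,6), (1/2, -1, -1/2, 1/2, 1, -1/2, 1, 1)),
     ((2,2,2,2), (-4, 0, 0, 0, 4, 0, 0, 0)),
     ((2,2,3,3), (1, 2, 1, -1, -2, -1, 2, -2)),
     ((2,2,6,6), (-2, 0, 2, 2, -2, -2, 2, 0)),
     ((3,3,3,3), (0, -8/3, 0, 0, 0, 8/3, 0, 0)),
     ((3,3,6,6), (0, -4/3, 0, 2/3, 0, -2/3, 4/3, 0)),
     ((6,6,6,6), (0, 0, 0, -4/3, 0, 0, 4/3, 0))}"

end

theory Submission
  imports Defs "HOL-Complex_Analysis.Complex_Analysis" "HOL-Number_Theory.Cong"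
begin

text \<open>
  A weight 2 form for \<open>\<Gamma>\<^sub>0(24)\<close> whose \<open>q\<close>-expansion vanishes to order 9 is zero, because the index of
  \<open>\<Gamma>\<^sub>0(24)\<close> in the modular group is 48 and \<open>2 \<cdot> 48 / 12 = 8\<close>. Every row of the table is therefore a
  comparison of nine coefficients as soon as both sides are known to be forms, and the real work
  lies in the transformation laws.

  The one analytic input is the inversion formula \<open>L(-1/z) = z\<^sup>2 L(z) + \<i> z / (4\<pi>)\<close>
  (\<open>eis_L_inversion\<close>). It compares the two orders of summation of a conditionally convergent series
  over the lattice \<open>\<int> z + \<int>\<close>. Since \<open>- 2 \<pi> \<i> L\<close> is the logarithmic derivative of \<open>\<eta>\<close>, it integrates
  to the law of \<open>\<eta>\<^sup>2\<close> under inversion, and the Euclidean algorithm extends this to all of \<open>SL\<^sub>2(\<int>)\<close> with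
  a multiplier that is a character of order 12, given by an explicit polynomial
  (\<open>dedekind_eta_sq_SL2Z\<close>). Everything else is read off from this law. Differentiating it gives
  the law of \<open>L\<close>, and the non-modular terms cancel in \<open>L\<^sub>d\<close> (\<open>eis_Ld_form\<close>). By an identity of Gauss
  \<open>\<phi>(z) = \<eta>(2z)\<^sup>5 / (\<eta>(z)\<^sup>2 \<eta>(4z)\<^sup>2)\<close> (\<open>theta_phi_eta_quotient\<close>), so products of two squares
  \<open>\<phi>(xz)\<^sup>2 \<phi>(yz)\<^sup>2\<close> have trivial character (\<open>theta_pair_form\<close>).

  The law of \<open>\<eta>\<^sup>2\<close> sees only the square of \<open>A\<close>. However, \<open>A\<close> has to be a quarter of the difference
  of the rows \<open>(1,1,6,6)\<close> and \<open>(2,2,3,3)\<close>. The squares of the two sides of this identity are forms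
  of weight 4, where 17 coefficients decide, and the sign is settled by the first coefficient
  (\<open>cusp_A_theta\<close>). This makes \<open>A\<close> itself a form, and also \<open>\<phi>(z) \<phi>(2z) \<phi>(3z) \<phi>(6z)\<close>, which is \<open>A\<close>
  times a quotient of even powers of \<open>\<eta>\<close> (\<open>theta_1236_form\<close>).

  Boundedness at the cusps is deduced from growth. All functions involved are bounded by
  a power of \<open>1 + 1 / Im z\<close>. Such a bound survives the slash operators as a polynomial bound in
  \<open>Im z\<close>, and a periodic holomorphic function with polynomial growth is bounded
  (\<open>periodic_polynomial_growth_bounded\<close>). The bound on the order of vanishing
  (\<open>moderate_forms_valence_bound\<close>) comes from the product of a form over all cosets: divided by a power of
  the discriminant \<open>\<eta>\<^sup>2\<^sup>4\<close> it becomes a modular invariant function that tends to 0 at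
  infinity, hence is zero by the maximum principle.
\<close>

(* Frees the dollar sign for the entries of matrices. *)
no_notation fps_nth (infixl "$" 75)

section \<open>Partial fractions of the cotangent\<close>

lemma sin_nonzero_nonreal:
  fixes z :: complex assumes "Im z \<noteq> 0" shows "sin (of_real pi * z) \<noteq> 0"
proof
  assume "sin (of_real pi * z) = 0"
  then obtain n :: int where "of_real pi * z = of_real (of_int n * pi)"
    using sin_eq_0 [of "of_real pi * z"] by auto
  hence "z = of_int n" by simp
  with assms show False by simp
qed

text \<open>
  Logarithmic differentiation of Euler's reflection formula for the Gamma function.
\<close>
lemma Digamma_reflection:
  fixes z :: complex assumes "Im z \<noteq> 0"
  shows "Digamma (1 - z) - Digamma z = pi * cot (pi * z)"
proof -
  have nI: "z \<notin> \<int>\<^sub>\<le>\<^sub>0" "1 - z \<notin> \<int>\<^sub>\<le>\<^sub>0"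
    using assms by (auto elim!: nonpos_Ints_cases simp: complex_eq_iff)
  have "((\<lambda>z. rGamma z * rGamma (1 - z)) has_field_derivative
         (-rGamma z * Digamma z) * rGamma (1 - z) + (- rGamma (1 - z) * Digamma (1 - z)) * (-1) * rGamma z) (at z)"
    using nI by (auto intro!: derivative_eq_intros)
  moreover have "(\<lambda>z. rGamma z * rGamma (1 - z)) = (\<lambda>z::complex. sin (pi * z) / pi)"
    using rGamma_reflection_complex by (auto simp: fun_eq_iff)
  moreover have "((\<lambda>z. sin (pi * z) / pi) has_field_derivative cos (pi * z)) (at z)"
    by (auto intro!: derivative_eq_intros)
  ultimately have "(-rGamma z * Digamma z) * rGamma (1 - z) + rGamma (1 - z) * Digamma (1 - z) * rGamma z = cos (pi * z)"
    using DERIV_unique by fastforce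
  hence "(rGamma z * rGamma (1 - z)) * (Digamma (1 - z) - Digamma z) = cos (pi * z)"
    by (simp add: algebra_simps)
  hence "sin (pi * z) / pi * (Digamma (1 - z) - Digamma z) = cos (pi * z)"
    using rGamma_reflection_complex[of z] by simp
  thus ?thesis using sin_nonzero_nonreal[OF assms] by (simp add: cot_def field_simps)
qed

text \<open>
  These are the two series in the reflection formula for the Digamma function. Shifting the index of
  one of them by one, which costs a telescoping series, pairs the poles at \<open>k\<close> and \<open>- k\<close>.
\<close>
lemma pi_cot_sums:
  fixes z :: complex assumes "Im z \<noteq> 0"
  shows "(\<lambda>k. 1 / (z + of_nat (Suc k)) + 1 / (z - of_nat (Suc k))) sums (pi * cot (pi * z) - 1 / z)"
proof -
  have nz: "z \<noteq> 0" "1 - z \<noteq> 0" using assms by (auto simp: complex_eq_iff)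
  have D: "(\<lambda>n. inverse (of_nat (Suc n)) - inverse (w + of_nat n)) sums (Digamma w + euler_mascheroni)"
    if "w \<noteq> 0" for w :: complex
    using summable_Digamma[OF that] by (simp add: Digamma_def summable_sums)
  from sums_diff[OF D[OF nz(2)] D[OF nz(1)]]
  have A: "(\<lambda>n. 1 / (z + of_nat n) - 1 / (1 - z + of_nat n)) sums (pi * cot (pi * z))"
    using Digamma_reflection[OF assms] by (simp add: field_simps)
  have "(\<lambda>n. (\<lambda>n. 1 / (z + of_nat n)) (Suc n) - (\<lambda>n. 1 / (z + of_nat n)) n) sums (0 - 1 / (z + of_nat 0))"
    by (rule telescope_sums)
       (use tendsto_add_filterlim_at_infinity[OF tendsto_const tendsto_of_nat, of z] in
         \<open>auto intro: tendsto_divide_0 tendsto_const\<close>)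
  from sums_add[OF A this]
  have "(\<lambda>n. 1 / (z + of_nat n) - 1 / (1 - z + of_nat n) + (1 / (z + of_nat (Suc n)) - 1 / (z + of_nat n)))
     sums (pi * cot (pi * z) - 1 / z)" by simp
  moreover have "1 / (z + of_nat n) - 1 / (1 - z + of_nat n) + (1 / (z + of_nat (Suc n)) - 1 / (z + of_nat n))
     = 1 / (z + of_nat (Suc n)) + 1 / (z - of_nat (Suc n))" for n
  proof -
    have "z - of_nat (Suc n) = - (1 - z + of_nat n)" by simp
    hence *: "1 / (z - of_nat (Suc n)) = - (1 / (1 - z + of_nat n))"
      by (simp only: minus_divide_right [symmetric])
    show ?thesis unfolding * by simp
  qed
  ultimately show ?thesis by (simp only:)
qed

text \<open>
  The termwise derivative of the previous expansion, justified by the differentiability of the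
  polygamma functions.
\<close>
lemma pi_csc_sq_sums:
  fixes z :: complex assumes "Im z \<noteq> 0"
  shows "(\<lambda>k. 1 / (z + of_nat (Suc k))^2 + 1 / (z - of_nat (Suc k))^2) sums (pi^2 / sin (pi * z)^2 - 1 / z^2)"
proof -
  have nz: "z \<noteq> 0" "1 - z \<noteq> 0" using assms by (auto simp: complex_eq_iff)
  have nI: "z \<notin> \<int>\<^sub>\<le>\<^sub>0" "1 - z \<notin> \<int>\<^sub>\<le>\<^sub>0"
    using assms by (auto elim!: nonpos_Ints_cases simp: complex_eq_iff)
  have op: "open {z. Im z \<noteq> 0}"
    by (intro open_Collect_neq continuous_intros)
  have "((\<lambda>z. Digamma (1 - z) - Digamma z) has_field_derivative - Polygamma 1 (1 - z) - Polygamma 1 z) (at z)"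
    using nI by (auto intro!: derivative_eq_intros)
  hence 1: "((\<lambda>z. pi * cot (pi * z)) has_field_derivative - Polygamma 1 (1 - z) - Polygamma 1 z) (at z)"
    by (rule has_field_derivative_transform_within_open[OF _ op]) (use assms Digamma_reflection in auto)
  have 2: "((\<lambda>z. pi * cot (pi * z)) has_field_derivative (-(pi^2 / sin (pi * z)^2))) (at z)"
    by (rule derivative_eq_intros DERIV_chain2[OF DERIV_cot] sin_nonzero_nonreal[OF assms] refl)+
       (simp add: power2_eq_square field_simps)
  have E: "Polygamma 1 z + Polygamma 1 (1 - z) = pi^2 / sin (pi * z)^2"
    using DERIV_unique[OF 1 2] by (metis (no_types) add.commute add.inverse_inverse diff_conv_add_uminus minus_add_distrib)
  have P: "(\<lambda>k. 1 / (w + of_nat k)^2) sums (Polygamma 1 w)" if "w \<noteq> 0" for w :: complex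
    using Polygamma_LIMSEQ[OF that, of 1] by (simp add: inverse_eq_divide power2_eq_square)
  from sums_add[OF P[OF nz(1)] P[OF nz(2)]]
  have A: "(\<lambda>k. 1 / (z + of_nat k)^2 + 1 / (1 - z + of_nat k)^2) sums (pi^2 / sin (pi * z)^2)"
    using E by simp
  have "(\<lambda>n. (\<lambda>n. 1 / (z + of_nat n)^2) (Suc n) - (\<lambda>n. 1 / (z + of_nat n)^2) n) sums (0 - 1 / (z + of_nat 0)^2)"
    by (rule telescope_sums)
       (use summable_LIMSEQ_zero[OF sums_summable[OF P[OF nz(1)]]] in simp)
  from sums_add[OF A this]
  have "(\<lambda>k. 1 / (z + of_nat k)^2 + 1 / (1 - z + of_nat k)^2 + (1 / (z + of_nat (Suc k))^2 - 1 / (z + of_nat k)^2))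
     sums (pi^2 / sin (pi * z)^2 - 1 / z^2)" by simp
  moreover have "1 / (z + of_nat k)^2 + 1 / (1 - z + of_nat k)^2 + (1 / (z + of_nat (Suc k))^2 - 1 / (z + of_nat k)^2)
    = 1 / (z + of_nat (Suc k))^2 + 1 / (z - of_nat (Suc k))^2" for k
    using power2_commute[of "1 + of_nat k" z] by (simp add: algebra_simps)
  ultimately show ?thesis by (simp only:)
qed

lemma pi_csc_sq_conv_nome:
  fixes z :: complex
  assumes "Im z \<noteq> 0"
  shows "pi^2 / sin (pi * z)^2 = - 4 * pi^2 * nome z / (1 - nome z)^2"
proof -
  define e where "e = exp (\<i> * (pi * z))"
  have e0: "e \<noteq> 0" by (simp add: e_def)
  have n: "nome z = e^2" by (simp add: nome_def e_def power2_eq_square flip: exp_add) (simp add: algebra_simps)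
  have s: "sin (pi * z) = (e - 1 / e) / (2 * \<i>)"
    by (simp add: sin_exp_eq e_def exp_minus field_simps)
  have sn: "sin (pi * z) \<noteq> 0" using sin_nonzero_nonreal[OF assms] .
  hence "1 - e^2 \<noteq> 0" using s e0 by (auto simp: field_simps power2_eq_square)
  thus ?thesis unfolding n s using e0 by (simp add: field_simps power2_eq_square) (simp add: algebra_simps)?
qed

lemma norm_nome: "norm (nome z) = exp (- 2 * pi * Im z)"
  by (simp add: nome_def)

lemma norm_nome_less_1: "Im z > 0 \<Longrightarrow> norm (nome z) < 1"
  by (simp add: norm_nome)

lemma nome_mult_nat: "nome (of_nat n * z) = nome z ^ n"
  by (simp add: nome_def mult_ac flip: exp_of_nat_mult)

lemma cot_conv_nome:
  fixes z :: complex
  assumes "Im z > 0"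
  shows "cot (pi * z) = - \<i> * (1 + nome z) / (1 - nome z)"
proof -
  define e where "e = exp (\<i> * (pi * z))"
  have e0: "e \<noteq> 0" by (simp add: e_def)
  have n: "nome z = e^2" by (simp add: nome_def e_def power2_eq_square flip: exp_add) (simp add: algebra_simps)
  have s: "sin (pi * z) = (e - 1 / e) / (2 * \<i>)"
    by (simp add: sin_exp_eq e_def exp_minus field_simps)
  have c: "cos (pi * z) = (e + 1 / e) / 2"
    by (simp add: cos_exp_eq e_def exp_minus field_simps)
  have sn: "sin (pi * z) \<noteq> 0" using sin_nonzero_nonreal assms by auto
  have "1 - e^2 \<noteq> 0" using s e0 sn by (auto simp: field_simps power2_eq_square)
  thus ?thesis unfolding n cot_def s c using e0 sn[unfolded s]
    by (simp add: divide_simps power2_eq_square) (auto simp: algebra_simps)?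
qed

text \<open>
  Fubini's theorem in the form in which it is used below: the row sums and the column sums are found
  by separate means, and absolute convergence equates their totals.
\<close>
lemma double_sums_swap:
  fixes F :: "nat \<Rightarrow> nat \<Rightarrow> complex"
  assumes S: "(\<lambda>(m, n). norm (F m n)) summable_on UNIV \<times> UNIV"
    and r: "\<And>m. F m sums r m" and c: "\<And>n. (\<lambda>m. F m n) sums c n"
    and R: "r sums R"
  shows "c sums R"
proof -
  have S': "(\<lambda>(m, n). F m n) summable_on UNIV \<times> UNIV"
    using S abs_summable_summable[of "\<lambda>(m, n). F m n" "UNIV \<times> UNIV"] by (simp add: case_prod_unfold)
  have row: "(F m has_sum r m) UNIV" for m
  proof -
    have "(F m has_sum infsum (F m) UNIV) UNIV"
      by (rule has_sum_infsum, rule summable_on_SigmaD1[where f = F and A = UNIV, OF S']) simp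
    moreover have "infsum (F m) UNIV = r m"
      by (rule sums_unique2[OF has_sum_imp_sums[OF calculation] r])
    ultimately show ?thesis by simp
  qed
  have S'': "(\<lambda>(n, m). F m n) summable_on UNIV \<times> UNIV"
    using S' summable_on_swap[of "\<lambda>(m, n). F m n" UNIV UNIV] by simp
  have col: "((\<lambda>m. F m n) has_sum c n) UNIV" for n
  proof -
    have "((\<lambda>m. F m n) has_sum infsum (\<lambda>m. F m n) UNIV) UNIV"
      by (rule has_sum_infsum, rule summable_on_SigmaD1[where f = "\<lambda>n m. F m n" and A = UNIV, OF S'']) simp
    moreover have "infsum (\<lambda>m. F m n) UNIV = c n"
      by (rule sums_unique2[OF has_sum_imp_sums[OF calculation] c])
    ultimately show ?thesis by simp
  qed
  obtain T where T: "((\<lambda>(m, n). F m n) has_sum T) (UNIV \<times> UNIV)"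
    using S' by (auto simp: summable_on_def)
  have "(r has_sum T) UNIV"
    by (rule has_sum_SigmaD[OF T]) (use row in simp)
  hence "T = R" using R has_sum_imp_sums sums_unique2 by blast
  have "((\<lambda>(n, m). F m n) has_sum T) (UNIV \<times> UNIV)"
    using T has_sum_swap[where f = "\<lambda>(m, n). F m n" and S = T and A = UNIV and B = UNIV] by simp
  hence "(c has_sum T) UNIV" by (rule has_sum_SigmaD) (use col in simp)
  thus ?thesis using \<open>T = R\<close> has_sum_imp_sums by blast
qed


section \<open>Lambert series\<close>

lemma power_Suc_mult_Suc: "(q :: 'a :: monoid_mult) ^ (Suc m * Suc k) = q ^ Suc k * (q ^ Suc k) ^ m"
  by (metis mult.commute power_Suc power_mult)

lemma lambert_summable:
  fixes q :: complex assumes q: "norm q < 1"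
  shows "(\<lambda>(m, k). norm (of_nat (Suc k) * q ^ (Suc m * Suc k))) summable_on (UNIV \<times> UNIV :: (nat \<times> nat) set)"
proof -
  define r where "r = norm q"
  have r: "0 \<le> r" "r < 1" using q by (auto simp: r_def)
  have rk: "r ^ Suc k \<le> r" for k using power_decreasing[of 1 "Suc k" r] r by simp
  have inner: "((\<lambda>m. real (Suc k) * r ^ (Suc m * Suc k)) has_sum (real (Suc k) * (r ^ Suc k / (1 - r ^ Suc k)))) UNIV" for k
  proof (rule sums_nonneg_imp_has_sum)
    have "(\<lambda>m. (r ^ Suc k) ^ m) sums (1 / (1 - r ^ Suc k))"
      by (rule geometric_sums) (use rk[of k] r in simp)
    from sums_mult[OF this, of "real (Suc k) * r ^ Suc k"]
    show "(\<lambda>m. real (Suc k) * r ^ (Suc m * Suc k)) sums (real (Suc k) * (r ^ Suc k / (1 - r ^ Suc k)))"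
      unfolding power_Suc_mult_Suc by (simp add: mult_ac)
  qed (use r in auto)
  have outer: "(\<lambda>k. real (Suc k) * (r ^ Suc k / (1 - r ^ Suc k))) summable_on UNIV"
  proof (rule summable_nonneg_imp_summable_on)
    have "summable (\<lambda>k. real (Suc k) * r ^ k * (1 / (1 - r)))"
      by (intro summable_mult2 sums_summable[OF geometric_deriv_sums]) (use r in simp)
    thus "summable (\<lambda>k. real (Suc k) * (r ^ Suc k / (1 - r ^ Suc k)))"
    proof (rule summable_comparison_test_ev[rotated])
      have "norm (real (Suc k) * (r ^ Suc k / (1 - r ^ Suc k))) \<le> real (Suc k) * r ^ k * (1 / (1 - r))" for k
      proof -
        have "r ^ Suc k / (1 - r ^ Suc k) \<le> r ^ k / (1 - r)"
          by (rule frac_le) (use rk[of k] r power_decreasing[of k "Suc k" r] in auto)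
        moreover have "0 \<le> r ^ Suc k / (1 - r ^ Suc k)" using rk[of k] r by auto
        ultimately show ?thesis
          using mult_left_mono[of "r ^ Suc k / (1 - r ^ Suc k)" "r ^ k / (1 - r)" "real (Suc k)"]
          by (simp only: real_norm_def abs_of_nonneg mult_nonneg_nonneg of_nat_0_le_iff) (simp only: mult.assoc times_divide_eq_right mult_1_right)
      qed
      thus "\<forall>\<^sub>F k in sequentially. norm (real (Suc k) * (r ^ Suc k / (1 - r ^ Suc k))) \<le> real (Suc k) * r ^ k * (1 / (1 - r))"
        by simp
    qed
  next
    fix k :: nat
    show "0 \<le> real (Suc k) * (r ^ Suc k / (1 - r ^ Suc k))" using rk[of k] r by auto
  qed
  have "(\<lambda>(k, m). real (Suc k) * r ^ (Suc m * Suc k)) summable_on (UNIV \<times> UNIV :: (nat \<times> nat) set)"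
    by (rule summable_on_SigmaI[where g = "\<lambda>k. real (Suc k) * (r ^ Suc k / (1 - r ^ Suc k))"])
       (use inner outer r in auto)
  hence "(\<lambda>(m, k). real (Suc k) * r ^ (Suc m * Suc k)) summable_on (UNIV \<times> UNIV :: (nat \<times> nat) set)"
    by (subst summable_on_swap) simp
  thus ?thesis by (simp add: norm_mult norm_power r_def del: of_nat_Suc power_Suc mult_Suc mult_Suc_right)
qed

text \<open>
  Collect the terms with \<open>(m + 1) (k + 1) = n + 1\<close>: then \<open>k + 1\<close> runs through the divisors of \<open>n + 1\<close>,
  and their sum is \<open>\<sigma>(n + 1)\<close>.
\<close>
lemma lambert_total:
  fixes q :: complex assumes q: "norm q < 1"
  shows "((\<lambda>(m, k). of_nat (Suc k) * q ^ (Suc m * Suc k)) has_sum (eis_L q + 1 / 24)) (UNIV \<times> UNIV)"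
    and "(\<lambda>n. of_nat (sigma (Suc n)) * q ^ Suc n) sums (eis_L q + 1 / 24)"
proof -
  let ?D = "\<lambda>n. {d. 1 \<le> d \<and> d dvd Suc n}"
  obtain T where T: "((\<lambda>(m, k). of_nat (Suc k) * q ^ (Suc m * Suc k)) has_sum T) (UNIV \<times> UNIV)"
    using abs_summable_summable[of "\<lambda>(m, k). of_nat (Suc k) * q ^ (Suc m * Suc k)"] lambert_summable[OF q]
    by (auto simp: summable_on_def case_prod_unfold)
  have bij: "bij_betw (\<lambda>(m, k). (Suc m * Suc k - 1, Suc k)) (UNIV \<times> UNIV) (Sigma UNIV ?D)"
  proof (rule bij_betwI[where g = "\<lambda>(n, d). (Suc n div d - 1, d - 1)"])
    show "(\<lambda>(m, k). (Suc m * Suc k - 1, Suc k)) \<in> UNIV \<times> UNIV \<rightarrow> Sigma UNIV ?D"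
    proof -
      have "Suc k dvd Suc (Suc m * Suc k - 1)" for m k
      proof -
        have "Suc (Suc m * Suc k - 1) = Suc m * Suc k" by simp
        thus ?thesis by (simp only: dvd_triv_right)
      qed
      thus ?thesis by (simp add: Pi_def split_beta del: mult_Suc mult_Suc_right)
    qed
    show "(\<lambda>(n, d). (Suc n div d - 1, d - 1)) (case x of (m, k) \<Rightarrow> (Suc m * Suc k - 1, Suc k)) = x" for x :: "nat \<times> nat"
    proof (cases x)
      case (Pair m k)
      have "Suc (Suc m * Suc k - 1) = Suc m * Suc k" by simp
      moreover have "(Suc m * Suc k) div Suc k = Suc m" by (rule nonzero_mult_div_cancel_right) simp
      ultimately show ?thesis unfolding Pair by (simp del: mult_Suc mult_Suc_right)
    qed
    show "(case (case y of (n, d) \<Rightarrow> (Suc n div d - 1, d - 1)) of (m, k) \<Rightarrow> (Suc m * Suc k - 1, Suc k)) = y"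
      if "y \<in> Sigma UNIV ?D" for y :: "nat \<times> nat"
    proof (cases y)
      case (Pair n d)
      hence d: "1 \<le> d" "d dvd Suc n" using that by auto
      then obtain e where e: "Suc n = d * e" by auto
      have "Suc n div d = e" unfolding e using d by simp
      moreover obtain d' where d': "d = Suc d'" using d by (cases d) auto
      moreover obtain e' where e': "e = Suc e'" using e by (cases e) auto
      moreover have "n = Suc e' * Suc d' - 1" using e unfolding d' e' by (metis diff_Suc_1 mult.commute)
      ultimately show ?thesis unfolding Pair by (simp del: mult_Suc mult_Suc_right)
    qed
  qed auto
  have "((\<lambda>(n, d). of_nat d * q ^ Suc n) has_sum T) (Sigma UNIV ?D)"
    using has_sum_reindex_bij_betw[OF bij, of "\<lambda>(n, d). of_nat d * q ^ Suc n" T] T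
    by (simp add: case_prod_unfold)
  hence "((\<lambda>n. \<Sum>d\<in>?D n. of_nat d * q ^ Suc n) has_sum T) UNIV"
  proof (rule has_sum_SigmaD)
    fix n :: nat
    have "finite (?D n)" by (rule finite_subset[of _ "{..Suc n}"]) (auto dest: dvd_imp_le)
    thus "((\<lambda>y. case (n, y) of (n, d) \<Rightarrow> of_nat d * q ^ Suc n) has_sum (\<Sum>d\<in>?D n. of_nat d * q ^ Suc n)) (?D n)"
      by (auto intro!: has_sum_finiteI)
  qed
  hence "((\<lambda>n. of_nat (sigma (Suc n)) * q ^ Suc n) has_sum T) UNIV"
    by (simp add: sigma_def sum_distrib_right [symmetric])
  hence S: "(\<lambda>n. of_nat (sigma (Suc n)) * q ^ Suc n) sums T"
    by (rule has_sum_imp_sums)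
  hence "eis_L q + 1 / 24 = T" by (simp add: eis_L_def sums_iff)
  with T S show "((\<lambda>(m, k). of_nat (Suc k) * q ^ (Suc m * Suc k)) has_sum (eis_L q + 1 / 24)) (UNIV \<times> UNIV)"
    and "(\<lambda>n. of_nat (sigma (Suc n)) * q ^ Suc n) sums (eis_L q + 1 / 24)" by simp_all
qed

lemma norm_power_Suc_less_1:
  fixes q :: complex assumes q: "norm q < 1"
  shows "norm (q ^ Suc k) < 1"
  using power_decreasing[of 1 "Suc k" "norm q"] q unfolding norm_power by simp

text \<open>
  Summing the double series over one index or over the other gives two different single series
  for \<open>L\<close>. The first one has the terms that arise from \<open>1 / sin\<^sup>2\<close>, the second one, \<open>lambert_sums\<close>, those
  of the logarithmic derivative of Euler's product.
\<close>
lemma lambert_sums_sq: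
  fixes q :: complex assumes q: "norm q < 1"
  shows "(\<lambda>m. q ^ Suc m / (1 - q ^ Suc m)^2) sums (eis_L q + 1 / 24)"
proof (rule has_sum_imp_sums, rule has_sum_SigmaD[OF lambert_total(1)[OF q]])
  fix m :: nat
  define x where "x = q ^ Suc m"
  have x: "norm x < 1" unfolding x_def by (rule norm_power_Suc_less_1[OF q])
  have "(\<lambda>k. of_nat (Suc k) * x ^ k) sums (1 / (1 - x)^2)" by (rule geometric_deriv_sums[OF x])
  from sums_mult[OF this, of x]
  have s: "(\<lambda>k. of_nat (Suc k) * q ^ (Suc m * Suc k)) sums (q ^ Suc m / (1 - q ^ Suc m)^2)"
    unfolding power_mult x_def[symmetric] by (simp add: mult_ac)
  have "summable (\<lambda>k. norm (of_nat (Suc k) * q ^ (Suc m * Suc k)))"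
  proof -
    have "summable (\<lambda>k. norm x * (of_nat (Suc k) * norm x ^ k))"
      by (intro summable_mult sums_summable[OF geometric_deriv_sums]) (use x in simp)
    thus ?thesis unfolding power_mult x_def[symmetric] by (simp add: norm_mult norm_power mult_ac del: of_nat_Suc)
  qed
  from norm_summable_imp_has_sum[OF this s]
  show "((\<lambda>y. case (m, y) of (m, k) \<Rightarrow> of_nat (Suc k) * q ^ (Suc m * Suc k)) has_sum
          q ^ Suc m / (1 - q ^ Suc m)^2) UNIV" by simp
qed

lemma lambert_sums:
  fixes q :: complex assumes q: "norm q < 1"
  shows "(\<lambda>k. of_nat (Suc k) * q ^ Suc k / (1 - q ^ Suc k)) sums (eis_L q + 1 / 24)"
proof (rule has_sum_imp_sums, rule has_sum_SigmaD)
  show "((\<lambda>(k, m). of_nat (Suc k) * q ^ (Suc m * Suc k)) has_sum (eis_L q + 1 / 24)) (UNIV \<times> UNIV)"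
    using lambert_total(1)[OF q] by (subst has_sum_swap) simp
  fix k :: nat
  define x where "x = q ^ Suc k"
  have x: "norm x < 1" unfolding x_def by (rule norm_power_Suc_less_1[OF q])
  have e: "of_nat (Suc k) * q ^ (Suc m * Suc k) = of_nat (Suc k) * x * x ^ m" for m
    unfolding x_def power_Suc_mult_Suc by (simp only: mult.assoc)
  have "(\<lambda>m. x ^ m) sums (1 / (1 - x))" by (rule geometric_sums[OF x])
  from sums_mult[OF this, of "of_nat (Suc k) * x"]
  have s: "(\<lambda>m. of_nat (Suc k) * q ^ (Suc m * Suc k)) sums (of_nat (Suc k) * q ^ Suc k / (1 - q ^ Suc k))"
    unfolding e by (simp add: x_def)
  have "summable (\<lambda>m. norm (of_nat (Suc k) * q ^ (Suc m * Suc k)))"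
  proof -
    have "summable (\<lambda>m. norm (of_nat (Suc k) * x) * norm x ^ m)"
      by (intro summable_mult summable_geometric) (use x in simp)
    thus ?thesis unfolding e by (simp only: norm_mult norm_power)
  qed
  from norm_summable_imp_has_sum[OF this s]
  show "((\<lambda>y. case (k, y) of (k, m) \<Rightarrow> of_nat (Suc k) * q ^ (Suc m * Suc k)) has_sum
          of_nat (Suc k) * q ^ Suc k / (1 - q ^ Suc k)) UNIV" by simp
qed


section \<open>The inversion formula for \<open>L\<close>\<close>

text \<open>
  The imaginary part of \<open>m z + s\<close> bounds \<open>m\<close>, and then the triangle inequality bounds \<open>s\<close>.
\<close>
lemma lattice_lower_bound:
  assumes z: "Im z > 0"
  obtains K where "K > 0" "\<And>m s :: real. m > 0 \<Longrightarrow> m \<le> K * norm (of_real m * z + of_real s)"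
    "\<And>m s :: real. m > 0 \<Longrightarrow> \<bar>s\<bar> \<le> K * norm (of_real m * z + of_real s)"
proof -
  define K where "K = (1 + norm z) / Im z + 1"
  have *: "m \<le> K * norm (of_real m * z + of_real s)" "\<bar>s\<bar> \<le> K * norm (of_real m * z + of_real s)"
    if m: "m > 0" for m s :: real
  proof -
    define w where "w = of_real m * z + of_real s"
    have "m * Im z \<le> norm w"
      using abs_Im_le_cmod[of w] m z by (simp add: w_def)
    hence 1: "m \<le> norm w / Im z" using z by (simp add: field_simps)
    have "\<bar>s\<bar> = norm (w - of_real m * z)" by (simp add: w_def)
    also have "\<dots> \<le> norm w + m * norm z"
      using norm_triangle_ineq4[of w "of_real m * z"] m by (simp add: norm_mult)
    also have "\<dots> \<le> norm w + norm w / Im z * norm z"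
      using mult_right_mono[OF 1, of "norm z"] by simp
    finally have 2: "\<bar>s\<bar> \<le> norm w + norm w / Im z * norm z" .
    have K: "K * norm w = norm w / Im z + norm w / Im z * norm z + norm w"
      by (simp add: K_def field_simps add_divide_distrib)
    have nn: "0 \<le> norm w / Im z * norm z" "0 \<le> norm w / Im z" "0 \<le> norm w" using z by auto
    show "m \<le> K * norm (of_real m * z + of_real s)"
      unfolding w_def[symmetric] K using 1 nn by linarith
    show "\<bar>s\<bar> \<le> K * norm (of_real m * z + of_real s)"
      unfolding w_def[symmetric] K using 2 nn by linarith
  qed
  moreover have "K > 0" using z by (simp add: K_def add_nonneg_pos)
  ultimately show ?thesis using that by blast
qed

text \<open>
  Subtracting \<open>1 / (w - 1/2) - 1 / (w + 1/2)\<close> from \<open>1 / w\<^sup>2\<close> improves the decay from order 2 to order 4, and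
  this makes the sum over a lattice converge absolutely.
\<close>
lemma telescoped_inverse_square_bound:
  fixes w :: complex
  assumes K: "K > 0" and w: "norm w \<ge> a / K" "norm (w - 1/2) \<ge> b / K" "norm (w + 1/2) \<ge> b / K"
    and ab: "a > 0" "b > 0"
  shows "norm (1 / w^2 - 1 / ((w - 1/2) * (w + 1/2))) \<le> K^4 * (1 / (a^2 * b^2))"
proof -
  have p: "0 < a / K" "0 < b / K" using K ab by auto
  have nz: "w \<noteq> 0" "w - 1/2 \<noteq> 0" "w + 1/2 \<noteq> 0"
    using w p using less_le_trans[OF p(1) w(1)] less_le_trans[OF p(2) w(2)] less_le_trans[OF p(2) w(3)]
    unfolding zero_less_norm_iff by blast+
  have "1 / w^2 - 1 / ((w - 1/2) * (w + 1/2)) = ((w - 1/2) * (w + 1/2) - w^2) / (w^2 * ((w - 1/2) * (w + 1/2)))"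
    by (subst diff_frac_eq) (use nz in auto)
  also have "(w - 1/2) * (w + 1/2) - w^2 = - (1/4)"
    by (simp add: algebra_simps power2_eq_square)
  finally have "norm (1 / w^2 - 1 / ((w - 1/2) * (w + 1/2)))
     = (1/4) / ((norm w)^2 * (norm (w - 1/2) * norm (w + 1/2)))"
    by (simp add: norm_divide norm_mult norm_power)
  also have "\<dots> \<le> 1 / ((a/K)^2 * ((b/K) * (b/K)))"
    by (intro frac_le mult_mono power_mono mult_pos_pos zero_less_power w p mult_nonneg_nonneg zero_le_power)
       (use p in auto)
  also have "\<dots> = K^4 * (1 / (a^2 * b^2))"
    using K ab by (simp add: field_simps power2_eq_square eval_nat_numeral)
  finally show ?thesis .
qed

text \<open>
  Let \<open>B(m, n) = (m z + n)\<^sup>-\<^sup>2 + (m z - n)\<^sup>-\<^sup>2\<close> for positive \<open>m\<close> and \<open>n\<close>. By the partial fractions of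
  \<open>1 / sin\<^sup>2\<close>, summing \<open>B\<close> over \<open>n\<close> first produces \<open>L(z)\<close>, and summing over \<open>m\<close> first produces \<open>L(-1/z)\<close>.
  The two iterated sums differ, as \<open>B\<close> is not absolutely summable. Subtracting the
  telescoping terms of the previous lemma leaves an absolutely summable \<open>F\<close>, so the difference of the
  iterated sums of \<open>B\<close> is that of the telescoping terms. They are governed by
  \<open>h(s) = z' (\<pi> cot(\<pi> s z') - 1 / (s z'))\<close> with \<open>z' = -1/z\<close>: summing over \<open>n\<close> first leaves \<open>h(1/2)\<close>, while
  summing over \<open>m\<close> first leaves \<open>h(1/2)\<close> minus the limit of \<open>h\<close> at infinity. As the cotangent tends to \<open>- \<i>\<close>,
  that limit is \<open>- \<i> \<pi> z'\<close>, which is the source of the non-modular term.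
\<close>
lemma eis_L_inversion:
  assumes z: "Im z > 0"
  shows "eis_L (nome (- 1 / z)) = z^2 * eis_L (nome z) + \<i> * z / (4 * pi)"
proof -
  define z' where "z' = - 1 / z"
  have z0: "z \<noteq> 0" using z by auto
  have z': "Im z' > 0" using z z0 by (simp add: z'_def Im_divide')
  have z'0: "z' \<noteq> 0" using z' by auto
  (* F is B minus the telescoping terms, which are differences of values of t; summing t s over m gives h s. *)
  define T :: "complex \<Rightarrow> complex" where "T = (\<lambda>w. 1 / w^2 - 1 / ((w - 1/2) * (w + 1/2)))"
  define F where "F = (\<lambda>m n. T (of_nat (Suc m) * z + of_nat (Suc n)) + T (of_nat (Suc m) * z - of_nat (Suc n)))"
  define h where "h = (\<lambda>s::real. z' * (pi * cot (pi * (s * z')) - 1 / (s * z')))"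
  define t where "t = (\<lambda>(s::real) m. 1 / (of_nat (Suc m) * z + s) - 1 / (of_nat (Suc m) * z - s))"

  have summable: "(\<lambda>(m, n). norm (F m n)) summable_on UNIV \<times> UNIV"
  proof -
    obtain K where K: "K > 0" "\<And>m s :: real. m > 0 \<Longrightarrow> m \<le> K * norm (of_real m * z + of_real s)"
      "\<And>m s :: real. m > 0 \<Longrightarrow> \<bar>s\<bar> \<le> K * norm (of_real m * z + of_real s)"
      using lattice_lower_bound[OF z] by metis
    define a where "a = (\<lambda>n. 1 / real (Suc n)^2)"
    have bound: "norm (F m n) \<le> 8 * K^4 * (a m * a n)" for m n
    proof -
      define M N where "M = real (Suc m)" and "N = real (Suc n)"
      have MN: "M > 0" "N \<ge> 1" by (auto simp: M_def N_def)
      have c: "of_nat (Suc m) = of_real M" "of_nat (Suc n) = (of_real N :: complex)"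
        by (auto simp: M_def N_def)
      have lb: "norm (of_real M * z + of_real s) \<ge> M / K" "norm (of_real M * z + of_real s) \<ge> \<bar>s\<bar> / K" for s
        using K(2)[OF MN(1), of s] K(3)[OF MN(1), of s] K(1) by (auto simp: field_simps)
      (* The shifts s used below are N or - N up to 1/2, so their modulus is at least N / 2. *)
      have lbN: "norm (of_real M * z + of_real s) \<ge> (N/2) / K" if "\<bar>s\<bar> \<ge> N/2" for s
        using lb(2)[of s] divide_right_mono[OF that, of K] K(1) by linarith
      have 1: "norm (T (of_real M * z + of_real N)) \<le> K^4 * (1 / (M^2 * (N/2)^2))"
        unfolding T_def
      proof (rule telescoped_inverse_square_bound)
        show "norm (of_real M * z + of_real N - 1/2) \<ge> (N/2) / K"
          using lbN[of "N - 1/2"] MN by (simp add: algebra_simps)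
        show "norm (of_real M * z + of_real N + 1/2) \<ge> (N/2) / K"
          using lbN[of "N + 1/2"] MN by (simp add: algebra_simps)
      qed (use lb MN K in auto)
      have 2: "norm (T (of_real M * z - of_real N)) \<le> K^4 * (1 / (M^2 * (N/2)^2))"
        unfolding T_def
      proof (rule telescoped_inverse_square_bound)
        show "norm (of_real M * z - of_real N - 1/2) \<ge> (N/2) / K"
          using lbN[of "- N - 1/2"] MN by (simp add: algebra_simps)
        show "norm (of_real M * z - of_real N + 1/2) \<ge> (N/2) / K"
          using lbN[of "- N + 1/2"] MN by (simp add: algebra_simps)
        show "norm (of_real M * z - of_real N) \<ge> M / K"
          using lb(1)[of "- N"] by simp
      qed (use MN K in auto)
      have "norm (F m n) \<le> norm (T (of_real M * z + of_real N)) + norm (T (of_real M * z - of_real N))"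
        unfolding F_def c by (rule norm_triangle_ineq)
      also have "\<dots> \<le> 2 * (K^4 * (1 / (M^2 * (N/2)^2)))" using 1 2 by linarith
      also have "\<dots> = 8 * K^4 * (a m * a n)"
        by (simp add: a_def M_def N_def power_divide)
      finally show ?thesis .
    qed
    have sa: "a summable_on UNIV"
      by (rule summable_nonneg_imp_summable_on)
         (use sums_summable[OF inverse_squares_sums] in \<open>auto simp: a_def add_ac\<close>)
    have "(\<lambda>(m, n). 8 * K^4 * (a m * a n)) summable_on UNIV \<times> UNIV"
    proof (rule summable_on_SigmaI)
      fix m :: nat
      have "((\<lambda>n. 8 * K^4 * a m * a n) has_sum 8 * K^4 * a m * infsum a UNIV) UNIV"
        by (intro has_sum_cmult_right has_sum_infsum sa)
      thus "((\<lambda>n. case (m, n) of (m, n) \<Rightarrow> 8 * K^4 * (a m * a n)) has_sum 8 * K^4 * a m * infsum a UNIV) UNIV"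
        by (simp add: mult_ac)
      show "(\<lambda>m. 8 * K^4 * a m * infsum a UNIV) summable_on UNIV"
        by (intro summable_on_cmult_left summable_on_cmult_right sa)
    qed (auto simp: a_def)
    thus ?thesis
      by (rule summable_on_comparison_test) (use bound in auto)
  qed

  have tel: "1 / ((w - 1/2) * (w + 1/2)) = 1 / (w - 1/2) - 1 / (w + 1/2)" if "w \<noteq> 1/2" "w \<noteq> -1/2" for w :: complex
  proof -
    have "w - 1/2 \<noteq> 0" "w + 1/2 \<noteq> 0" using that by (auto simp: add_eq_0_iff2)
    thus ?thesis by (simp add: diff_frac_eq)
  qed
  have imn: "of_nat (Suc m) * z + of_real s \<noteq> of_real u" for m s u
    using z by (auto simp: complex_eq_iff)
  have Fsplit: "F m n = (1 / (of_nat (Suc m) * z + of_nat (Suc n))^2 + 1 / (of_nat (Suc m) * z - of_nat (Suc n))^2)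
        - (t (real n + 1/2) m - t (real (Suc n) + 1/2) m)" for m n
  proof -
    let ?w = "of_nat (Suc m) * z"
    (* Rewriting the half-integral shifts so that the partial fractions match syntactically. *)
    have half: "?w + of_real (real n + 1/2) = ?w + of_nat (Suc n) - 1/2"
      "?w - of_real (real n + 1/2) = ?w - of_nat (Suc n) + 1/2"
      "?w + of_real (real (Suc n) + 1/2) = ?w + of_nat (Suc n) + 1/2"
      "?w - of_real (real (Suc n) + 1/2) = ?w - of_nat (Suc n) - 1/2"
      by simp_all
    have "1 / ((?w + of_nat (Suc n) - 1/2) * (?w + of_nat (Suc n) + 1/2))
        = 1 / (?w + of_nat (Suc n) - 1/2) - 1 / (?w + of_nat (Suc n) + 1/2)"
      using imn[of m "real (Suc n)" "1/2"] imn[of m "real (Suc n)" "-1/2"] by (intro tel) (auto simp del: of_nat_Suc)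
    moreover have "1 / ((?w - of_nat (Suc n) - 1/2) * (?w - of_nat (Suc n) + 1/2))
        = 1 / (?w - of_nat (Suc n) - 1/2) - 1 / (?w - of_nat (Suc n) + 1/2)"
      using imn[of m "- real (Suc n)" "1/2"] imn[of m "- real (Suc n)" "-1/2"] by (intro tel) (auto simp del: of_nat_Suc)
    ultimately show ?thesis
      unfolding F_def T_def t_def half by simp
  qed

  have tlim: "(\<lambda>n. t (real n + 1/2) m) \<longlonglongrightarrow> 0" for m
  proof -
    let ?w = "of_nat (Suc m) * z"
    have "(\<lambda>n. 1 / ((?w + 1/2) + of_nat n) - 1 / ((?w - 1/2) - of_nat n)) \<longlonglongrightarrow> 0 - 0"
    proof (intro tendsto_diff tendsto_divide_0[OF tendsto_const])
      show "filterlim (\<lambda>n. (?w + 1/2) + of_nat n) at_infinity sequentially"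
        by (rule tendsto_add_filterlim_at_infinity[OF tendsto_const tendsto_of_nat])
      have "filterlim (\<lambda>n. of_nat n - (?w - 1/2)) at_infinity sequentially"
        unfolding diff_conv_add_uminus[of _ "?w - 1/2"] add.commute[of _ "- (?w - 1/2)"]
        by (rule tendsto_add_filterlim_at_infinity[OF tendsto_const tendsto_of_nat])
      thus "filterlim (\<lambda>n. (?w - 1/2) - of_nat n) at_infinity sequentially"
        unfolding filterlim_at_infinity_conv_norm_at_top by (subst norm_minus_commute)
    qed
    thus ?thesis by (simp add: t_def algebra_simps)
  qed

  have row: "F m sums (- 4 * pi^2 * (nome z ^ Suc m / (1 - nome z ^ Suc m)^2) - 1 / (of_nat (Suc m) * z)^2 - t (1/2) m)" for m
  proof -
    let ?w = "of_nat (Suc m) * z"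
    have w: "Im ?w \<noteq> 0" using z by simp
    have 1: "(\<lambda>n. 1 / (?w + of_nat (Suc n))^2 + 1 / (?w - of_nat (Suc n))^2) sums
       (- 4 * pi^2 * (nome z ^ Suc m / (1 - nome z ^ Suc m)^2) - 1 / ?w^2)"
      using pi_csc_sq_sums[OF w] unfolding pi_csc_sq_conv_nome[OF w] nome_mult_nat by (simp add: mult.assoc)
    have "(\<lambda>n. t (real n + 1/2) m - t (real (Suc n) + 1/2) m) sums (t (real 0 + 1/2) m - 0)"
      by (rule telescope_sums'[OF tlim])
    from sums_diff[OF 1 this] show ?thesis unfolding Fsplit[symmetric] by simp
  qed

  have hsums: "t s sums h s" for s
  proof (cases "s = 0")
    case True thus ?thesis by (simp add: t_def h_def cot_def)
  next
    case False
    let ?u = "of_real s * z'"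
    have u: "Im ?u \<noteq> 0" using z' False by simp
    from sums_mult[OF pi_cot_sums[OF u], of z']
    have "(\<lambda>k. z' * (1 / (?u + of_nat (Suc k)) + 1 / (?u - of_nat (Suc k)))) sums h s"
      by (simp add: h_def)
    moreover have "z' * (1 / (?u + of_nat (Suc k)) + 1 / (?u - of_nat (Suc k))) = t s k" for k
    proof -
      have a: "?u + of_nat (Suc k) = z' * (s - of_nat (Suc k) * z)" "?u - of_nat (Suc k) = z' * (s + of_nat (Suc k) * z)"
        using z0 by (auto simp: z'_def field_simps)
      have c: "z' * (1 / (z' * x)) = 1 / x" for x using z'0 by simp
      have "1 / (s - of_nat (Suc k) * z) = - (1 / (of_nat (Suc k) * z - s))"
        by (subst minus_diff_eq [symmetric]) (rule minus_divide_right [symmetric])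
      thus ?thesis unfolding a distrib_left[of z' "1 / _"] c t_def by (simp add: add.commute)
    qed
    ultimately show ?thesis by (simp only:)
  qed

  have col: "(\<lambda>m. F m n) sums (z'^2 * (- 4 * pi^2 * (nome z' ^ Suc n / (1 - nome z' ^ Suc n)^2)) - 1 / of_nat (Suc n)^2
       - (h (real n + 1/2) - h (real (Suc n) + 1/2)))" for n
  proof -
    let ?w = "of_nat (Suc n) * z'"
    have w: "Im ?w \<noteq> 0" using z' by simp
    have "(\<lambda>m. 1 / (?w + of_nat (Suc m))^2 + 1 / (?w - of_nat (Suc m))^2) sums
       (- 4 * pi^2 * (nome z' ^ Suc n / (1 - nome z' ^ Suc n)^2) - 1 / ?w^2)"
      using pi_csc_sq_sums[OF w] unfolding pi_csc_sq_conv_nome[OF w] nome_mult_nat by (simp add: mult.assoc)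
    from sums_mult[OF this, of "z'^2"]
    have 1: "(\<lambda>m. z'^2 * (1 / (?w + of_nat (Suc m))^2 + 1 / (?w - of_nat (Suc m))^2)) sums
       (z'^2 * (- 4 * pi^2 * (nome z' ^ Suc n / (1 - nome z' ^ Suc n)^2)) - 1 / of_nat (Suc n)^2)"
      using z'0 by (simp add: right_diff_distrib power_mult_distrib del: of_nat_Suc)
    have 2: "z'^2 * (1 / (?w + of_nat (Suc m))^2 + 1 / (?w - of_nat (Suc m))^2) =
       1 / (of_nat (Suc m) * z + of_nat (Suc n))^2 + 1 / (of_nat (Suc m) * z - of_nat (Suc n))^2" for m
    proof -
      have a: "?w + of_nat (Suc m) = z' * (of_nat (Suc n) - of_nat (Suc m) * z)"
              "?w - of_nat (Suc m) = z' * (of_nat (Suc n) + of_nat (Suc m) * z)"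
        using z0 by (auto simp: z'_def field_simps)
      have c: "z'^2 * (1 / (z'^2 * x)) = 1 / x" for x using z'0 by simp
      show ?thesis unfolding a power_mult_distrib distrib_left[of "z'^2" "1 / _"] c
        by (simp add: add.commute power2_commute[of "of_nat (Suc n)" "of_nat (Suc m) * z"] del: of_nat_Suc)
    qed
    from sums_diff[OF 1 sums_diff[OF hsums[of "real n + 1/2"] hsums[of "real (Suc n) + 1/2"]]]
    show ?thesis unfolding 2 Fsplit .
  qed

  have zeta2: "(\<lambda>n. 1 / of_nat (Suc n)^2 :: complex) sums (of_real (pi^2) / 6)"
    using sums_of_real[OF inverse_squares_sums, where 'a = complex] by (simp add: add_ac)
  have rows: "(\<lambda>m. - 4 * pi^2 * (nome z ^ Suc m / (1 - nome z ^ Suc m)^2) - 1 / (of_nat (Suc m) * z)^2 - t (1/2) m)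
     sums (- 4 * pi^2 * (eis_L (nome z) + 1/24) - of_real (pi^2) / 6 * (1 / z^2) - h (1/2))"
    using sums_diff[OF sums_diff[OF sums_mult[OF lambert_sums_sq[OF norm_nome_less_1[OF z]], of "- 4 * pi^2"]
          sums_mult2[OF zeta2, of "1 / z^2"]] hsums[of "1/2"]]
    by (simp add: power_mult_distrib)

  have hlim: "(\<lambda>n. h (real n + 1/2)) \<longlonglongrightarrow> z' * (pi * (- \<i> * (1 + 0) / (1 - 0)) - 0)"
  proof -
    let ?u = "\<lambda>n. of_real (real n + 1/2) * z'"
    have u: "Im (?u n) > 0" for n using z' by simp
    have "filterlim (\<lambda>n. real n + 1/2) at_top sequentially"
      by real_asymp
    hence "filterlim (\<lambda>n. (real n + 1/2) * Im z') at_top sequentially"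
      by (rule filterlim_at_top_mult_tendsto_pos[OF tendsto_const z'])
    hence il: "filterlim (\<lambda>n. Im (?u n)) at_top sequentially" by simp
    have "(\<lambda>n. exp (- (2 * pi * Im (?u n)))) \<longlonglongrightarrow> 0"
      by (rule filterlim_compose[OF exp_at_bot])
         (intro filterlim_uminus_at_bot_at_top[THEN filterlim_compose] filterlim_tendsto_pos_mult_at_top[OF tendsto_const _ il], simp)
    hence n0: "(\<lambda>n. nome (?u n)) \<longlonglongrightarrow> 0"
      by (subst tendsto_norm_zero_iff[symmetric]) (simp add: norm_nome mult.assoc)
    have "filterlim (\<lambda>n. norm (?u n)) at_top sequentially"
      by (rule filterlim_at_top_mono[OF il]) (intro always_eventually allI, rule order.trans[OF abs_ge_self abs_Im_le_cmod])
    hence "(\<lambda>n. 1 / ?u n) \<longlonglongrightarrow> 0"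
      by (intro tendsto_divide_0[OF tendsto_const]) (simp add: filterlim_at_infinity_conv_norm_at_top)
    hence "(\<lambda>n. z' * (pi * (- \<i> * (1 + nome (?u n)) / (1 - nome (?u n))) - 1 / ?u n)) \<longlonglongrightarrow> z' * (pi * (- \<i> * (1 + 0) / (1 - 0)) - 0)"
      by (intro tendsto_intros n0) auto
    thus ?thesis unfolding h_def using cot_conv_nome[OF u] by (simp only:)
  qed
  have cols: "(\<lambda>n. z'^2 * (- 4 * pi^2 * (nome z' ^ Suc n / (1 - nome z' ^ Suc n)^2)) - 1 / of_nat (Suc n)^2
       - (h (real n + 1/2) - h (real (Suc n) + 1/2)))
     sums (z'^2 * (- 4 * pi^2 * (eis_L (nome z') + 1/24)) - of_real (pi^2) / 6
       - (h (real 0 + 1/2) - z' * (pi * (- \<i> * (1 + 0) / (1 - 0)) - 0)))"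
    by (intro sums_diff sums_mult lambert_sums_sq norm_nome_less_1 z' zeta2 telescope_sums' hlim)
  have "- 4 * pi^2 * (eis_L (nome z) + 1/24) - of_real (pi^2) / 6 * (1 / z^2) - h (1/2)
     = z'^2 * (- 4 * pi^2 * (eis_L (nome z') + 1/24)) - of_real (pi^2) / 6
       - (h (real 0 + 1/2) - z' * (pi * (- \<i> * (1 + 0) / (1 - 0)) - 0))"
    by (rule sums_unique2[OF double_sums_swap[OF summable row col rows] cols])
  moreover have "1 / z^2 = z'^2" by (simp add: z'_def power_divide)
  ultimately have "- 4 * pi^2 * (eis_L (nome z) + 1/24) - of_real (pi^2) / 6 * z'^2 - h (1/2)
     = z'^2 * (- 4 * pi^2 * (eis_L (nome z') + 1/24)) - of_real (pi^2) / 6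
       - (h (1/2) + \<i> * z' * pi)" by simp
  hence "- 4 * pi^2 * eis_L (nome z) = z'^2 * (- 4 * pi^2 * eis_L (nome z')) - \<i> * z' * pi"
    by (simp add: algebra_simps)
  moreover have "4 * pi^2 * (\<i> * z' / (4 * pi)) = \<i> * z' * pi"
    by (simp add: field_simps power2_eq_square)
  ultimately have "4 * pi^2 * (eis_L (nome z') * z'^2) = 4 * pi^2 * (eis_L (nome z) - \<i> * z' / (4 * pi))"
    unfolding right_diff_distrib by (simp add: algebra_simps)
  hence "eis_L (nome z') * z'^2 = eis_L (nome z) - \<i> * z' / (4 * pi)"
    by simp
  thus ?thesis using z0 by (simp add: z'_def field_simps power2_eq_square)
qed

section \<open>The eta function\<close>

definition euler_prod :: "complex \<Rightarrow> complex" where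
  "euler_prod q = (\<Prod>n. 1 - q ^ Suc n)"

lemma euler_factor_nonzero:
  fixes q :: complex assumes "norm q < 1" shows "1 - q ^ Suc n \<noteq> 0"
  using norm_power_Suc_less_1[OF assms, of n] by auto

lemma euler_prod_convergent:
  fixes q :: complex
  assumes "norm q < 1"
  shows "abs_convergent_prod (\<lambda>n. 1 - q ^ Suc n)" "convergent_prod (\<lambda>n. 1 - q ^ Suc n)"
proof -
  have "summable (\<lambda>n. norm q * norm q ^ n)"
    by (intro summable_mult summable_geometric) (use assms in simp)
  moreover have "norm (1 - q ^ Suc n - 1) = norm q * norm q ^ n" for n
    by (simp add: norm_mult norm_power)
  ultimately show "abs_convergent_prod (\<lambda>n. 1 - q ^ Suc n)"
    unfolding abs_convergent_prod_conv_summable by (simp only:)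
  thus "convergent_prod (\<lambda>n. 1 - q ^ Suc n)"
    by (rule abs_convergent_prod_imp_convergent_prod)
qed

lemma euler_prod_LIMSEQ:
  assumes "norm q < 1"
  shows "(\<lambda>n. \<Prod>k<n. 1 - q ^ Suc k) \<longlonglongrightarrow> euler_prod q"
  using convergent_prod_LIMSEQ[OF euler_prod_convergent(2)[OF assms]]
  unfolding euler_prod_def by (simp add: LIMSEQ_lessThan_iff_atMost)

lemma euler_prod_nonzero: "norm q < 1 \<Longrightarrow> euler_prod q \<noteq> 0"
  unfolding euler_prod_def by (intro prodinf_nonzero euler_prod_convergent euler_factor_nonzero)

lemma euler_prod_uniform_limit:
  assumes r: "r < 1"
  shows "uniform_limit (cball 0 r) (\<lambda>n q. \<Prod>k<n. 1 - q ^ Suc k) euler_prod sequentially"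
proof (cases "r \<ge> 0")
  case False
  thus ?thesis by simp
next
  case True
  have "uniformly_convergent_on (cball 0 r) (\<lambda>n q. \<Prod>k<n. 1 - q ^ Suc k :: complex)"
  proof (rule uniformly_convergent_on_prod')
    have "uniformly_convergent_on (cball 0 r) (\<lambda>N q. \<Sum>n<N. norm ((q :: complex) ^ Suc n))"
    proof (rule Weierstrass_m_test')
      show "norm (norm (q ^ Suc n)) \<le> r ^ Suc n" if "q \<in> cball 0 r" for n and q :: complex
        using that by (simp add: norm_power power_mono del: power_Suc)
      show "summable (\<lambda>n. r ^ Suc n)"
        using True r by (simp add: summable_mult summable_geometric)
    qed
    thus "uniformly_convergent_on (cball 0 r) (\<lambda>N q. \<Sum>n<N. norm (1 - (q :: complex) ^ Suc n - 1))"
      by simp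
  qed (auto intro!: continuous_intros)
  then obtain f where f: "uniform_limit (cball 0 r) (\<lambda>n q. \<Prod>k<n. 1 - q ^ Suc k :: complex) f sequentially"
    by (auto simp: uniformly_convergent_on_def)
  have "f q = euler_prod q" if "q \<in> cball 0 r" for q
    using LIMSEQ_unique[OF tendsto_uniform_limitI[OF f that] euler_prod_LIMSEQ[of q]] that r by simp
  thus ?thesis using f by (subst uniform_limit_cong'[of _ _ _ _ f]) auto
qed

text \<open>
  Locally uniform convergence allows the product to be differentiated logarithmically factor by
  factor, and the result is a Lambert series. Multiplying the equation by \<open>q\<close> avoids dividing by it.
\<close>
lemma euler_prod_logderiv:
  assumes q: "norm q < 1"
  obtains D where "(euler_prod has_field_derivative D) (at q)"
    "q * D = - (eis_L q + 1 / 24) * euler_prod q"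
proof -
  define r where "r = (norm q + 1) / 2"
  have r: "norm q < r" "r < 1" using q by (auto simp: r_def)
  have lim: "uniform_limit (ball 0 r) (\<lambda>n q. \<Prod>k<n. 1 - q ^ Suc k) euler_prod sequentially"
    by (rule uniform_limit_on_subset[OF euler_prod_uniform_limit[OF r(2)]]) auto
  have hol: "euler_prod holomorphic_on ball 0 r"
  proof (rule holomorphic_uniform_limit[where z = 0 and r = r and g = euler_prod and F = sequentially
        and f = "\<lambda>n q. \<Prod>k<n. 1 - q ^ Suc k"])
    show "uniform_limit (cball 0 r) (\<lambda>n q. \<Prod>k<n. 1 - q ^ Suc k) euler_prod sequentially"
      by (rule euler_prod_uniform_limit[OF r(2)])
  qed (auto intro!: always_eventually continuous_intros holomorphic_intros)
  have D: "(euler_prod has_field_derivative deriv euler_prod q) (at q)"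
    by (rule holomorphic_derivI[OF hol]) (use r in auto)
  have der: "deriv (\<lambda>q. 1 - q ^ Suc k) q = - (of_nat (Suc k) * q ^ k)" for k
    by (rule DERIV_imp_deriv) (auto intro!: derivative_eq_intros simp del: power_Suc of_nat_Suc)
  have "(\<lambda>k. deriv (\<lambda>q. 1 - q ^ Suc k) q / (1 - q ^ Suc k)) sums (deriv euler_prod q / euler_prod q)"
    by (rule logderiv_prodinf_complex_uniform_limit[OF lim])
       (use r euler_prod_nonzero[OF q] in \<open>auto intro!: holomorphic_intros\<close>)
  from sums_mult[OF this, of "- q"]
  have "(\<lambda>k. of_nat (Suc k) * q ^ Suc k / (1 - q ^ Suc k)) sums (- q * (deriv euler_prod q / euler_prod q))"
    unfolding der by (simp add: mult_ac)
  from sums_unique2[OF lambert_sums[OF q] this]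
  have "q * deriv euler_prod q = - (eis_L q + 1 / 24) * euler_prod q"
    using euler_prod_nonzero[OF q] by (simp add: field_simps)
  with D that show ?thesis by blast
qed

lemma dedekind_eta_conv_euler_prod:
  "dedekind_eta z = exp (of_real pi * \<i> * z / 12) * euler_prod (nome z)"
proof -
  have "exp (2 * of_real pi * \<i> * of_nat (Suc n) * z) = nome z ^ Suc n" for n
    unfolding nome_mult_nat[symmetric] by (simp add: nome_def mult_ac)
  thus ?thesis by (simp add: dedekind_eta_def euler_prod_def)
qed

lemma dedekind_eta_nonzero: "Im z > 0 \<Longrightarrow> dedekind_eta z \<noteq> 0"
  by (simp add: dedekind_eta_conv_euler_prod euler_prod_nonzero norm_nome_less_1)

lemma has_field_derivative_nome: "(nome has_field_derivative (2 * of_real pi * \<i> * nome z)) (at z)"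
  unfolding nome_def [abs_def] by (auto intro!: derivative_eq_intros)

lemma dedekind_eta_deriv:
  assumes z: "Im z > 0"
  shows "(dedekind_eta has_field_derivative (- 2 * pi * \<i> * eis_L (nome z) * dedekind_eta z)) (at z)"
proof -
  obtain D where D: "(euler_prod has_field_derivative D) (at (nome z))"
    "nome z * D = - (eis_L (nome z) + 1 / 24) * euler_prod (nome z)"
    using euler_prod_logderiv[OF norm_nome_less_1[OF z]] .
  have "((\<lambda>z. exp (of_real pi * \<i> * z / 12) * euler_prod (nome z)) has_field_derivative
     (exp (of_real pi * \<i> * z / 12) * (of_real pi * \<i> / 12)) * euler_prod (nome z) +
     D * (2 * of_real pi * \<i> * nome z) * exp (of_real pi * \<i> * z / 12)) (at z)"
  proof (rule DERIV_mult)
    show "((\<lambda>z. euler_prod (nome z)) has_field_derivative D * (2 * of_real pi * \<i> * nome z)) (at z)"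
      by (rule DERIV_chain2[where f = euler_prod and g = nome, OF D(1) has_field_derivative_nome])
  qed (auto intro!: derivative_eq_intros)
  moreover have "(exp (of_real pi * \<i> * z / 12) * (of_real pi * \<i> / 12)) * euler_prod (nome z) +
     D * (2 * of_real pi * \<i> * nome z) * exp (of_real pi * \<i> * z / 12)
     = exp (of_real pi * \<i> * z / 12) * of_real pi * \<i> * (euler_prod (nome z) / 12 + 2 * (nome z * D))"
    by (simp add: algebra_simps)
  moreover have "\<dots> = - 2 * pi * \<i> * eis_L (nome z) * dedekind_eta z"
    unfolding D(2) dedekind_eta_conv_euler_prod by (simp add: algebra_simps)
  ultimately show ?thesis by (simp add: dedekind_eta_conv_euler_prod [abs_def])
qed

lemma Im_minus_inverse_pos: "Im z > 0 \<Longrightarrow> Im (- 1 / z) > 0"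
  by (auto simp: Im_divide' intro!: divide_pos_pos)

text \<open>
  By the inversion formula for \<open>L\<close> the quotient of \<open>\<eta>(-1/z)\<^sup>2\<close> and \<open>z \<eta>(z)\<^sup>2\<close> has derivative zero. The
  constant is found at the fixed point \<open>\<i>\<close> of the inversion.
\<close>
lemma dedekind_eta_sq_inversion:
  assumes z: "Im z > 0"
  shows "dedekind_eta (- 1 / z) ^ 2 = - \<i> * z * dedekind_eta z ^ 2"
proof -
  define H where "H = {z. Im z > 0}"
  define g where "g = (\<lambda>z. dedekind_eta (- 1 / z) ^ 2 / (z * dedekind_eta z ^ 2))"
  have "(g has_field_derivative 0) (at z within H)" if "z \<in> H" for z
  proof (rule has_field_derivative_at_within)
    have z: "Im z > 0" using that by (simp add: H_def)
    have z0: "z \<noteq> 0" using z by auto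
    define E E' where "E = dedekind_eta z" and "E' = dedekind_eta (- 1 / z)"
    have E: "E \<noteq> 0" using dedekind_eta_nonzero[OF z] by (simp add: E_def)
    have d1: "((\<lambda>z. dedekind_eta (- 1 / z)) has_field_derivative
       (- 2 * pi * \<i> * eis_L (nome (- 1 / z)) * E' * (1 / z^2))) (at z)"
      unfolding E'_def
      by (rule DERIV_chain2[where f = dedekind_eta and g = "\<lambda>z. - 1 / z",
            OF dedekind_eta_deriv[OF Im_minus_inverse_pos[OF z]]])
         (use z0 in \<open>auto intro!: derivative_eq_intros simp: power2_eq_square\<close>)
    have d2: "(dedekind_eta has_field_derivative (- 2 * pi * \<i> * eis_L (nome z) * E)) (at z)"
      unfolding E_def by (rule dedekind_eta_deriv[OF z])
    define N where "N = - 2 * pi * \<i> * eis_L (nome (- 1 / z)) * E' * (1 / z^2)"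
    have N: "N = (1 / (2 * z) - 2 * pi * \<i> * eis_L (nome z)) * E'"
      unfolding N_def eis_L_inversion[OF z] using z0 by (simp add: field_simps power2_eq_square)
    have n: "((\<lambda>z. dedekind_eta (- 1 / z) ^ 2) has_field_derivative 2 * N * E') (at z)"
      by (rule DERIV_cong[OF DERIV_power[OF d1, of 2]]) (simp add: N_def E'_def mult_ac)
    have m: "((\<lambda>z. z * dedekind_eta z ^ 2) has_field_derivative
        E^2 + z * (2 * (- 2 * pi * \<i> * eis_L (nome z) * E) * E)) (at z)"
      by (rule DERIV_cong[OF DERIV_mult[OF DERIV_ident DERIV_power[OF d2, of 2]]])
         (simp add: E_def[symmetric] mult_ac)
    have "(g has_field_derivative
      ((2 * N * E') * (z * E^2) - E'^2 * (E^2 + z * (2 * (- 2 * pi * \<i> * eis_L (nome z) * E) * E))) / ((z * E^2) * (z * E^2))) (at z)"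
      unfolding g_def E_def E'_def
      by (rule DERIV_divide[OF n[unfolded E_def E'_def] m[unfolded E_def]]) (use z0 E in \<open>simp add: E_def\<close>)
    moreover have "2 * N * E' * (z * E^2) - E'^2 * (E^2 + z * (2 * (- 2 * pi * \<i> * eis_L (nome z) * E) * E)) = 0"
      unfolding N using z0 by (simp add: field_simps power2_eq_square)
    ultimately show "(g has_field_derivative 0) (at z)" by simp
  qed
  moreover have "convex H" unfolding H_def by (rule convex_halfspace_Im_gt)
  ultimately obtain c where c: "\<And>z. z \<in> H \<Longrightarrow> g z = c"
    using has_field_derivative_zero_constant[of H g] by blast
  have "g z = g \<i>" using c[of z] c[of \<i>] z by (simp add: H_def)
  also have "g \<i> = - \<i>"
    using dedekind_eta_nonzero[of \<i>] by (simp add: g_def)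
  finally have "dedekind_eta (- 1 / z) ^ 2 / (z * dedekind_eta z ^ 2) = - \<i>"
    by (simp add: g_def)
  moreover have "z \<noteq> 0" using z by auto
  ultimately show ?thesis
    using dedekind_eta_nonzero[OF z] by (simp add: divide_eq_eq mult_ac)
qed

section \<open>The multiplier of the square of eta\<close>

definition zeta12 :: "int \<Rightarrow> complex" where
  "zeta12 n = exp (of_int n * (pi * \<i> / 6))"

lemma zeta12_add: "zeta12 (m + n) = zeta12 m * zeta12 n"
  unfolding zeta12_def of_int_add distrib_right exp_add ..

lemma zeta12_0 [simp]: "zeta12 0 = 1"
  by (simp add: zeta12_def)

lemma zeta12_minus3: "zeta12 (- 3) = - \<i>"
  using exp_Euler[of "- (pi/2)"] by (simp add: zeta12_def field_simps cis_conv_exp[symmetric] complex_eq_iff)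

lemma zeta12_cong:
  assumes "[m = n] (mod 12)" shows "zeta12 m = zeta12 n"
proof -
  obtain k where k: "m = n + 12 * k" using assms by (metis cong_iff_lin cong_sym)
  have "zeta12 (12 * k) = exp (of_int k * (2 * pi * \<i>))"
    by (simp add: zeta12_def field_simps)
  also have "\<dots> = 1" using exp_integer_2pi[of "of_int k"] by (simp add: mult_ac)
  finally show ?thesis by (simp add: k zeta12_add)
qed

lemma dedekind_eta_sq_plus_of_int:
  "dedekind_eta (z + of_int n) ^ 2 = zeta12 n * dedekind_eta z ^ 2"
proof -
  have "nome (z + of_int n) = nome z"
  proof -
    have "nome (z + of_int n) = nome z * exp (2 * of_int n * pi * \<i>)"
      by (simp add: nome_def exp_add [symmetric] algebra_simps)
    thus ?thesis using exp_integer_2pi[of "of_int n"] by (simp add: mult_ac)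
  qed
  hence "dedekind_eta (z + of_int n) = exp (of_int n * (pi * \<i> / 12)) * dedekind_eta z"
    unfolding dedekind_eta_conv_euler_prod by (simp add: exp_add [symmetric] field_simps)
  moreover have "exp (of_int n * (pi * \<i> / 12)) ^ 2 = zeta12 n"
    unfolding zeta12_def exp_double [symmetric] by (rule arg_cong[of _ _ exp]) simp
  ultimately show ?thesis by (simp add: power_mult_distrib)
qed

text \<open>
  The abelianization of \<open>SL\<^sub>2(\<int>)\<close> is cyclic of order 12. Read modulo 12, this polynomial in the entries
  is an explicit isomorphism, with the value 1 at \<open>z \<mapsto> z + 1\<close> and \<open>- 3\<close> at \<open>z \<mapsto> - 1 / z\<close>. It is the
  exponent in the multiplier of \<open>\<eta>\<^sup>2\<close>.
\<close>
definition eta_exponent :: "int \<Rightarrow> int \<Rightarrow> int \<Rightarrow> int \<Rightarrow> int" where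
  "eta_exponent a b c d = (1 - c\<^sup>2) * (b * d + 3 * (c - 1) * d + c + 3) + c * (a + d - 3)"

lemma eta_exponent_cong:
  assumes "[a = a'] (mod m)" "[b = b'] (mod m)" "[c = c'] (mod m)" "[d = d'] (mod m)"
  shows "[eta_exponent a b c d = eta_exponent a' b' c' d'] (mod m)"
  unfolding eta_exponent_def
  by (intro cong_add cong_mult cong_diff cong_pow assms cong_refl)

lemma cong_12_iff: "[x = y] (mod 12) \<longleftrightarrow> [x = y] (mod 3) \<and> [x = y] (mod (4::int))"
proof -
  have "12 dvd k \<longleftrightarrow> 3 dvd k \<and> 4 dvd k" for k :: int by presburger
  thus ?thesis by (simp only: cong_iff_dvd_diff)
qed

text \<open>
  Congruences between integer polynomials under the side condition \<open>R = 0\<close> only depend on the residues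
  of the variables, so they can be checked case by case. The congruences below are all modulo 12, which
  splits into the moduli 3 and 4 with at most 256 cases.
\<close>
lemma cong_by_residues:
  fixes P Q :: "int \<Rightarrow> int \<Rightarrow> int \<Rightarrow> int \<Rightarrow> int"
  assumes P: "\<And>a b c d. [P a b c d = P (a mod m) (b mod m) (c mod m) (d mod m)] (mod m)"
    and Q: "\<And>a b c d. [Q a b c d = Q (a mod m) (b mod m) (c mod m) (d mod m)] (mod m)"
    and D: "\<And>a b c d. [R a b c d = R (a mod m) (b mod m) (c mod m) (d mod m)] (mod m)"
    and m: "m > 0"
    and R: "[R a b c d = 0] (mod m)"
    and check: "\<forall>a\<in>{0..<m}. \<forall>b\<in>{0..<m}. \<forall>c\<in>{0..<m}. \<forall>d\<in>{0..<m}. R a b c d mod m = 0 \<longrightarrow> P a b c d mod m = Q a b c d mod m"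
  shows "[P a b c d = Q a b c d] (mod m)"
proof -
  have "R (a mod m) (b mod m) (c mod m) (d mod m) mod m = 0"
    using R D[of a b c d] by (simp add: cong_def)
  hence "P (a mod m) (b mod m) (c mod m) (d mod m) mod m = Q (a mod m) (b mod m) (c mod m) (d mod m) mod m"
    using check m by (auto simp del: mod_pos_pos_trivial)
  thus ?thesis using P[of a b c d] Q[of a b c d] by (simp add: cong_def)
qed

lemma int_range_3: "{0..<3::int} = {0, 1, 2}" and int_range_4: "{0..<4::int} = {0, 1, 2, 3}"
  by auto

text \<open>
  How the exponent changes under right multiplication by the two generators of \<open>SL\<^sub>2(\<int>)\<close>.
\<close>
lemma eta_exponent_T:
  assumes "a * d - b * c = 1"
  shows "[eta_exponent a (a + b) c (c + d) = eta_exponent a b c d + 1] (mod 12)"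
  unfolding cong_12_iff
  by (intro conjI; rule cong_by_residues[where R = "\<lambda>a b c d. a * d - b * c - 1"
        and P = "\<lambda>a b c d. eta_exponent a (a + b) c (c + d)" and Q = "\<lambda>a b c d. eta_exponent a b c d + 1"])
     (use assms in \<open>simp_all only: int_range_3 int_range_4, auto intro!: eta_exponent_cong cong_add cong_mult cong_diff cong_pow
         simp: eta_exponent_def\<close>)

lemma eta_exponent_S:
  assumes "a * d - b * c = 1"
  shows "[eta_exponent b (- a) d (- c) = eta_exponent a b c d - 3] (mod 12)"
  unfolding cong_12_iff
  by (intro conjI; rule cong_by_residues[where R = "\<lambda>a b c d. a * d - b * c - 1"
        and P = "\<lambda>a b c d. eta_exponent b (- a) d (- c)" and Q = "\<lambda>a b c d. eta_exponent a b c d - 3"])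
     (use assms in \<open>simp_all only: int_range_3 int_range_4, auto intro!: eta_exponent_cong cong_add cong_mult cong_diff cong_pow
         simp: eta_exponent_def cong_minus_minus_iff\<close>)


lemma eta_exponent_translations:
  "eta_exponent 1 b 0 1 = b" "eta_exponent (-1) b 0 (-1) = 6 - b"
  by (simp_all add: eta_exponent_def)

definition eta_sq_law :: "int \<Rightarrow> int \<Rightarrow> int \<Rightarrow> int \<Rightarrow> bool" where
  "eta_sq_law a b c d \<longleftrightarrow> (\<forall>z. Im z > 0 \<longrightarrow>
     dedekind_eta ((of_int a * z + of_int b) / (of_int c * z + of_int d)) ^ 2 =
     zeta12 (eta_exponent a b c d) * (of_int c * z + of_int d) * dedekind_eta z ^ 2)"

text \<open>
  Right multiplication by a generator respects the law, because \<open>(\<gamma> T) z = \<gamma> (z + 1)\<close>: evaluating the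
  law for \<open>\<gamma> T\<close> at \<open>z - 1\<close> yields the one for \<open>\<gamma>\<close>, and conversely.
\<close>
lemma eta_sq_law_shift:
  assumes "a * d - b * c = 1" and "eta_sq_law a (b + a) c (d + c)"
  shows "eta_sq_law a b c d"
  unfolding eta_sq_law_def
proof (intro allI impI)
  fix z :: complex assume z: "Im z > 0"
  define w where "w = z + of_int (- 1)"
  have w: "Im w > 0" using z by (simp add: w_def)
  have 1: "dedekind_eta ((of_int a * w + of_int (b + a)) / (of_int c * w + of_int (d + c))) ^ 2 =
     zeta12 (eta_exponent a (b + a) c (d + c)) * (of_int c * w + of_int (d + c)) * dedekind_eta w ^ 2"
    using assms(2) w unfolding eta_sq_law_def by blast
  have e: "of_int a * w + of_int (b + a) = of_int a * z + of_int b"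
    "of_int c * w + of_int (d + c) = of_int c * z + of_int d"
    by (simp_all add: w_def algebra_simps)
  have 2: "dedekind_eta w ^ 2 = zeta12 (-1) * dedekind_eta z ^ 2"
    unfolding w_def by (rule dedekind_eta_sq_plus_of_int)
  have 3: "zeta12 (eta_exponent a (b + a) c (d + c)) = zeta12 (eta_exponent a b c d) * zeta12 1"
    unfolding zeta12_add [symmetric]
    using zeta12_cong[OF eta_exponent_T[OF assms(1)]] by (simp add: add.commute)
  have 4: "zeta12 1 * zeta12 (-1) = 1" by (simp flip: zeta12_add)
  have "dedekind_eta ((of_int a * z + of_int b) / (of_int c * z + of_int d)) ^ 2 =
     zeta12 (eta_exponent a b c d) * zeta12 1 * (of_int c * z + of_int d) * (zeta12 (-1) * dedekind_eta z ^ 2)"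
    using 1 unfolding e 2 3 .
  also have "\<dots> = zeta12 (eta_exponent a b c d) * (of_int c * z + of_int d) * dedekind_eta z ^ 2 * (zeta12 1 * zeta12 (-1))"
    by (simp only: mult_ac)
  finally show "dedekind_eta ((of_int a * z + of_int b) / (of_int c * z + of_int d)) ^ 2 =
     zeta12 (eta_exponent a b c d) * (of_int c * z + of_int d) * dedekind_eta z ^ 2"
    unfolding 4 by simp
qed

lemma eta_sq_law_unshift:
  assumes "a * d - b * c = 1" and "eta_sq_law a b c d"
  shows "eta_sq_law a (b + a) c (d + c)"
  unfolding eta_sq_law_def
proof (intro allI impI)
  fix z :: complex assume z: "Im z > 0"
  define w where "w = z + of_int 1"
  have w: "Im w > 0" using z by (simp add: w_def)
  have "dedekind_eta ((of_int a * w + of_int b) / (of_int c * w + of_int d)) ^ 2 =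
     zeta12 (eta_exponent a b c d) * (of_int c * w + of_int d) * dedekind_eta w ^ 2"
    using assms(2) w unfolding eta_sq_law_def by blast
  moreover have "of_int a * z + of_int (b + a) = of_int a * w + of_int b"
    "of_int c * z + of_int (d + c) = of_int c * w + of_int d"
    by (simp_all add: w_def algebra_simps)
  moreover have "dedekind_eta w ^ 2 = zeta12 1 * dedekind_eta z ^ 2"
    unfolding w_def by (rule dedekind_eta_sq_plus_of_int)
  moreover have "zeta12 (eta_exponent a (b + a) c (d + c)) = zeta12 (eta_exponent a b c d) * zeta12 1"
    unfolding zeta12_add [symmetric]
    using zeta12_cong[OF eta_exponent_T[OF assms(1)]] by (simp add: add.commute)
  ultimately show "dedekind_eta ((of_int a * z + of_int (b + a)) / (of_int c * z + of_int (d + c))) ^ 2 =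
     zeta12 (eta_exponent a (b + a) c (d + c)) * (of_int c * z + of_int (d + c)) * dedekind_eta z ^ 2"
    by (simp only: mult_ac)
qed

lemma eta_sq_law_shift_iff:
  assumes "a * d - b * c = 1"
  shows "eta_sq_law a (b + n * a) c (d + n * c) \<longleftrightarrow> eta_sq_law a b c d"
proof (induction n rule: int_induct[where k = 0])
  case base
  show ?case by simp
next
  case (step1 i)
  have "a * (d + i * c) - (b + i * a) * c = 1" using assms by (simp add: algebra_simps)
  from eta_sq_law_shift[OF this] eta_sq_law_unshift[OF this] step1 show ?case
    by (auto simp: algebra_simps)
next
  case (step2 i)
  have "a * (d + (i - 1) * c) - (b + (i - 1) * a) * c = 1" using assms by (simp add: algebra_simps)
  from eta_sq_law_shift[OF this] eta_sq_law_unshift[OF this] step2 show ?case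
    by (auto simp: algebra_simps)
qed

lemma eta_sq_law_inversion:
  assumes "a * d - b * c = 1" and "eta_sq_law b (- a) d (- c)"
  shows "eta_sq_law a b c d"
  unfolding eta_sq_law_def
proof (intro allI impI)
  fix z :: complex assume z: "Im z > 0"
  define w where "w = - 1 / z"
  have w: "Im w > 0" unfolding w_def by (rule Im_minus_inverse_pos[OF z])
  have z0: "z \<noteq> 0" using z by auto
  have "dedekind_eta ((of_int b * w + of_int (- a)) / (of_int d * w + of_int (- c))) ^ 2 =
     zeta12 (eta_exponent b (- a) d (- c)) * (of_int d * w + of_int (- c)) * dedekind_eta w ^ 2"
    using assms(2) w unfolding eta_sq_law_def by blast
  moreover have e: "of_int b * w + of_int (- a) = (of_int a * z + of_int b) * w"
    "of_int d * w + of_int (- c) = (of_int c * z + of_int d) * w"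
    using z0 by (simp_all add: w_def field_simps)
  moreover have w0: "w \<noteq> 0" using w by auto
  moreover have "dedekind_eta w ^ 2 = - \<i> * z * dedekind_eta z ^ 2"
    unfolding w_def by (rule dedekind_eta_sq_inversion[OF z])
  moreover have "zeta12 (eta_exponent b (- a) d (- c)) = zeta12 (eta_exponent a b c d) * (- \<i>)"
    unfolding zeta12_minus3 [symmetric] zeta12_add [symmetric]
    using zeta12_cong[OF eta_exponent_S[OF assms(1)]] by simp
  ultimately have "dedekind_eta ((of_int a * z + of_int b) / (of_int c * z + of_int d)) ^ 2 =
     zeta12 (eta_exponent a b c d) * (- \<i>) * ((of_int c * z + of_int d) * w) * (- \<i> * z * dedekind_eta z ^ 2)"
    by simp
  also have "\<dots> = zeta12 (eta_exponent a b c d) * (of_int c * z + of_int d) * dedekind_eta z ^ 2 * (- (w * z))"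
    by (simp add: algebra_simps)
  also have "w * z = - 1" using z0 by (simp add: w_def)
  finally show "dedekind_eta ((of_int a * z + of_int b) / (of_int c * z + of_int d)) ^ 2 =
     zeta12 (eta_exponent a b c d) * (of_int c * z + of_int d) * dedekind_eta z ^ 2" by simp
qed

text \<open>
  The Euclidean algorithm on the lower row: a translation reduces \<open>d\<close> modulo \<open>c\<close>, an inversion exchanges
  the two entries, and matrices with \<open>c = 0\<close> are translations up to sign.
\<close>
theorem dedekind_eta_sq_SL2Z:
  assumes "a * d - b * c = 1"
  shows "eta_sq_law a b c d"
  using assms
proof (induction "nat \<bar>c\<bar>" arbitrary: a b c d rule: less_induct)
  case less
  show ?case
  proof (cases "c = 0")
    case True
    hence "a * d = 1" using less.prems by simp
    hence ad: "a = 1 \<and> d = 1 \<or> a = -1 \<and> d = -1" using zmult_eq_1_iff[of a d] by auto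
    have base: "eta_sq_law a 0 0 d"
      using ad zeta12_add[of 3 3] zeta12_add[of "-3" "-3"] zeta12_cong[of 6 "-6"] zeta12_minus3
      by (auto simp: eta_sq_law_def eta_exponent_translations cong_def)
    have "eta_sq_law a (0 + (b * a) * a) 0 (d + (b * a) * 0) \<longleftrightarrow> eta_sq_law a 0 0 d"
      by (rule eta_sq_law_shift_iff) (use ad in auto)
    thus ?thesis using base ad True by auto
  next
    case False
    (* The sign makes d + n * c the remainder of d modulo the absolute value of c. *)
    define n where "n = - (d div \<bar>c\<bar>) * sgn c"
    have dc: "d + n * c = d mod \<bar>c\<bar>"
      unfolding n_def using False by (simp add: minus_div_mult_eq_mod [symmetric] abs_sgn mult_ac)
    have lt: "nat \<bar>d + n * c\<bar> < nat \<bar>c\<bar>"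
      unfolding dc using False by (simp add: abs_of_nonneg)
    have det: "a * (d + n * c) - (b + n * a) * c = 1" using less.prems by (simp add: algebra_simps)
    have "eta_sq_law (b + n * a) (- a) (d + n * c) (- c)"
      by (rule less.hyps[OF lt]) (use det in \<open>simp add: algebra_simps\<close>)
    hence "eta_sq_law a (b + n * a) c (d + n * c)"
      by (rule eta_sq_law_inversion[OF det])
    thus ?thesis using eta_sq_law_shift_iff[OF less.prems] by simp
  qed
qed

section \<open>The theta function as an eta quotient\<close>

text \<open>
  The finite \<open>q\<close>-Pochhammer symbol \<open>(p; p)\<^sub>n\<close>.
\<close>
definition qpoch :: "complex \<Rightarrow> nat \<Rightarrow> complex" where
  "qpoch p n = (\<Prod>i<n. 1 - p ^ Suc i)"

text \<open>
  Defined by the Pascal rule that matches the recursion of the product in the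
  \<open>q\<close>-binomial theorem.
\<close>
fun gauss_binomial :: "complex \<Rightarrow> nat \<Rightarrow> nat \<Rightarrow> complex" where
  "gauss_binomial p M 0 = 1"
| "gauss_binomial p 0 (Suc j) = 0"
| "gauss_binomial p (Suc M) (Suc j) = gauss_binomial p M j + p ^ Suc j * gauss_binomial p M (Suc j)"

lemma gauss_binomial_eq_0: "M < j \<Longrightarrow> gauss_binomial p M j = 0"
  by (induction p M j rule: gauss_binomial.induct) auto

lemma gauss_binomial_qpoch:
  "gauss_binomial p (j + k) j * (qpoch p j * qpoch p k) = qpoch p (j + k)"
proof (induction "j + k" arbitrary: j k)
  case 0
  thus ?case by (simp add: qpoch_def)
next
  case (Suc M)
  show ?case
  proof (cases j)
    case 0
    thus ?thesis by (simp add: qpoch_def)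
  next
    case (Suc i)
    have Mi: "M = i + k" using Suc.hyps(2) Suc by simp
    have IH1: "gauss_binomial p (i + k) i * (qpoch p i * qpoch p k) = qpoch p (i + k)"
      using Suc.hyps(1)[of i k] Mi by simp
    have S: "qpoch p (Suc n) = qpoch p n * (1 - p ^ Suc n)" for n
      by (simp add: qpoch_def)
    show ?thesis
    proof (cases k)
      case 0
      have "gauss_binomial p i (Suc i) = 0" by (rule gauss_binomial_eq_0) simp
      thus ?thesis using IH1 Suc 0 by (simp add: S qpoch_def del: power_Suc) (metis mult.assoc)
    next
      case (Suc l)
      note k = this
      have IH2: "gauss_binomial p (Suc i + l) (Suc i) * (qpoch p (Suc i) * qpoch p l) = qpoch p (Suc i + l)"
        using Suc.hyps(1)[of "Suc i" l] Mi k by simp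
      have ik: "i + k = Suc i + l" using k by simp
      have "gauss_binomial p (Suc i + k) (Suc i) * (qpoch p (Suc i) * qpoch p k)
         = gauss_binomial p (i + k) i * (qpoch p i * qpoch p k) * (1 - p ^ Suc i)
          + p ^ Suc i * (gauss_binomial p (Suc i + l) (Suc i) * (qpoch p (Suc i) * qpoch p l)) * (1 - p ^ Suc l)"
        unfolding k S[of l] S[of i] by (simp add: algebra_simps)
      also have "\<dots> = qpoch p (i + k) * ((1 - p ^ Suc i) + p ^ Suc i * (1 - p ^ Suc l))"
        unfolding IH1 IH2 unfolding ik[symmetric] by (simp add: algebra_simps)
      also have "(1 - p ^ Suc i) + p ^ Suc i * (1 - p ^ Suc l) = 1 - p ^ Suc (i + k)"
        by (simp add: k algebra_simps power_add)
      also have "qpoch p (i + k) * (1 - p ^ Suc (i + k)) = qpoch p (Suc i + k)"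
        by (simp add: S del: power_Suc)
      finally show ?thesis using \<open>j = Suc i\<close> by simp
    qed
  qed
qed

text \<open>
  Split off the factor with \<open>i = 0\<close>. The remaining product is the one for \<open>M\<close> at \<open>x p\<close>, and comparing
  coefficients of \<open>x\<close> gives the Pascal rule.
\<close>
theorem gauss_binomial_theorem:
  "(\<Prod>i<M. 1 + x * p ^ i) = (\<Sum>j\<le>M. gauss_binomial p M j * p ^ (j * (j - 1) div 2) * x ^ j)"
proof (induction M arbitrary: x)
  case 0
  show ?case by simp
next
  case (Suc M)
  define t where "t = (\<lambda>j. p ^ (j * (j - 1) div 2) * x ^ j)"
  (* The triangular numbers j (j - 1) / 2 increase by j. *)
  have tri: "Suc j * j div 2 = j * (j - 1) div 2 + j" for j :: nat
  proof -
    have "Suc j * j = j * (j - 1) + j * 2" by (cases j) auto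
    thus ?thesis by (simp only: div_mult_self1 [of 2])
  qed
  have t_Suc: "t (Suc j) = p ^ (j * (j - 1) div 2) * p ^ j * x ^ j * x" for j
    unfolding t_def diff_Suc_1 tri power_add by (simp add: mult_ac)
  have pt: "p ^ (j * (j - 1) div 2) * (x * p) ^ j = p ^ j * t j" for j
    by (simp add: t_def power_mult_distrib mult_ac)
  have "(\<Prod>i<Suc M. 1 + x * p ^ i) = (1 + x) * (\<Prod>i<M. 1 + (x * p) * p ^ i)"
    by (subst prod.lessThan_Suc_shift) (simp add: mult_ac)
  also have "(\<Prod>i<M. 1 + (x * p) * p ^ i) = (\<Sum>j\<le>M. gauss_binomial p M j * (p ^ j * t j))"
    unfolding Suc.IH pt [symmetric] by (simp add: mult_ac)
  also have "(1 + x) * \<dots> = (\<Sum>j\<le>M. gauss_binomial p M j * (p ^ j * t j)) + (\<Sum>j\<le>M. gauss_binomial p M j * t (Suc j))"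
    unfolding distrib_right sum_distrib_left t_Suc by (simp add: t_def mult_ac sum.distrib)
  also have "(\<Sum>j\<le>M. gauss_binomial p M j * (p ^ j * t j)) = (\<Sum>j\<le>Suc M. gauss_binomial p M j * (p ^ j * t j))"
    using gauss_binomial_eq_0[of M "Suc M" p] by simp
  also have "\<dots> = t 0 + (\<Sum>j\<le>M. gauss_binomial p M (Suc j) * (p ^ Suc j * t (Suc j)))"
    by (subst sum.atMost_Suc_shift) simp
  also have "\<dots> + (\<Sum>j\<le>M. gauss_binomial p M j * t (Suc j))
     = gauss_binomial p (Suc M) 0 * t 0 + (\<Sum>j\<le>M. gauss_binomial p (Suc M) (Suc j) * t (Suc j))"
    by (simp add: sum.distrib [symmetric] algebra_simps)
  also have "\<dots> = (\<Sum>j\<le>Suc M. gauss_binomial p (Suc M) j * t j)"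
    by (subst sum.atMost_Suc_shift) simp
  finally show ?case by (simp add: t_def mult.assoc)
qed

lemma prod_lessThan_add:
  fixes f :: "nat \<Rightarrow> 'a :: comm_monoid_mult"
  shows "(\<Prod>i<M + N. f i) = (\<Prod>i<M. f i) * (\<Prod>i<N. f (M + i))"
  by (induction N) (simp_all add: mult.assoc)

lemma sum_centered:
  fixes g :: "nat \<Rightarrow> 'a :: comm_monoid_add"
  shows "(\<Sum>j\<le>2 * N. g j) = g N + (\<Sum>k<N. g (N + Suc k) + g (N - Suc k))"
proof -
  have "{..2 * N} = {..<N} \<union> ({N} \<union> {N<..2 * N})" by auto
  hence "(\<Sum>j\<le>2 * N. g j) = sum g {..<N} + (g N + sum g {N<..2 * N})"
  proof (simp only:, subst sum.union_disjoint)
    show "sum g {..<N} + sum g ({N} \<union> {N<..2 * N}) = sum g {..<N} + (g N + sum g {N<..2 * N})"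
      by (subst sum.union_disjoint) auto
  qed auto
  also have "sum g {..<N} = (\<Sum>k<N. g (N - Suc k))"
    by (rule sum.nat_diff_reindex [symmetric])
  also have "sum g {N<..2 * N} = (\<Sum>k<N. g (N + Suc k))"
    by (rule sum.reindex_bij_witness[of _ "\<lambda>k. N + Suc k" "\<lambda>j. j - Suc N"]) auto
  finally show ?thesis by (simp add: sum.distrib add_ac)
qed

text \<open>
  The \<open>q\<close>-binomial theorem with base \<open>q\<^sup>2\<close> and \<open>2 N\<close> factors at \<open>x = q powi (1 - 2 N)\<close>, multiplied by
  \<open>q\<close> to the power \<open>N\<^sup>2\<close>. The exponents in the factors are then the odd numbers from \<open>1 - 2 N\<close> to
  \<open>2 N - 1\<close>, so the factors match up in pairs, and the term of index \<open>j\<close> on the other side becomes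
  the \<open>(j - N)\<^sup>2\<close>-th power of \<open>q\<close>.
\<close>
lemma finite_theta_product:
  fixes q :: complex assumes q: "q \<noteq> 0"
  shows "(\<Prod>j<N. 1 + q ^ (2 * j + 1))^2 =
     gauss_binomial (q^2) (2 * N) N +
     (\<Sum>k<N. (gauss_binomial (q^2) (2 * N) (N + Suc k) + gauss_binomial (q^2) (2 * N) (N - Suc k)) * q ^ (Suc k)^2)"
proof -
  (* The value of the variable of the q-binomial theorem that centres the exponents. *)
  define y where "y = q powi (1 - 2 * int N)"
  have pw: "q ^ n = q powi int n" for n by simp
  define e where "e = q ^ (N^2)"
  have trm: "e * ((q^2) ^ (j * (j - 1) div 2) * y ^ j) = q powi ((int j - int N)^2)" for j
  proof -
    have "even (j * (j - 1))" by (cases "even j") simp_all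
    hence "2 * (j * (j - 1) div 2) = j * (j - 1)" by (rule even_two_times_div_two)
    hence "(q^2) ^ (j * (j - 1) div 2) = q ^ (j * (j - 1))" by (simp flip: power_mult)
    also have "\<dots> = q powi (int j * (int j - 1))"
      unfolding pw by (cases j) (simp_all add: algebra_simps)
    finally have 1: "(q^2) ^ (j * (j - 1) div 2) = q powi (int j * (int j - 1))" .
    have 2: "y ^ j = q powi ((1 - 2 * int N) * int j)"
      by (simp add: y_def power_int_mult)
    show ?thesis unfolding 1 2 unfolding e_def pw using q
      by (simp only: power_int_add [OF disjI1 [OF q], symmetric] of_nat_power) (simp add: algebra_simps power2_eq_square)
  qed
  have up: "y * (q^2) ^ (N + j) = q ^ (2 * j + 1)" for j
  proof -
    have "y * (q^2) ^ (N + j) = q powi (1 - 2 * int N) * q powi (int (2 * (N + j)))"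
      unfolding y_def pw [symmetric] by (simp only: power_mult)
    also have "\<dots> = q powi (int (2 * j + 1))"
      using q by (simp only: power_int_add [OF disjI1 [OF q], symmetric]) (simp add: algebra_simps)
    finally show ?thesis unfolding pw .
  qed
  have down: "q ^ (2 * j + 1) * (1 + y * (q^2) ^ (N - Suc j)) = 1 + q ^ (2 * j + 1)" if "j < N" for j
  proof -
    have "q ^ (2 * j + 1) * (y * (q^2) ^ (N - Suc j)) = q powi (int (2 * j + 1)) * (q powi (1 - 2 * int N) * q powi (int (2 * (N - Suc j))))"
      unfolding y_def pw [symmetric] by (simp only: power_mult)
    also have "\<dots> = q powi 0"
      using q that by (simp only: power_int_add [OF disjI1 [OF q], symmetric]) (simp add: algebra_simps of_nat_diff)
    finally show ?thesis by (simp add: algebra_simps)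
  qed
  have e_prod: "e = (\<Prod>j<N. q ^ (2 * j + 1))"
    unfolding e_def by (induction N) (simp_all add: power2_eq_square power_add mult_2_right algebra_simps)
  have "e * (\<Prod>i<2 * N. 1 + y * (q^2) ^ i) = e * (\<Prod>i<N. 1 + y * (q^2) ^ i) * (\<Prod>j<N. 1 + y * (q^2) ^ (N + j))"
    unfolding mult_2 prod_lessThan_add by (simp add: mult.assoc)
  also have "(\<Prod>i<N. 1 + y * (q^2) ^ i) = (\<Prod>j<N. 1 + y * (q^2) ^ (N - Suc j))"
    by (rule prod.nat_diff_reindex [symmetric])
  also have "e * \<dots> = (\<Prod>j<N. 1 + q ^ (2 * j + 1))"
    unfolding e_prod prod.distrib [symmetric] by (rule prod.cong) (use down in auto)
  also have "(\<Prod>j<N. 1 + y * (q^2) ^ (N + j)) = (\<Prod>j<N. 1 + q ^ (2 * j + 1))"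
    unfolding up ..
  finally have "(\<Prod>j<N. 1 + q ^ (2 * j + 1))^2 = e * (\<Prod>i<2 * N. 1 + y * (q^2) ^ i)"
    by (simp add: power2_eq_square)
  also have "\<dots> = (\<Sum>j\<le>2 * N. gauss_binomial (q^2) (2 * N) j * (e * ((q^2) ^ (j * (j - 1) div 2) * y ^ j)))"
    unfolding gauss_binomial_theorem sum_distrib_left by (simp only: mult_ac)
  also have "\<dots> = (\<Sum>j\<le>2 * N. gauss_binomial (q^2) (2 * N) j * q powi ((int j - int N)^2))"
    unfolding trm ..
  also have "\<dots> = gauss_binomial (q^2) (2 * N) N * q powi ((int N - int N)^2) +
     (\<Sum>k<N. gauss_binomial (q^2) (2 * N) (N + Suc k) * q powi ((int (N + Suc k) - int N)^2)
            + gauss_binomial (q^2) (2 * N) (N - Suc k) * q powi ((int (N - Suc k) - int N)^2))"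
    by (rule sum_centered)
  also have "(\<Sum>k<N. gauss_binomial (q^2) (2 * N) (N + Suc k) * q powi ((int (N + Suc k) - int N)^2)
            + gauss_binomial (q^2) (2 * N) (N - Suc k) * q powi ((int (N - Suc k) - int N)^2))
      = (\<Sum>k<N. (gauss_binomial (q^2) (2 * N) (N + Suc k) + gauss_binomial (q^2) (2 * N) (N - Suc k)) * q ^ (Suc k)^2)"
  proof (rule sum.cong)
    fix k assume "k \<in> {..<N}"
    hence "(int (N - Suc k) - int N)^2 = int ((Suc k)^2)" "(int (N + Suc k) - int N)^2 = int ((Suc k)^2)"
      by (simp_all add: of_nat_diff power2_eq_square algebra_simps)
    thus "gauss_binomial (q^2) (2 * N) (N + Suc k) * q powi ((int (N + Suc k) - int N)^2)
            + gauss_binomial (q^2) (2 * N) (N - Suc k) * q powi ((int (N - Suc k) - int N)^2)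
       = (gauss_binomial (q^2) (2 * N) (N + Suc k) + gauss_binomial (q^2) (2 * N) (N - Suc k)) * q ^ (Suc k)^2"
      by (simp only: pw distrib_right)
  qed simp
  finally show ?thesis by simp
qed

definition theta_series :: "complex \<Rightarrow> complex" where
  "theta_series q = 1 + 2 * (\<Sum>n. q ^ (Suc n)\<^sup>2)"

lemma theta_term_bound: "norm q < 1 \<Longrightarrow> norm (q ^ (Suc n)\<^sup>2) \<le> norm q ^ n" for q :: complex
  unfolding norm_power by (rule power_decreasing) (auto simp: power2_eq_square)

lemma theta_summable:
  fixes q :: complex
  assumes "norm q < 1" shows "summable (\<lambda>n. norm (q ^ (Suc n)\<^sup>2))"
  by (rule summable_comparison_test[OF _ summable_geometric[of "norm q"]])
     (use assms theta_term_bound[OF assms] in auto)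

lemma theta_phi_conv_series:
  assumes z: "Im z > 0"
  shows "theta_phi z = theta_series (nome z)"
proof -
  define q where "q = nome z"
  have q: "norm q < 1" using norm_nome_less_1[OF z] by (simp add: q_def)
  define S where "S = (\<Sum>n. q ^ (Suc n)\<^sup>2)"
  have hs: "((\<lambda>n. q ^ (Suc n)\<^sup>2) has_sum S) UNIV"
    by (rule norm_summable_imp_has_sum)
       (use theta_summable[OF q] summable_norm_cancel[OF theta_summable[OF q]] in \<open>auto simp: S_def summable_sums\<close>)
  define f where "f = (\<lambda>n :: int. q powi (n^2))"
  have pos: "(f has_sum S) ((\<lambda>n. int (Suc n)) ` UNIV)"
  proof (subst has_sum_reindex)
    have "f (int (Suc n)) = q ^ (Suc n)\<^sup>2" for n
      unfolding f_def of_nat_power [symmetric] by (rule power_int_of_nat)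
    thus "((f \<circ> (\<lambda>n. int (Suc n))) has_sum S) UNIV" using hs by (simp only: o_def)
  qed (auto intro: injI)
  have neg: "(f has_sum S) ((\<lambda>n. - int (Suc n)) ` UNIV)"
  proof (subst has_sum_reindex)
    have "f (- int (Suc n)) = q ^ (Suc n)\<^sup>2" for n
      unfolding f_def power2_minus of_nat_power [symmetric] by (rule power_int_of_nat)
    thus "((f \<circ> (\<lambda>n. - int (Suc n))) has_sum S) UNIV" using hs by (simp only: o_def)
  qed (auto intro: injI)
  have zero: "(f has_sum 1) {0}"
    by (rule has_sum_finiteI) (auto simp: f_def)
  have un: "UNIV = (\<lambda>n. int (Suc n)) ` UNIV \<union> (\<lambda>n. - int (Suc n)) ` UNIV \<union> {0}"
  proof (intro equalityI subsetI)
    fix n :: int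
    have "n = int (Suc (nat (n - 1))) \<or> n = - int (Suc (nat (- n - 1))) \<or> n = 0" by auto
    thus "n \<in> (\<lambda>n. int (Suc n)) ` UNIV \<union> (\<lambda>n. - int (Suc n)) ` UNIV \<union> {0}" by blast
  qed auto
  have "(f has_sum (S + S + 1)) UNIV"
    by (subst un, intro has_sum_Un_disjoint pos neg zero) auto
  hence "infsum f UNIV = S + S + 1" by (rule infsumI)
  thus ?thesis by (simp add: theta_phi_def f_def theta_series_def S_def q_def)
qed

lemma qpoch_LIMSEQ: "norm p < 1 \<Longrightarrow> qpoch p \<longlonglongrightarrow> euler_prod p"
  using euler_prod_LIMSEQ[of p] by (simp add: qpoch_def [abs_def])

lemma qpoch_nonzero: "norm p < 1 \<Longrightarrow> qpoch p n \<noteq> 0"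
  using euler_factor_nonzero[of p] by (simp add: qpoch_def del: power_Suc)

lemma gauss_binomial_eq:
  assumes "norm p < 1"
  shows "gauss_binomial p (j + k) j = qpoch p (j + k) * (inverse (qpoch p j) * inverse (qpoch p k))"
  using gauss_binomial_qpoch[of p j k] qpoch_nonzero[OF assms, of j] qpoch_nonzero[OF assms, of k]
  by (simp add: field_simps)

lemma gauss_binomial_bounded:
  assumes p: "norm p < 1"
  obtains B where "\<And>M j. norm (gauss_binomial p M j) \<le> B"
proof -
  have "Bseq (qpoch p)"
    using qpoch_LIMSEQ[OF p] by (intro convergent_imp_Bseq convergentI)
  then obtain B1 where B1: "B1 > 0" "\<And>n. norm (qpoch p n) \<le> B1" by (auto simp: Bseq_def)
  have "Bseq (\<lambda>n. inverse (qpoch p n))"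
    using tendsto_inverse[OF qpoch_LIMSEQ[OF p] euler_prod_nonzero[OF p]] by (intro convergent_imp_Bseq convergentI)
  then obtain B2 where B2: "B2 > 0" "\<And>n. norm (inverse (qpoch p n)) \<le> B2" unfolding Bseq_def by auto
  have "norm (gauss_binomial p M j) \<le> B1 * (B2 * B2)" for M j
  proof (cases "j \<le> M")
    case True
    then obtain k where k: "M = j + k" using le_Suc_ex by blast
    show ?thesis unfolding k gauss_binomial_eq[OF p] norm_mult
      by (intro mult_mono B1(2) B2(2)) (use B1(1) B2(1) in auto)
  next
    case False
    thus ?thesis using B1(1) B2(1) by (simp add: gauss_binomial_eq_0)
  qed
  thus ?thesis using that by blast
qed

text \<open>
  Each of the three finite products in the closed form of the binomial tends to Euler's product.
\<close>
lemma gauss_binomial_central_LIMSEQ: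
  assumes p: "norm p < 1"
  shows "(\<lambda>N. gauss_binomial p (2 * N) (N + k)) \<longlonglongrightarrow> inverse (euler_prod p)"
    and "(\<lambda>N. gauss_binomial p (2 * N) (N - k)) \<longlonglongrightarrow> inverse (euler_prod p)"
proof -
  have E: "euler_prod p \<noteq> 0" by (rule euler_prod_nonzero[OF p])
  have s1: "filterlim (\<lambda>N. N + k) sequentially sequentially"
    by (rule filterlim_add_const_nat_at_top)
  have s2: "filterlim (\<lambda>N. N - k) sequentially sequentially"
    by (rule filterlim_minus_const_nat_at_top)
  have s3: "filterlim (\<lambda>N. 2 * N) sequentially sequentially"
    by (rule filterlim_subseq) (simp add: strict_mono_def)
  note L = qpoch_LIMSEQ[OF p]
  have lim: "(\<lambda>N. qpoch p (2 * N) * (inverse (qpoch p (N + k)) * inverse (qpoch p (N - k)))) \<longlonglongrightarrow>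
     euler_prod p * (inverse (euler_prod p) * inverse (euler_prod p))"
    by (intro tendsto_mult tendsto_inverse filterlim_compose[OF L s1] filterlim_compose[OF L s2]
          filterlim_compose[OF L s3] E)
  have e: "euler_prod p * (inverse (euler_prod p) * inverse (euler_prod p)) = inverse (euler_prod p)"
    using E by simp
  have ev: "\<forall>\<^sub>F N in sequentially. gauss_binomial p (2 * N) (N + k) = qpoch p (2 * N) * (inverse (qpoch p (N + k)) * inverse (qpoch p (N - k)))"
    using eventually_ge_at_top[of k]
  proof eventually_elim
    case (elim N)
    have "2 * N = (N + k) + (N - k)" using elim by simp
    thus ?case by (metis gauss_binomial_eq[OF p])
  qed
  have ev': "\<forall>\<^sub>F N in sequentially. gauss_binomial p (2 * N) (N - k) = qpoch p (2 * N) * (inverse (qpoch p (N + k)) * inverse (qpoch p (N - k)))"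
    using eventually_ge_at_top[of k]
  proof eventually_elim
    case (elim N)
    have "2 * N = (N - k) + (N + k)" using elim by simp
    thus ?case using gauss_binomial_eq[OF p, of "N - k" "N + k"] by (simp only: mult_ac)
  qed
  show "(\<lambda>N. gauss_binomial p (2 * N) (N + k)) \<longlonglongrightarrow> inverse (euler_prod p)"
    using lim unfolding e by (rule Lim_transform_eventually) (use ev in \<open>auto elim: eventually_mono\<close>)
  show "(\<lambda>N. gauss_binomial p (2 * N) (N - k)) \<longlonglongrightarrow> inverse (euler_prod p)"
    using lim unfolding e by (rule Lim_transform_eventually) (use ev' in \<open>auto elim: eventually_mono\<close>)
qed

text \<open>
  Termwise passage to the limit in the finite identity. The Gaussian binomials are bounded
  uniformly, so Tannery's theorem applies with a geometric majorant.
\<close>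
lemma theta_series_LIMSEQ:
  fixes q :: complex
  assumes q: "norm q < 1" "q \<noteq> 0"
  shows "(\<lambda>N. (\<Prod>j<N. 1 + q ^ (2 * j + 1))^2) \<longlonglongrightarrow> theta_series q / euler_prod (q^2)"
proof -
  define p where "p = q^2"
  have p: "norm p < 1" unfolding p_def using norm_power_Suc_less_1[OF q(1), of 1] by (simp add: eval_nat_numeral)
  obtain B where B: "\<And>M j. norm (gauss_binomial p M j) \<le> B" using gauss_binomial_bounded[OF p] by blast
  have B0: "B \<ge> 0" using order.trans[OF norm_ge_zero B] .
  define a where "a = (\<lambda>k N. if k < N then (gauss_binomial p (2 * N) (N + Suc k) + gauss_binomial p (2 * N) (N - Suc k)) * q ^ (Suc k)^2 else 0)"
  define I where "I = inverse (euler_prod p)"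
  have "(\<lambda>N. \<Sum>k. a k N) \<longlonglongrightarrow> (\<Sum>k. (I + I) * q ^ (Suc k)^2)"
  proof (rule tannerys_theorem[THEN conjunct2, THEN conjunct2])
    fix k
    have "(\<lambda>N. (gauss_binomial p (2 * N) (N + Suc k) + gauss_binomial p (2 * N) (N - Suc k)) * q ^ (Suc k)^2)
       \<longlonglongrightarrow> (I + I) * q ^ (Suc k)^2"
      unfolding I_def by (intro tendsto_intros gauss_binomial_central_LIMSEQ[OF p])
    thus "(\<lambda>N. a k N) \<longlonglongrightarrow> (I + I) * q ^ (Suc k)^2"
      by (rule Lim_transform_eventually)
         (rule eventually_mono[OF eventually_gt_at_top[of k]], simp add: a_def)
  next
    have "norm (a k N) \<le> (B + B) * norm q ^ k" for k N
    proof (cases "k < N")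
      case True
      thus ?thesis unfolding a_def using B B0 theta_term_bound[OF q(1), of k]
        by (auto simp only: norm_mult if_True intro!: mult_mono norm_triangle_le add_mono norm_ge_zero)
    next
      case False
      thus ?thesis using B0 by (simp add: a_def)
    qed
    thus "\<forall>\<^sub>F (k, N) in at_top \<times>\<^sub>F sequentially. norm (a k N) \<le> (B + B) * norm q ^ k"
      by (intro always_eventually) auto
    show "summable (\<lambda>k. (B + B) * norm q ^ k)"
      by (intro summable_mult summable_geometric) (use q in simp)
  qed simp
  moreover have "(\<Sum>k. a k N) = (\<Sum>k<N. (gauss_binomial p (2 * N) (N + Suc k) + gauss_binomial p (2 * N) (N - Suc k)) * q ^ (Suc k)^2)" for N
    by (subst suminf_finite[of "{..<N}"]) (auto simp: a_def)
  ultimately have "(\<lambda>N. gauss_binomial p (2 * N) (N + 0) + (\<Sum>k<N. (gauss_binomial p (2 * N) (N + Suc k) + gauss_binomial p (2 * N) (N - Suc k)) * q ^ (Suc k)^2))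
     \<longlonglongrightarrow> I + (\<Sum>k. (I + I) * q ^ (Suc k)^2)"
    unfolding I_def by (intro tendsto_add gauss_binomial_central_LIMSEQ[OF p]) (simp only:)
  moreover have "(\<Sum>k. (I + I) * q ^ (Suc k)^2) = (I + I) * (\<Sum>k. q ^ (Suc k)^2)"
    by (rule suminf_mult[OF summable_norm_cancel[OF theta_summable[OF q(1)]]])
  moreover have "I + (I + I) * (\<Sum>k. q ^ (Suc k)^2) = theta_series q / euler_prod (q^2)"
    by (simp add: I_def p_def theta_series_def field_simps add_divide_distrib)
  ultimately show ?thesis
    unfolding finite_theta_product[OF q(2)] p_def [symmetric] by (simp only: add_0_right)
qed

lemma prod_plus_LIMSEQ:
  fixes q :: complex
  assumes q: "norm q < 1"
  shows "(\<lambda>N. \<Prod>i<N. 1 + q ^ Suc i) \<longlonglongrightarrow> euler_prod (q^2) / euler_prod q"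
proof -
  have q2: "norm (q^2) < 1" using norm_power_Suc_less_1[OF q, of 1] by (simp add: eval_nat_numeral)
  have "(\<Prod>i<N. 1 + q ^ Suc i) = qpoch (q^2) N / qpoch q N" for N
  proof -
    have "(\<Prod>i<N. 1 + q ^ Suc i) * qpoch q N = qpoch (q^2) N"
      unfolding qpoch_def prod.distrib [symmetric]
      by (rule prod.cong) (auto simp: algebra_simps power_mult_distrib power2_eq_square)
    thus ?thesis using qpoch_nonzero[OF q, of N] by (simp add: field_simps)
  qed
  thus ?thesis
    using tendsto_divide[OF qpoch_LIMSEQ[OF q2] qpoch_LIMSEQ[OF q] euler_prod_nonzero[OF q]] by (simp only:)
qed

text \<open>
  The product over odd exponents is the product over all exponents divided by the one over even
  exponents, and \<open>1 + q\<^sup>n = (1 - q\<^sup>2\<^sup>n) / (1 - q\<^sup>n)\<close>.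
\<close>
lemma prod_odd_plus_LIMSEQ:
  fixes q :: complex
  assumes q: "norm q < 1"
  shows "(\<lambda>N. \<Prod>j<N. 1 + q ^ (2 * j + 1)) \<longlonglongrightarrow> euler_prod (q^2)^2 / (euler_prod q * euler_prod (q^4))"
proof -
  have q2: "norm (q^2) < 1" using norm_power_Suc_less_1[OF q, of 1] by (simp add: eval_nat_numeral)
  have q4: "norm ((q^2)^2) < 1" using norm_power_Suc_less_1[OF q2, of 1] by (simp add: eval_nat_numeral)
  have e4: "(q^2)^2 = q^4" by (simp flip: power_mult)
  have split: "(\<Prod>j<N. 1 + q ^ (2 * j + 1)) * (\<Prod>j<N. 1 + (q^2) ^ Suc j) = (\<Prod>i<2 * N. 1 + q ^ Suc i)" for N
    by (induction N) (simp_all add: power_mult power_add eval_nat_numeral algebra_simps)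
  have nz: "(\<Prod>j<N. 1 + (q^2) ^ Suc j) \<noteq> 0" for N
  proof -
    have "1 + (q^2) ^ Suc j \<noteq> 0" for j
      using norm_power_Suc_less_1[OF q2, of j] by (metis add_eq_0_iff less_irrefl norm_minus_cancel norm_one)
    thus ?thesis by (simp del: power_Suc)
  qed
  have s: "filterlim (\<lambda>N. 2 * N) sequentially sequentially"
    by (rule filterlim_subseq) (simp add: strict_mono_def)
  have "(\<lambda>N. (\<Prod>i<2 * N. 1 + q ^ Suc i) / (\<Prod>j<N. 1 + (q^2) ^ Suc j)) \<longlonglongrightarrow>
     (euler_prod (q^2) / euler_prod q) / (euler_prod ((q^2)^2) / euler_prod (q^2))"
    by (intro tendsto_divide prod_plus_LIMSEQ q2 filterlim_compose[OF prod_plus_LIMSEQ[OF q] s])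
       (use euler_prod_nonzero q2 q4 in auto)
  moreover have "(\<Prod>i<2 * N. 1 + q ^ Suc i) / (\<Prod>j<N. 1 + (q^2) ^ Suc j) = (\<Prod>j<N. 1 + q ^ (2 * j + 1))" for N
    using split[of N] nz[of N] by (simp only: divide_eq_eq) simp
  ultimately show ?thesis
    unfolding e4 by (simp add: power2_eq_square)
qed

theorem theta_series_product:
  fixes q :: complex
  assumes q: "norm q < 1" "q \<noteq> 0"
  shows "theta_series q = euler_prod (q^2)^5 / (euler_prod q^2 * euler_prod (q^4)^2)"
proof -
  have q2: "norm (q^2) < 1" using norm_power_Suc_less_1[OF q(1), of 1] by (simp add: eval_nat_numeral)
  have "theta_series q / euler_prod (q^2) = (euler_prod (q^2)^2 / (euler_prod q * euler_prod (q^4)))^2"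
    by (rule LIMSEQ_unique[OF theta_series_LIMSEQ[OF q] tendsto_power[OF prod_odd_plus_LIMSEQ[OF q(1)]]])
  hence "theta_series q = (euler_prod (q^2)^2 / (euler_prod q * euler_prod (q^4)))^2 * euler_prod (q^2)"
    using euler_prod_nonzero[OF q2] by (simp add: divide_eq_eq)
  also have "\<dots> = euler_prod (q^2)^5 / (euler_prod q^2 * euler_prod (q^4)^2)"
    by (simp add: power_divide power_mult_distrib eval_nat_numeral mult_ac)
  finally show ?thesis .
qed

theorem theta_phi_eta_quotient:
  assumes z: "Im z > 0"
  shows "theta_phi z = dedekind_eta (2 * z) ^ 5 / (dedekind_eta z ^ 2 * dedekind_eta (4 * z) ^ 2)"
proof -
  define e where "e = exp (of_real pi * \<i> * z / 12)"
  have e0: "e \<noteq> 0" by (simp add: e_def)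
  have n: "nome (2 * z) = nome z ^ 2" "nome (4 * z) = nome z ^ 4"
    using nome_mult_nat[of 2 z] nome_mult_nat[of 4 z] by simp_all
  have e2: "exp (of_real pi * \<i> * (2 * z) / 12) = e ^ 2" and e4: "exp (of_real pi * \<i> * (4 * z) / 12) = e ^ 4"
    unfolding e_def by (simp_all add: exp_of_nat_mult [symmetric] field_simps)
  have q0: "nome z \<noteq> 0" by (simp add: nome_def)
  have "e ^ 10 * X / (e ^ 10 * Y) = X / Y" for X Y :: complex using e0 by simp
  moreover have "(e ^ 2 * X) ^ 5 = e ^ 10 * X ^ 5" "(e * Y) ^ 2 * (e ^ 4 * Z) ^ 2 = e ^ 10 * (Y ^ 2 * Z ^ 2)" for X Y Z :: complex
    by (simp_all add: eval_nat_numeral mult_ac)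
  ultimately show ?thesis
    unfolding theta_phi_conv_series[OF z] theta_series_product[OF norm_nome_less_1[OF z] q0]
      dedekind_eta_conv_euler_prod n e2 e4 e_def [symmetric] by (simp only:)
qed

section \<open>The action of the modular group\<close>

lemma mem_upper_half_plane [simp]: "z \<in> upper_half_plane \<longleftrightarrow> Im z > 0"
  by (simp add: upper_half_plane_def)

lemma open_upper_half_plane: "open upper_half_plane"
  unfolding upper_half_plane_def by (rule open_halfspace_Im_gt)

lemma connected_upper_half_plane: "connected upper_half_plane"
  unfolding upper_half_plane_def by (rule convex_connected[OF convex_halfspace_Im_gt])

definition mat22 :: "int \<Rightarrow> int \<Rightarrow> int \<Rightarrow> int \<Rightarrow> int ^ 2 ^ 2" where
  "mat22 a b c d = vector [vector [a, b], vector [c, d]]"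

lemma mat22_nth [simp]:
  "mat22 a b c d $ 1 $ 1 = a" "mat22 a b c d $ 1 $ 2 = b"
  "mat22 a b c d $ 2 $ 1 = c" "mat22 a b c d $ 2 $ 2 = d"
  by (simp_all add: mat22_def)

lemma SL2Z_iff: "\<gamma> \<in> SL2Z \<longleftrightarrow> \<gamma> $ 1 $ 1 * \<gamma> $ 2 $ 2 - \<gamma> $ 1 $ 2 * \<gamma> $ 2 $ 1 = 1"
  by (simp add: SL2Z_def det_2)

lemma matrix_mult_22:
  fixes A B :: "int ^ 2 ^ 2"
  shows "(A ** B) $ i $ j = A $ i $ 1 * B $ 1 $ j + A $ i $ 2 * B $ 2 $ j"
  by (simp add: matrix_matrix_mult_def sum_2)

lemma mat22_eqI:
  fixes A B :: "int ^ 2 ^ 2"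
  assumes "A $ 1 $ 1 = B $ 1 $ 1" "A $ 1 $ 2 = B $ 1 $ 2" "A $ 2 $ 1 = B $ 2 $ 1" "A $ 2 $ 2 = B $ 2 $ 2"
  shows "A = B"
  using assms by (simp add: vec_eq_iff forall_2)

lemma SL2Z_mult: "\<gamma> \<in> SL2Z \<Longrightarrow> \<delta> \<in> SL2Z \<Longrightarrow> \<gamma> ** \<delta> \<in> SL2Z"
  by (simp add: SL2Z_def det_mul)

definition autom_factor :: "int ^ 2 ^ 2 \<Rightarrow> complex \<Rightarrow> complex" where
  "autom_factor \<gamma> z = of_int (\<gamma> $ 2 $ 1) * z + of_int (\<gamma> $ 2 $ 2)"

definition moebius_action :: "int ^ 2 ^ 2 \<Rightarrow> complex \<Rightarrow> complex" where
  "moebius_action \<gamma> z = (of_int (\<gamma> $ 1 $ 1) * z + of_int (\<gamma> $ 1 $ 2)) / autom_factor \<gamma> z"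

lemma slash_eq: "slash k \<gamma> f z = autom_factor \<gamma> z powi (- k) * f (moebius_action \<gamma> z)"
  by (simp add: slash_def autom_factor_def moebius_action_def)

lemma autom_factor_nonzero:
  assumes "\<gamma> \<in> SL2Z" "Im z > 0" shows "autom_factor \<gamma> z \<noteq> 0"
proof
  assume "autom_factor \<gamma> z = 0"
  hence "of_int (\<gamma> $ 2 $ 1) * Im z = 0" "of_int (\<gamma> $ 2 $ 1) * Re z + of_int (\<gamma> $ 2 $ 2) = 0"
    by (auto simp: autom_factor_def complex_eq_iff)
  hence "\<gamma> $ 2 $ 1 = 0" "\<gamma> $ 2 $ 2 = 0" using assms(2) by auto
  thus False using assms(1) by (simp add: SL2Z_iff)
qed

lemma Im_moebius_action:
  assumes "\<gamma> \<in> SL2Z"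
  shows "Im (moebius_action \<gamma> z) = Im z / (norm (autom_factor \<gamma> z))^2"
proof -
  have "real_of_int (\<gamma> $ 1 $ 1 * \<gamma> $ 2 $ 2 - \<gamma> $ 1 $ 2 * \<gamma> $ 2 $ 1) = real_of_int 1"
    using assms by (simp only: SL2Z_iff)
  hence det: "of_int (\<gamma> $ 1 $ 1) * of_int (\<gamma> $ 2 $ 2) = 1 + of_int (\<gamma> $ 1 $ 2) * (of_int (\<gamma> $ 2 $ 1) :: real)"
    by simp
  have "Im (moebius_action \<gamma> z) =
      (of_int (\<gamma> $ 1 $ 1) * of_int (\<gamma> $ 2 $ 2) - of_int (\<gamma> $ 1 $ 2) * of_int (\<gamma> $ 2 $ 1)) * Im z / (norm (autom_factor \<gamma> z))^2"
    unfolding moebius_action_def Im_divide' by (simp add: autom_factor_def algebra_simps)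
  thus ?thesis using det by simp
qed

lemma Im_moebius_action_pos:
  assumes "\<gamma> \<in> SL2Z" "Im z > 0" shows "Im (moebius_action \<gamma> z) > 0"
  using assms autom_factor_nonzero[OF assms] by (simp add: Im_moebius_action)

lemma autom_factor_mult:
  assumes "\<delta> \<in> SL2Z" "Im z > 0"
  shows "autom_factor (\<gamma> ** \<delta>) z = autom_factor \<gamma> (moebius_action \<delta> z) * autom_factor \<delta> z"
proof -
  define j where "j = autom_factor \<delta> z"
  have j: "j \<noteq> 0" using autom_factor_nonzero[OF assms] by (simp add: j_def)
  have "autom_factor \<gamma> (moebius_action \<delta> z) * j =
     of_int (\<gamma> $ 2 $ 1) * (of_int (\<delta> $ 1 $ 1) * z + of_int (\<delta> $ 1 $ 2)) + of_int (\<gamma> $ 2 $ 2) * j"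
    unfolding autom_factor_def[of \<gamma>] moebius_action_def j_def [symmetric] using j by (simp add: field_simps)
  also have "\<dots> = autom_factor (\<gamma> ** \<delta>) z"
    by (simp add: j_def autom_factor_def matrix_mult_22 algebra_simps)
  finally show ?thesis by (simp add: j_def)
qed

lemma moebius_action_mult:
  assumes "\<gamma> \<in> SL2Z" "\<delta> \<in> SL2Z" "Im z > 0"
  shows "moebius_action (\<gamma> ** \<delta>) z = moebius_action \<gamma> (moebius_action \<delta> z)"
proof -
  define j where "j = autom_factor \<delta> z"
  have j: "j \<noteq> 0" using autom_factor_nonzero[OF assms(2,3)] by (simp add: j_def)
  have "moebius_action \<gamma> (moebius_action \<delta> z) =
     ((of_int (\<gamma> $ 1 $ 1) * moebius_action \<delta> z + of_int (\<gamma> $ 1 $ 2)) * j) / (autom_factor \<gamma> (moebius_action \<delta> z) * j)"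
    using j by (simp add: moebius_action_def[of \<gamma>])
  also have "autom_factor \<gamma> (moebius_action \<delta> z) * j = autom_factor (\<gamma> ** \<delta>) z"
    using autom_factor_mult[OF assms(2,3)] by (simp add: j_def)
  also have "(of_int (\<gamma> $ 1 $ 1) * moebius_action \<delta> z + of_int (\<gamma> $ 1 $ 2)) * j
     = of_int ((\<gamma> ** \<delta>) $ 1 $ 1) * z + of_int ((\<gamma> ** \<delta>) $ 1 $ 2)"
  proof -
    have "(of_int (\<gamma> $ 1 $ 1) * moebius_action \<delta> z + of_int (\<gamma> $ 1 $ 2)) * j =
      of_int (\<gamma> $ 1 $ 1) * (of_int (\<delta> $ 1 $ 1) * z + of_int (\<delta> $ 1 $ 2)) + of_int (\<gamma> $ 1 $ 2) * j"
      unfolding moebius_action_def[of \<delta>] j_def [symmetric] using j by (simp add: field_simps)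
    thus ?thesis by (simp add: j_def autom_factor_def matrix_mult_22 algebra_simps)
  qed
  finally show ?thesis by (simp add: moebius_action_def)
qed

lemma slash_mult:
  assumes "\<gamma> \<in> SL2Z" "\<delta> \<in> SL2Z" "Im z > 0"
  shows "slash k (\<gamma> ** \<delta>) f z = slash k \<delta> (slash k \<gamma> f) z"
  unfolding slash_eq autom_factor_mult[OF assms(2,3)] moebius_action_mult[OF assms] power_int_mult_distrib
  by (simp add: mult_ac)

lemma slash_holomorphic:
  assumes "\<gamma> \<in> SL2Z" "f holomorphic_on upper_half_plane"
  shows "slash k \<gamma> f holomorphic_on upper_half_plane"
proof -
  have j: "autom_factor \<gamma> holomorphic_on upper_half_plane"
    unfolding autom_factor_def [abs_def] by (intro holomorphic_intros)
  have m: "moebius_action \<gamma> holomorphic_on upper_half_plane"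
    unfolding moebius_action_def [abs_def]
    by (intro holomorphic_intros j) (use assms(1) autom_factor_nonzero in auto)
  have "moebius_action \<gamma> ` upper_half_plane \<subseteq> upper_half_plane"
    using Im_moebius_action_pos[OF assms(1)] by auto
  from holomorphic_on_compose_gen[OF m assms(2) this]
  have "(\<lambda>z. f (moebius_action \<gamma> z)) holomorphic_on upper_half_plane" by (simp add: o_def)
  thus ?thesis unfolding slash_eq [abs_def]
    by (intro holomorphic_on_mult holomorphic_on_power_int j) (use assms(1) autom_factor_nonzero in auto)
qed

section \<open>Maximum principles\<close>

lemma periodic_shift_int:
  fixes u :: "complex \<Rightarrow> 'b" and p :: real
  assumes T: "\<And>z. Im z > 0 \<Longrightarrow> u (z + of_real p) = u z" and z: "Im z > 0"
  shows "u (z + of_int n * of_real p) = u z"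
proof (induction n rule: int_induct[where k = 0])
  case (step1 i)
  thus ?case using T[of "z + of_int i * of_real p"] z by (simp add: algebra_simps)
next
  case (step2 i)
  thus ?case using T[of "z + of_int (i - 1) * of_real p"] z by (simp add: algebra_simps)
qed simp

text \<open>
  After a translation \<open>\<bar>Re z\<bar> \<le> 1/2\<close>. If then \<open>Im z < 1/2\<close>, so that \<open>\<bar>z\<bar>\<^sup>2 \<le> 1/2\<close>, the inversion at least doubles
  the imaginary part. Hence finitely many steps lead into the half strip \<open>Im z \<ge> 1/2\<close>, which is
  larger than the usual fundamental domain but serves the same purpose.
\<close>
lemma reduce_to_strip:
  fixes u :: "complex \<Rightarrow> 'b"
  assumes T: "\<And>z. Im z > 0 \<Longrightarrow> u (z + 1) = u z" and S: "\<And>z. Im z > 0 \<Longrightarrow> u (- 1 / z) = u z"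
    and z: "Im z > 0"
  obtains w where "Im w \<ge> 1/2" "\<bar>Re w\<bar> \<le> 1/2" "u w = u z"
proof -
  have "\<exists>w. Im w \<ge> 1/2 \<and> \<bar>Re w\<bar> \<le> 1/2 \<and> u w = u z" if "Im z > 0" "Im z \<ge> (1/2) * (1/2) ^ n" for n z
    using that
  proof (induction n arbitrary: z)
    case 0
    define w where "w = z + of_int (- round (Re z))"
    have "u w = u z"
      unfolding w_def using periodic_shift_int[of u 1 z "- round (Re z)"] T 0 by simp
    moreover have "\<bar>Re w\<bar> \<le> 1/2" using of_int_round_abs_le[of "Re z"] by (simp add: w_def abs_minus_commute)
    ultimately show ?case using 0 by (intro exI[of _ w]) (auto simp: w_def)
  next
    case (Suc n)
    define w where "w = z + of_int (- round (Re z))"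
    have uw: "u w = u z"
      unfolding w_def using periodic_shift_int[of u 1 z "- round (Re z)"] T Suc.prems by simp
    have Re: "\<bar>Re w\<bar> \<le> 1/2" using of_int_round_abs_le[of "Re z"] by (simp add: w_def abs_minus_commute)
    have Im: "Im w = Im z" by (simp add: w_def)
    show ?case
    proof (cases "Im w \<ge> 1/2")
      case True
      thus ?thesis using uw Re by blast
    next
      case False
      have "(norm w)^2 \<le> 1/2"
      proof -
        have "(Re w)^2 \<le> (1/2)^2" using Re by (simp add: abs_le_square_iff [symmetric])
        moreover have "(Im w)^2 \<le> (1/2)^2" using False Im Suc.prems by (intro power_mono) auto
        ultimately show ?thesis unfolding cmod_power2 by (simp add: power_divide)
      qed
      moreover have pos: "(norm w)^2 > 0" using Im Suc.prems by auto
      ultimately have "Im z * (norm w)^2 \<le> Im z * (1/2)" using Suc.prems by (intro mult_left_mono) auto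
      hence "2 * Im z \<le> Im z / (norm w)^2" using pos by (simp add: field_simps)
      moreover have Im': "Im (- 1 / w) = Im z / (norm w)^2"
        by (simp add: Im_divide' Im)
      ultimately have "Im (- 1 / w) \<ge> 2 * Im z" by (simp only:)
      hence "Im (- 1 / w) \<ge> (1/2) * (1/2) ^ n" "Im (- 1 / w) > 0"
        using Suc.prems unfolding power_Suc by linarith+
      from Suc.IH[OF this(2,1)] show ?thesis using S[of w] uw Im Suc.prems by auto
    qed
  qed
  moreover obtain n where "(1/2) ^ n < Im z"
    using real_arch_pow_inv[of "Im z" "1/2"] z by auto
  hence "Im z \<ge> (1/2) * (1/2) ^ n"
    using zero_less_power[of "1/2 :: real" n] by linarith
  ultimately show ?thesis using z that by blast
qed

lemma max_modulus_upper_half: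
  assumes "f holomorphic_on {z. Im z > c}" "Im w > c" "\<And>z. Im z > c \<Longrightarrow> norm (f z) \<le> norm (f w)" "Im z > c"
  shows "f z = f w"
proof -
  have "f constant_on {z. Im z > c}"
    by (rule maximum_modulus_principle[where U = "{z. Im z > c}" and \<xi> = w])
       (use assms open_halfspace_Im_gt convex_connected[OF convex_halfspace_Im_gt] in auto)
  thus ?thesis using assms(2,4) by (auto simp: constant_on_def)
qed

text \<open>
  If the function were nonzero somewhere, its modulus would have a maximum on the half plane, attained on a
  compact part of the strip. It would then be constant, against its limit at infinity.
\<close>
lemma invariant_vanishing_at_infinity_eq_0:
  assumes hol: "h holomorphic_on upper_half_plane"
    and T: "\<And>z. Im z > 0 \<Longrightarrow> h (z + 1) = h z" and S: "\<And>z. Im z > 0 \<Longrightarrow> h (- 1 / z) = h z"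
    and lim: "\<And>e. e > 0 \<Longrightarrow> \<exists>Y. \<forall>z. Im z > Y \<longrightarrow> norm (h z) < e"
    and z: "Im z > 0"
  shows "h z = 0"
proof (rule ccontr)
  assume nz: "h z \<noteq> 0"
  obtain z0 where z0: "Im z0 \<ge> 1/2" "\<bar>Re z0\<bar> \<le> 1/2" "h z0 = h z"
    using reduce_to_strip[of h z] T S z by metis
  obtain Y where Y: "\<And>z. Im z > Y \<Longrightarrow> norm (h z) < norm (h z0)"
    using lim[of "norm (h z0)"] nz z0 by auto
  define K where "K = cbox (Complex (-1/2) (1/2)) (Complex (1/2) Y)"
  have K: "z \<in> K \<longleftrightarrow> \<bar>Re z\<bar> \<le> 1/2 \<and> 1/2 \<le> Im z \<and> Im z \<le> Y" for z
    by (auto simp: K_def in_cbox_complex_iff)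
  have z0K: "z0 \<in> K" using z0 Y[of z0] K by force
  have "K \<subseteq> upper_half_plane" using K by force
  hence "continuous_on K h" using hol holomorphic_on_imp_continuous_on holomorphic_on_subset by blast
  hence "\<exists>w\<in>K. \<forall>z\<in>K. norm (h z) \<le> norm (h w)"
    using z0K by (intro continuous_attains_sup continuous_on_norm) (auto simp: K_def)
  then obtain w where w: "w \<in> K" "\<And>z. z \<in> K \<Longrightarrow> norm (h z) \<le> norm (h w)" by blast
  have max: "norm (h z) \<le> norm (h w)" if z: "Im z > 0" for z
  proof -
    obtain z' where z': "Im z' \<ge> 1/2" "\<bar>Re z'\<bar> \<le> 1/2" "h z' = h z"
      using reduce_to_strip[of h z] T S z by metis
    show ?thesis
    proof (cases "Im z' \<le> Y")
      case True
      thus ?thesis using w(2)[of z'] z' K by auto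
    next
      case False
      thus ?thesis using Y[of z'] w(2)[OF z0K] z' by auto
    qed
  qed
  have w0: "Im w > 0" using w(1) K by force
  define v where "v = \<i> * of_real (max Y 0 + 1)"
  have v: "Im v > 0" "Im v > Y" by (auto simp: v_def)
  have "h v = h w"
    by (rule max_modulus_upper_half[of h 0]) (use hol w0 max v in \<open>auto simp: upper_half_plane_def\<close>)
  thus False using Y[OF v(2)] w(2)[OF z0K] by simp
qed

text \<open>
  A Phragmen-Lindelof argument: the factor \<open>exp (\<i> \<epsilon> z)\<close> forces decay at infinity and has a periodic
  modulus, so the maximum of the product on \<open>Im z \<ge> 1\<close> lies on the line \<open>Im z = 1\<close>, where the bound
  does not depend on \<open>\<epsilon>\<close>. Then let \<open>\<epsilon>\<close> tend to 0.
\<close>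
lemma periodic_polynomial_growth_bounded:
  fixes p :: real
  assumes hol: "f holomorphic_on upper_half_plane" and p: "p > 0"
    and T: "\<And>z. Im z > 0 \<Longrightarrow> f (z + of_real p) = f z"
    and growth: "\<And>z. Im z \<ge> 1 \<Longrightarrow> 0 \<le> Re z \<Longrightarrow> Re z \<le> p \<Longrightarrow> norm (f z) \<le> C * Im z ^ n"
  shows "\<exists>B. \<forall>z. Im z \<ge> 1 \<longrightarrow> norm (f z) \<le> B"
proof -
  have trans: "\<exists>w. Im w = Im z \<and> 0 \<le> Re w \<and> Re w \<le> p \<and> f w = f z" if "Im z > 0" for z
  proof -
    define m where "m = \<lfloor>Re z / p\<rfloor>"
    define w where "w = z + of_int (- m) * of_real p"
    have "f w = f z" unfolding w_def by (rule periodic_shift_int[where u = f and p = p, OF T that])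
    moreover have "of_int m \<le> Re z / p" "Re z / p < of_int m + 1" by (auto simp: m_def)
    hence "of_int m * p \<le> Re z" "Re z < (of_int m + 1) * p" using p by (simp_all add: field_simps)
    ultimately show ?thesis by (intro exI[of _ w]) (auto simp: w_def algebra_simps)
  qed
  have cont: "continuous_on A f" if "A \<subseteq> upper_half_plane" for A
    using hol holomorphic_on_imp_continuous_on holomorphic_on_subset that by blast
  define L where "L = cbox (Complex 0 1) (Complex p 1)"
  have L: "z \<in> L \<longleftrightarrow> 0 \<le> Re z \<and> Re z \<le> p \<and> Im z = 1" for z
    by (auto simp: L_def in_cbox_complex_iff)
  have "L \<noteq> {}" using p L[of \<i>] by auto
  hence "\<exists>w\<in>L. \<forall>z\<in>L. norm (f z) \<le> norm (f w)"
    by (intro continuous_attains_sup continuous_on_norm cont) (use L in \<open>auto simp: L_def\<close>)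
  then obtain M where M: "M \<ge> 0" "\<And>z. Im z = 1 \<Longrightarrow> norm (f z) \<le> M"
    using trans by (metis L norm_ge_zero zero_less_one)
  have claim: "norm (f z) * exp (- \<epsilon> * Im z) \<le> M" if \<epsilon>: "\<epsilon> > 0" and z: "Im z \<ge> 1" for \<epsilon> z
  proof (rule ccontr)
    assume neg: "\<not> norm (f z) * exp (- \<epsilon> * Im z) \<le> M"
    define g where "g = (\<lambda>z. f z * exp (\<i> * of_real \<epsilon> * z))"
    have ng: "norm (g z) = norm (f z) * exp (- \<epsilon> * Im z)" for z
      by (simp add: g_def norm_mult)
    have gz: "norm (g z) > M" using neg by (simp add: ng)
    have lim: "((\<lambda>y. C * y ^ n * exp (- \<epsilon> * y)) \<longlongrightarrow> 0) at_top"
      using \<epsilon> by real_asymp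
    have "eventually (\<lambda>y. C * y ^ n * exp (- \<epsilon> * y) < norm (g z)) at_top"
      by (rule order_tendstoD(2)[OF lim]) (use gz M(1) in linarith)
    then obtain Y where Y: "\<And>y. y \<ge> Y \<Longrightarrow> C * y ^ n * exp (- \<epsilon> * y) < norm (g z)"
      by (auto simp: eventually_at_top_linorder)
    have far: "norm (g v) < norm (g z)" if v: "Im v \<ge> Y" "Im v \<ge> 1" for v
    proof -
      obtain w where w: "Im w = Im v" "0 \<le> Re w" "Re w \<le> p" "f w = f v" using trans[of v] v by force
      have "norm (g v) \<le> C * Im v ^ n * exp (- \<epsilon> * Im v)"
        unfolding ng using growth[of w] w v by (intro mult_right_mono) auto
      also have "\<dots> < norm (g z)" by (rule Y) fact
      finally show ?thesis .
    qed
    define K where "K = cbox (Complex 0 1) (Complex p Y)"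
    have K: "v \<in> K \<longleftrightarrow> 0 \<le> Re v \<and> Re v \<le> p \<and> 1 \<le> Im v \<and> Im v \<le> Y" for v
      by (auto simp: K_def in_cbox_complex_iff)
    obtain z' where z': "Im z' = Im z" "0 \<le> Re z'" "Re z' \<le> p" "f z' = f z" using trans[of z] z by force
    have "Im z < Y" using far[of z] z by force
    hence z'K: "z' \<in> K" using z' z K by auto
    have "K \<subseteq> upper_half_plane" using K by force
    hence "continuous_on K g" unfolding g_def by (intro continuous_intros cont)
    hence "\<exists>w\<in>K. \<forall>z\<in>K. norm (g z) \<le> norm (g w)"
      using z'K by (intro continuous_attains_sup continuous_on_norm) (auto simp: K_def)
    then obtain w where w: "w \<in> K" "\<And>z. z \<in> K \<Longrightarrow> norm (g z) \<le> norm (g w)" by blast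
    have gw: "norm (g z) \<le> norm (g w)" using w(2)[OF z'K] z' by (simp add: ng)
    have max: "norm (g v) \<le> norm (g w)" if v: "Im v > 1" for v
    proof (cases "Im v \<le> Y")
      case True
      obtain v' where v': "Im v' = Im v" "0 \<le> Re v'" "Re v' \<le> p" "f v' = f v" using trans[of v] v by force
      have "norm (g v) = norm (g v')" using v' by (simp add: ng)
      also have "\<dots> \<le> norm (g w)" by (rule w(2)) (use v v' True K in auto)
      finally show ?thesis .
    next
      case False
      thus ?thesis using far[of v] v gw by simp
    qed
    have w1: "Im w > 1"
    proof (rule ccontr)
      assume "\<not> Im w > 1"
      hence "Im w = 1" using w(1) K by force
      hence "norm (g w) \<le> M * 1"
        unfolding ng using M \<epsilon> by (intro mult_mono) auto
      thus False using gw gz by simp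
    qed
    define v where "v = \<i> * of_real (max Y 1 + 1)"
    have v: "Im v > 1" "Im v \<ge> Y" by (auto simp: v_def)
    have "g holomorphic_on {z. Im z > 1}"
      unfolding g_def by (intro holomorphic_intros holomorphic_on_subset[OF hol]) (auto simp: upper_half_plane_def)
    hence "g v = g w" by (rule max_modulus_upper_half) (use w1 max v in auto)
    thus False using far[of v] v gw by simp
  qed
  have "norm (f z) \<le> M" if z: "Im z \<ge> 1" for z
  proof (rule tendsto_le[where F = "at_right (0::real)"])
    have "((\<lambda>\<epsilon>. norm (f z) * exp (- \<epsilon> * Im z)) \<longlongrightarrow> norm (f z) * exp (- 0 * Im z)) (at_right (0::real))"
      by (intro tendsto_intros)
    thus "((\<lambda>\<epsilon>. norm (f z) * exp (- \<epsilon> * Im z)) \<longlongrightarrow> norm (f z)) (at_right (0::real))" by simp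
    show "eventually (\<lambda>\<epsilon>. norm (f z) * exp (- \<epsilon> * Im z) \<le> M) (at_right (0::real))"
      using eventually_at_right_less by eventually_elim (use claim z in auto)
  qed auto
  thus ?thesis by blast
qed


section \<open>Moderate growth\<close>

lemma euler_prod_continuous: "r < 1 \<Longrightarrow> continuous_on (cball 0 r) euler_prod"
proof (intro continuous_at_imp_continuous_on ballI)
  fix q :: complex assume "r < 1" "q \<in> cball 0 r"
  hence "norm q < 1" by simp
  thus "isCont euler_prod q" using euler_prod_logderiv[of q] DERIV_isCont by metis
qed

lemma norm_zeta12 [simp]: "norm (zeta12 n) = 1"
  by (simp add: zeta12_def)

text \<open>
  The function \<open>\<bar>\<eta>(z)\<bar>\<^sup>4 Im z\<close> is invariant under the modular group, so it suffices to bound it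
  on the half strip, where \<open>\<bar>\<eta>(z)\<bar>\<close> decays exponentially.
\<close>
lemma norm_dedekind_eta_bound:
  obtains B where "\<And>z. Im z > 0 \<Longrightarrow> norm (dedekind_eta z) ^ 4 * Im z \<le> B"
proof -
  define u where "u = (\<lambda>z. norm (dedekind_eta z) ^ 4 * Im z)"
  (* On the half strip the nome has modulus at most exp (- pi). *)
  have e1: "exp (- pi) < (1 :: real)" by simp
  have "compact (euler_prod ` cball 0 (exp (- pi)))"
    by (intro compact_continuous_image euler_prod_continuous e1 compact_cball)
  hence "bounded (euler_prod ` cball 0 (exp (- pi)))" by (rule compact_imp_bounded)
  then obtain B where B: "B > 0" "\<And>q. norm q \<le> exp (- pi) \<Longrightarrow> norm (euler_prod q) \<le> B"
    unfolding bounded_pos by (auto simp: dist_norm)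
  have T: "u (z + 1) = u z" if "Im z > 0" for z
  proof -
    have "norm (dedekind_eta (z + 1) ^ 2) = norm (dedekind_eta z ^ 2)"
      using dedekind_eta_sq_plus_of_int[of z 1] by (simp add: norm_mult)
    hence "(norm (dedekind_eta (z + 1)) ^ 2) ^ 2 = (norm (dedekind_eta z) ^ 2) ^ 2"
      by (simp only: norm_power)
    thus ?thesis by (simp add: u_def flip: power_mult)
  qed
  have S: "u (- 1 / z) = u z" if z: "Im z > 0" for z
  proof -
    have "norm (dedekind_eta (- 1 / z) ^ 2) = norm z * norm (dedekind_eta z ^ 2)"
      unfolding dedekind_eta_sq_inversion[OF z] by (simp add: norm_mult)
    hence "(norm (dedekind_eta (- 1 / z)) ^ 2) ^ 2 = (norm z * norm (dedekind_eta z) ^ 2) ^ 2"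
      by (simp only: norm_power)
    hence "norm (dedekind_eta (- 1 / z)) ^ 4 = norm z ^ 2 * norm (dedekind_eta z) ^ 4"
      by (simp add: power_mult_distrib flip: power_mult)
    moreover have "Im (- 1 / z) = Im z / norm z ^ 2" by (simp add: Im_divide')
    moreover have "norm z \<noteq> 0" using z by auto
    ultimately show ?thesis by (simp add: u_def)
  qed
  have "u z \<le> B ^ 4" if z: "Im z > 0" for z
  proof -
    obtain w where w: "Im w \<ge> 1/2" "u w = u z"
      using reduce_to_strip[of u z] T S z by metis
    have "norm (nome w) \<le> exp (- pi)" using w(1) by (simp add: norm_nome)
    hence P: "norm (euler_prod (nome w)) \<le> B" by (rule B(2))
    have "norm (dedekind_eta w) = exp (- pi * Im w / 12) * norm (euler_prod (nome w))"
      by (simp add: dedekind_eta_conv_euler_prod norm_mult)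
    hence "u w = (exp (- pi * Im w / 12) ^ 4 * Im w) * norm (euler_prod (nome w)) ^ 4"
      by (simp add: u_def power_mult_distrib)
    also have "exp (- pi * Im w / 12) ^ 4 = exp (- pi * Im w / 3)"
      by (simp add: exp_of_nat_mult [symmetric])
    also have "exp (- pi * Im w / 3) * Im w \<le> exp (- Im w) * exp (Im w)"
    proof (rule mult_mono)
      show "exp (- pi * Im w / 3) \<le> exp (- Im w)"
        using mult_right_mono[of 3 pi "Im w"] pi_gt3 w(1) by simp
      show "Im w \<le> exp (Im w)" using exp_ge_add_one_self[of "Im w"] by linarith
    qed (use w(1) in auto)
    also have "exp (- Im w) * exp (Im w) = 1" by (simp flip: exp_add)
    finally have "u w \<le> 1 * norm (euler_prod (nome w)) ^ 4"
      by (simp add: mult_right_mono)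
    also have "\<dots> \<le> B ^ 4" using P by (simp add: power_mono)
    finally show ?thesis using w(2) by simp
  qed
  thus ?thesis using that[of "B ^ 4"] by (simp add: u_def)
qed

text \<open>
  Growth towards the real axis, uniformly in all directions and with a bound that can be read off
  from the coefficients of a \<open>q\<close>-series. It includes boundedness at infinity.
\<close>
definition moderate_growth :: "(complex \<Rightarrow> complex) \<Rightarrow> bool" where
  "moderate_growth f \<longleftrightarrow> (\<exists>C n. \<forall>z. Im z > 0 \<longrightarrow> norm (f z) \<le> C * (1 + 1 / Im z) ^ n)"

lemma moderate_growthI:
  assumes "\<And>z. Im z > 0 \<Longrightarrow> norm (f z) \<le> C * (1 + 1 / Im z) ^ n"
  shows "moderate_growth f"
  using assms unfolding moderate_growth_def by blast

lemma moderate_growthE: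
  assumes "moderate_growth f"
  obtains C n where "C \<ge> 0" "\<And>z. Im z > 0 \<Longrightarrow> norm (f z) \<le> C * (1 + 1 / Im z) ^ n"
proof -
  obtain C n where C: "\<And>z. Im z > 0 \<Longrightarrow> norm (f z) \<le> C * (1 + 1 / Im z) ^ n"
    using assms unfolding moderate_growth_def by blast
  have "0 \<le> C * 2 ^ n" using order.trans[OF norm_ge_zero C[of \<i>]] by simp
  hence "C \<ge> 0" using mult_neg_pos[of C "2 ^ n"] by (meson not_le zero_less_numeral zero_less_power)
  with C that show ?thesis by blast
qed

lemma moderate_growth_const: "moderate_growth (\<lambda>z. c)"
  by (rule moderate_growthI[where n = 0 and C = "norm c"]) simp

lemma moderate_growth_mult:
  assumes "moderate_growth f" "moderate_growth g"
  shows "moderate_growth (\<lambda>z. f z * g z)"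
proof -
  obtain C m where 1: "C \<ge> 0" "\<And>z. Im z > 0 \<Longrightarrow> norm (f z) \<le> C * (1 + 1 / Im z) ^ m"
    using moderate_growthE[OF assms(1)] by blast
  obtain D n where 2: "D \<ge> 0" "\<And>z. Im z > 0 \<Longrightarrow> norm (g z) \<le> D * (1 + 1 / Im z) ^ n"
    using moderate_growthE[OF assms(2)] by blast
  show ?thesis
  proof (rule moderate_growthI[where C = "C * D" and n = "m + n"])
    fix z :: complex assume z: "Im z > 0"
    have "norm (f z * g z) \<le> (C * (1 + 1 / Im z) ^ m) * (D * (1 + 1 / Im z) ^ n)"
      unfolding norm_mult by (intro mult_mono 1 2 z) (use 1(1) z in auto)
    thus "norm (f z * g z) \<le> C * D * (1 + 1 / Im z) ^ (m + n)"
      by (simp add: power_add mult_ac)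
  qed
qed

lemma moderate_growth_add:
  assumes "moderate_growth f" "moderate_growth g"
  shows "moderate_growth (\<lambda>z. f z + g z)"
proof -
  obtain C m where 1: "C \<ge> 0" "\<And>z. Im z > 0 \<Longrightarrow> norm (f z) \<le> C * (1 + 1 / Im z) ^ m"
    using moderate_growthE[OF assms(1)] by blast
  obtain D n where 2: "D \<ge> 0" "\<And>z. Im z > 0 \<Longrightarrow> norm (g z) \<le> D * (1 + 1 / Im z) ^ n"
    using moderate_growthE[OF assms(2)] by blast
  show ?thesis
  proof (rule moderate_growthI[where C = "C + D" and n = "m + n"])
    fix z :: complex assume z: "Im z > 0"
    have le: "(1 + 1 / Im z) ^ m \<le> (1 + 1 / Im z) ^ (m + n)" "(1 + 1 / Im z) ^ n \<le> (1 + 1 / Im z) ^ (m + n)"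
      using z by (intro power_increasing; simp)+
    have "norm (f z + g z) \<le> C * (1 + 1 / Im z) ^ m + D * (1 + 1 / Im z) ^ n"
      by (intro norm_triangle_le add_mono 1 2 z)
    also have "\<dots> \<le> C * (1 + 1 / Im z) ^ (m + n) + D * (1 + 1 / Im z) ^ (m + n)"
      by (intro add_mono mult_left_mono le 1 2)
    finally show "norm (f z + g z) \<le> (C + D) * (1 + 1 / Im z) ^ (m + n)"
      by (simp add: distrib_right)
  qed
qed

lemma moderate_growth_scale:
  assumes "moderate_growth f" "a > 0"
  shows "moderate_growth (\<lambda>z. f (of_nat a * z))"
proof -
  obtain C m where 1: "C \<ge> 0" "\<And>z. Im z > 0 \<Longrightarrow> norm (f z) \<le> C * (1 + 1 / Im z) ^ m"
    using moderate_growthE[OF assms(1)] by blast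
  show ?thesis
  proof (rule moderate_growthI[where C = C and n = m])
    fix z :: complex assume z: "Im z > 0"
    have az: "Im (of_nat a * z) \<ge> Im z" using z assms(2) by (cases a) (auto simp: field_simps)
    have "norm (f (of_nat a * z)) \<le> C * (1 + 1 / Im (of_nat a * z)) ^ m" using az z by (intro 1) auto
    also have "\<dots> \<le> C * (1 + 1 / Im z) ^ m"
      by (intro mult_left_mono power_mono add_mono divide_left_mono 1 az) (use az z in auto)
    finally show "norm (f (of_nat a * z)) \<le> C * (1 + 1 / Im z) ^ m" .
  qed
qed

lemma moderate_growth_dedekind_eta: "moderate_growth dedekind_eta"
proof -
  obtain B where B: "\<And>z. Im z > 0 \<Longrightarrow> norm (dedekind_eta z) ^ 4 * Im z \<le> B"
    using norm_dedekind_eta_bound by blast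
  show ?thesis
  proof (rule moderate_growthI[where C = "1 + \<bar>B\<bar>" and n = 1])
    fix z :: complex assume z: "Im z > 0"
    have "norm (dedekind_eta z) ^ 4 \<le> \<bar>B\<bar> / Im z" using B[OF z] z by (simp add: field_simps)
    moreover have "norm (dedekind_eta z) \<le> 1 + norm (dedekind_eta z) ^ 4"
    proof (cases "norm (dedekind_eta z) \<le> 1")
      case False
      thus ?thesis using power_increasing[of 1 4 "norm (dedekind_eta z)"] by simp
    qed (simp add: add_increasing2)
    ultimately have "norm (dedekind_eta z) \<le> 1 + \<bar>B\<bar> * (1 / Im z)" by simp
    also have "\<dots> \<le> (1 + \<bar>B\<bar>) * (1 + 1 / Im z) ^ 1" using z by (simp add: algebra_simps add_divide_distrib)
    finally show "norm (dedekind_eta z) \<le> (1 + \<bar>B\<bar>) * (1 + 1 / Im z) ^ 1" .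
  qed
qed

section \<open>Forms of moderate growth\<close>

text \<open>
  Here moderate growth takes the place of boundedness at the cusps. Unlike the latter, it is evidently
  inherited by \<open>f(a z)\<close>.
\<close>
definition moderate_forms :: "nat \<Rightarrow> nat \<Rightarrow> (complex \<Rightarrow> complex) set" where
  "moderate_forms k N = {f. f holomorphic_on upper_half_plane \<and>
     (\<forall>\<gamma>\<in>Gamma0 N. \<forall>z. Im z > 0 \<longrightarrow> slash (int k) \<gamma> f z = f z) \<and> moderate_growth f}"

lemma Gamma0_SL2Z: "\<gamma> \<in> Gamma0 N \<Longrightarrow> \<gamma> \<in> SL2Z"
  by (simp add: Gamma0_def)

lemma moderate_forms_add:
  assumes "f \<in> moderate_forms k N" "g \<in> moderate_forms k N"
  shows "(\<lambda>z. f z + g z) \<in> moderate_forms k N"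
  using assms by (auto simp: moderate_forms_def slash_eq distrib_left intro!: holomorphic_intros moderate_growth_add)

lemma moderate_forms_cmult:
  assumes "f \<in> moderate_forms k N"
  shows "(\<lambda>z. c * f z) \<in> moderate_forms k N"
  using assms by (auto simp: moderate_forms_def slash_eq mult.left_commute[of _ c]
      intro!: holomorphic_intros moderate_growth_mult moderate_growth_const)

lemma moderate_forms_diff:
  assumes "f \<in> moderate_forms k N" "g \<in> moderate_forms k N"
  shows "(\<lambda>z. f z - g z) \<in> moderate_forms k N"
  using moderate_forms_add[OF assms(1) moderate_forms_cmult[OF assms(2), of "-1"]] by simp

lemma moderate_forms_mult:
  assumes "f \<in> moderate_forms k N" "g \<in> moderate_forms l N"
  shows "(\<lambda>z. f z * g z) \<in> moderate_forms (k + l) N"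
proof -
  have "slash (int (k + l)) \<gamma> (\<lambda>z. f z * g z) z = slash (int k) \<gamma> f z * slash (int l) \<gamma> g z"
    if "\<gamma> \<in> Gamma0 N" "Im z > 0" for \<gamma> z
    using autom_factor_nonzero[OF Gamma0_SL2Z[OF that(1)] that(2)]
    by (simp add: slash_eq power_int_diff power_int_minus field_simps power_add)
  thus ?thesis using assms by (auto simp: moderate_forms_def intro!: holomorphic_intros moderate_growth_mult)
qed

text \<open>
  The quotient \<open>\<gamma>' \<gamma>\<^sup>-\<^sup>1\<close> has the assumed number as its lower left entry, so it lies in \<open>\<Gamma>\<^sub>0(N)\<close>.
\<close>
lemma moderate_forms_slash_coset:
  assumes f: "f \<in> moderate_forms k N" and g: "\<gamma> \<in> SL2Z" "\<gamma>' \<in> SL2Z"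
    and N: "int N dvd \<gamma>' $ 2 $ 1 * \<gamma> $ 2 $ 2 - \<gamma>' $ 2 $ 2 * \<gamma> $ 2 $ 1" and z: "Im z > 0"
  shows "slash (int k) \<gamma>' f z = slash (int k) \<gamma> f z"
proof -
  define a b c d where abcd: "a = \<gamma> $ 1 $ 1" "b = \<gamma> $ 1 $ 2" "c = \<gamma> $ 2 $ 1" "d = \<gamma> $ 2 $ 2"
  define a' b' c' d' where abcd': "a' = \<gamma>' $ 1 $ 1" "b' = \<gamma>' $ 1 $ 2" "c' = \<gamma>' $ 2 $ 1" "d' = \<gamma>' $ 2 $ 2"
  have det: "a * d - b * c = 1" "a' * d' - b' * c' = 1" using g by (simp_all add: SL2Z_iff abcd abcd')
  define \<delta> where "\<delta> = mat22 (a' * d - b' * c) (b' * a - a' * b) (c' * d - d' * c) (d' * a - c' * b)"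
  have "(a' * d - b' * c) * (d' * a - c' * b) - (b' * a - a' * b) * (c' * d - d' * c) = (a * d - b * c) * (a' * d' - b' * c')"
    by (simp add: algebra_simps)
  hence \<delta>: "\<delta> \<in> Gamma0 N"
    using N det by (simp add: Gamma0_def SL2Z_iff \<delta>_def abcd abcd')
  have m: "\<delta> ** \<gamma> = \<gamma>'"
  proof (rule mat22_eqI)
    (* Multiplying by the determinant of the first matrix makes both sides homogeneous of the same degree. *)
    have e: "x = x * (a * d - b * c)" for x using det(1) by simp
    show "(\<delta> ** \<gamma>) $ 1 $ 1 = \<gamma>' $ 1 $ 1"
      unfolding matrix_mult_22 abcd [symmetric] abcd' [symmetric] by (subst e[of a']) (simp add: \<delta>_def algebra_simps)
    show "(\<delta> ** \<gamma>) $ 1 $ 2 = \<gamma>' $ 1 $ 2"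
      unfolding matrix_mult_22 abcd [symmetric] abcd' [symmetric] by (subst e[of b']) (simp add: \<delta>_def algebra_simps)
    show "(\<delta> ** \<gamma>) $ 2 $ 1 = \<gamma>' $ 2 $ 1"
      unfolding matrix_mult_22 abcd [symmetric] abcd' [symmetric] by (subst e[of c']) (simp add: \<delta>_def algebra_simps)
    show "(\<delta> ** \<gamma>) $ 2 $ 2 = \<gamma>' $ 2 $ 2"
      unfolding matrix_mult_22 abcd [symmetric] abcd' [symmetric] by (subst e[of d']) (simp add: \<delta>_def algebra_simps)
  qed
  have "slash (int k) \<gamma>' f z = slash (int k) \<gamma> (slash (int k) \<delta> f) z"
    unfolding m [symmetric] by (rule slash_mult[OF Gamma0_SL2Z[OF \<delta>] g(1) z])
  also have "\<dots> = slash (int k) \<gamma> f z"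
    using f \<delta> Im_moebius_action_pos[OF g(1) z] by (simp add: slash_eq[of _ \<gamma>] moderate_forms_def)
  finally show ?thesis .
qed

lemma slash_translation:
  "slash k (mat22 1 n 0 1) f z = f (z + of_int n)"
  by (simp add: slash_def)

lemma moderate_forms_slash_periodic:
  assumes f: "f \<in> moderate_forms k N" and g: "\<gamma> \<in> SL2Z" and z: "Im z > 0"
  shows "slash (int k) \<gamma> f (z + of_nat N) = slash (int k) \<gamma> f z"
proof -
  have t: "mat22 1 (int N) 0 1 \<in> SL2Z" by (simp add: SL2Z_iff)
  have "slash (int k) \<gamma> f (z + of_nat N) = slash (int k) (\<gamma> ** mat22 1 (int N) 0 1) f z"
    unfolding slash_mult[OF g t z] slash_translation by simp
  also have "\<dots> = slash (int k) \<gamma> f z"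
    by (rule moderate_forms_slash_coset[OF f g SL2Z_mult[OF g t] _ z])
       (simp add: matrix_mult_22 algebra_simps)
  finally show ?thesis .
qed

text \<open>
  For \<open>Im z \<ge> 1\<close> the automorphy factor lies between 1 and a multiple of \<open>Im z\<close>, as long as \<open>Re z\<close> stays in
  one period. A power of \<open>1 + 1 / Im (\<gamma> z)\<close> is therefore at most a power of \<open>Im z\<close>, and the growth lemma
  for periodic functions applies.
\<close>
lemma moderate_forms_slash_bounded:
  assumes f: "f \<in> moderate_forms k N" and N: "N > 0" and g: "\<gamma> \<in> SL2Z"
  shows "\<exists>B. \<forall>z. Im z \<ge> 1 \<longrightarrow> norm (slash (int k) \<gamma> f z) \<le> B"
proof -
  obtain C n where C: "C \<ge> 0" "\<And>z. Im z > 0 \<Longrightarrow> norm (f z) \<le> C * (1 + 1 / Im z) ^ n"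
    using f by (auto simp: moderate_forms_def elim!: moderate_growthE)
  define E where "E = \<bar>real_of_int (\<gamma> $ 2 $ 1)\<bar> * (real N + 1) + \<bar>real_of_int (\<gamma> $ 2 $ 2)\<bar>"
  have bound: "norm (slash (int k) \<gamma> f z) \<le> (C * (1 + E^2) ^ n) * Im z ^ (2 * n)"
    if z: "Im z \<ge> 1" "0 \<le> Re z" "Re z \<le> real N" for z
  proof -
    define j where "j = autom_factor \<gamma> z"
    define y where "y = Im z"
    have y: "y \<ge> 1" using z by (simp add: y_def)
    have j1: "norm j \<ge> 1"
    proof (cases "\<gamma> $ 2 $ 1 = 0")
      case True
      hence "\<gamma> $ 2 $ 2 \<noteq> 0" using g by (auto simp: SL2Z_iff)
      hence "\<bar>real_of_int (\<gamma> $ 2 $ 2)\<bar> \<ge> 1" by linarith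
      thus ?thesis by (simp add: j_def autom_factor_def True)
    next
      case False
      hence "1 \<le> \<bar>real_of_int (\<gamma> $ 2 $ 1)\<bar>" by linarith
      hence "1 * 1 \<le> \<bar>real_of_int (\<gamma> $ 2 $ 1)\<bar> * y" using y by (intro mult_mono) auto
      also have "\<dots> = \<bar>Im j\<bar>" using y by (simp add: j_def autom_factor_def y_def abs_mult)
      also have "\<dots> \<le> norm j" by (rule abs_Im_le_cmod)
      finally show ?thesis by simp
    qed
    have j2: "norm j \<le> E * y"
    proof -
      have "norm j \<le> \<bar>real_of_int (\<gamma> $ 2 $ 1)\<bar> * norm z + \<bar>real_of_int (\<gamma> $ 2 $ 2)\<bar> * 1"
        unfolding j_def autom_factor_def by (rule order.trans[OF norm_triangle_ineq]) (simp add: norm_mult)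
      also have "\<dots> \<le> \<bar>real_of_int (\<gamma> $ 2 $ 1)\<bar> * ((real N + 1) * y) + \<bar>real_of_int (\<gamma> $ 2 $ 2)\<bar> * y"
      proof (intro add_mono mult_left_mono)
        have "norm z \<le> \<bar>Re z\<bar> + \<bar>Im z\<bar>" by (rule cmod_le)
        also have "\<dots> \<le> real N * y + y" using z mult_left_mono[OF y, of "real N"] by (simp add: y_def)
        finally show "norm z \<le> (real N + 1) * y" by (simp add: algebra_simps)
      qed (use y in auto)
      finally show ?thesis by (simp add: E_def algebra_simps)
    qed
    have "norm (j powi (- int k)) \<le> 1"
      using j1 one_le_power[OF j1, of k] by (simp add: power_int_minus norm_inverse norm_power inverse_le_1_iff)
    moreover have "norm (f (moebius_action \<gamma> z)) \<le> C * (1 + (norm j)^2 / y) ^ n"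
      using C(2)[OF Im_moebius_action_pos[OF g, of z]] z by (simp add: Im_moebius_action[OF g] j_def y_def)
    ultimately have "norm (slash (int k) \<gamma> f z) \<le> 1 * (C * (1 + (norm j)^2 / y) ^ n)"
      unfolding slash_eq norm_mult j_def [symmetric] using C(1) y by (intro mult_mono) auto
    also have "\<dots> \<le> C * ((1 + E^2) * y^2) ^ n"
    proof -
      have "(norm j)^2 \<le> (E * y)^2" using j2 by (intro power_mono) auto
      hence "(norm j)^2 / y \<le> E^2 * y" using y by (simp add: field_simps power2_eq_square)
      also have "\<dots> \<le> E^2 * y^2" using y by (intro mult_left_mono) (auto simp: power2_eq_square)
      finally have "1 + (norm j)^2 / y \<le> (1 + E^2) * y^2"
        using one_le_power[OF y, of 2] by (simp add: distrib_right)
      thus ?thesis using C(1) y by (simp add: mult_left_mono power_mono)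
    qed
    also have "\<dots> = (C * (1 + E^2) ^ n) * Im z ^ (2 * n)"
      by (simp add: power_mult_distrib y_def power_mult)
    finally show ?thesis .
  qed
  show ?thesis
    by (rule periodic_polynomial_growth_bounded[OF slash_holomorphic[OF g], where p = "real N"])
       (use f N bound moderate_forms_slash_periodic[OF f g] in \<open>auto simp: moderate_forms_def\<close>)
qed

theorem moderate_forms_modular:
  assumes "f \<in> moderate_forms k N" "N > 0"
  shows "f \<in> modular_forms (int k) N"
proof -
  have "bounded_at_ii_inf (slash (int k) \<gamma> f)" if "\<gamma> \<in> SL2Z" for \<gamma>
    using moderate_forms_slash_bounded[OF assms that] unfolding bounded_at_ii_inf_def
    by (metis less_imp_le)
  thus ?thesis using assms by (auto simp: modular_forms_def moderate_forms_def)
qed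


section \<open>The order of vanishing of a form\<close>

lemma fsigma_upper_half_plane: "fsigma upper_half_plane"
proof -
  define C :: "nat \<Rightarrow> complex set" where "C = (\<lambda>n. {z. Im z \<ge> inverse (real (Suc n))})"
  have "upper_half_plane = \<Union> (C ` UNIV)"
  proof (intro equalityI subsetI)
    fix z assume "z \<in> upper_half_plane"
    then obtain n where "inverse (real (Suc n)) < Im z" using reals_Archimedean by auto
    thus "z \<in> \<Union> (C ` UNIV)" by (auto simp: C_def intro!: exI[of _ n])
  next
    fix z assume "z \<in> \<Union> (C ` UNIV)"
    then obtain n where n: "inverse (real (Suc n)) \<le> Im z" by (auto simp: C_def)
    have "0 < inverse (real (Suc n))" by simp
    hence "Im z > 0" using n by linarith
    thus "z \<in> upper_half_plane" by simp
  qed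
  moreover have "closed (C n)" for n unfolding C_def by (rule closed_halfspace_Im_ge)
  hence "fsigma (\<Union> (C ` UNIV))" by (rule fsigma.intros)
  ultimately show ?thesis by simp
qed

text \<open>
  A holomorphic function that is not identically zero has countably many zeros, so finitely many of
  them cannot cover a disc.
\<close>
lemma holomorphic_prod_eq_0:
  assumes R: "finite R" "\<And>g. g \<in> R \<Longrightarrow> g holomorphic_on upper_half_plane"
    and zero: "\<And>z. Im z > 0 \<Longrightarrow> (\<Prod>g\<in>R. g z) = 0"
  obtains g where "g \<in> R" "\<And>z. Im z > 0 \<Longrightarrow> g z = 0"
proof (rule ccontr)
  note found = that
  assume neg: "\<not> thesis"
  have "countable {z \<in> upper_half_plane. g z = 0}" if g: "g \<in> R" for g
  proof (cases "g constant_on upper_half_plane")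
    case True
    then obtain c where c: "\<And>z. Im z > 0 \<Longrightarrow> g z = c" by (auto simp: constant_on_def)
    have "c \<noteq> 0" using neg found g c by metis
    hence "{z \<in> upper_half_plane. g z = 0} = {}" using c by auto
    thus ?thesis by (simp only: countable_empty)
  next
    case False
    show ?thesis
      by (rule holomorphic_countable_zeros[OF R(2)[OF g] open_upper_half_plane connected_upper_half_plane
            fsigma_upper_half_plane False])
  qed
  hence "countable (\<Union>g\<in>R. {z \<in> upper_half_plane. g z = 0})"
    by (intro countable_UN[OF countable_finite[OF R(1)]]) auto
  moreover have "ball \<i> 1 \<subseteq> (\<Union>g\<in>R. {z \<in> upper_half_plane. g z = 0})"
  proof
    fix z assume "z \<in> ball \<i> 1"
    hence "norm (\<i> - z) < 1" by (simp add: dist_norm)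
    hence "\<bar>Im (\<i> - z)\<bar> < 1" using abs_Im_le_cmod[of "\<i> - z"] by linarith
    hence "Im z > 0" by simp
    with zero[OF this] R(1) show "z \<in> (\<Union>g\<in>R. {z \<in> upper_half_plane. g z = 0})"
      by (auto simp: prod_zero_iff)
  qed
  ultimately have "countable (ball \<i> 1)" by (rule countable_subset[rotated])
  thus False using uncountable_ball[of 1 \<i>] by simp
qed

definition modular_discriminant :: "complex \<Rightarrow> complex" where
  "modular_discriminant z = dedekind_eta z ^ 24"

lemma modular_discriminant_nonzero: "Im z > 0 \<Longrightarrow> modular_discriminant z \<noteq> 0"
  by (simp add: modular_discriminant_def dedekind_eta_nonzero)

lemma modular_discriminant_T: "modular_discriminant (z + 1) = modular_discriminant z"
proof -
  have "zeta12 1 ^ 12 = zeta12 12" by (simp add: zeta12_def exp_of_nat_mult [symmetric])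
  also have "zeta12 12 = zeta12 0" by (rule zeta12_cong) (simp add: cong_def)
  finally have "zeta12 1 ^ 12 = 1" by simp
  hence "(dedekind_eta (z + 1) ^ 2) ^ 12 = (dedekind_eta z ^ 2) ^ 12"
    using dedekind_eta_sq_plus_of_int[of z 1] by (simp add: power_mult_distrib)
  thus ?thesis by (simp add: modular_discriminant_def flip: power_mult)
qed

lemma modular_discriminant_S:
  assumes "Im z > 0"
  shows "modular_discriminant (- 1 / z) = z ^ 12 * modular_discriminant z"
proof -
  have "(- \<i>) ^ 12 = (1 :: complex)" by (simp add: power_minus' eval_nat_numeral)
  hence "(dedekind_eta (- 1 / z) ^ 2) ^ 12 = z ^ 12 * (dedekind_eta z ^ 2) ^ 12"
    unfolding dedekind_eta_sq_inversion[OF assms] by (simp add: power_mult_distrib)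
  thus ?thesis by (simp add: modular_discriminant_def flip: power_mult)
qed

lemma dedekind_eta_holomorphic: "dedekind_eta holomorphic_on upper_half_plane"
  by (rule holomorphic_onI) (use dedekind_eta_deriv in \<open>auto simp: field_differentiable_def intro: has_field_derivative_at_within\<close>)

text \<open>
  The quotient of the discriminant and the nome is \<open>\<Prod>(1 - q\<^sup>n)\<^sup>2\<^sup>4\<close>, which tends to 1.
\<close>
lemma modular_discriminant_lower_bound:
  obtains c Y where "c > 0" "\<And>z. Im z > Y \<Longrightarrow> norm (modular_discriminant z) \<ge> c * norm (nome z)"
proof -
  have "continuous_on (cball 0 (1/2)) euler_prod" by (rule euler_prod_continuous) simp
  hence "isCont euler_prod 0" by (rule continuous_on_interior) simp
  moreover have "euler_prod 0 \<noteq> 0" by (rule euler_prod_nonzero) simp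
  ultimately have "((\<lambda>q. norm (euler_prod q) ^ 24) \<longlongrightarrow> norm (euler_prod 0) ^ 24) (at 0)"
    by (intro tendsto_intros) (simp add: isCont_def)
  moreover define c where "c = norm (euler_prod 0) ^ 24 / 2"
  moreover have c: "c > 0" using \<open>euler_prod 0 \<noteq> 0\<close> by (simp add: c_def)
  ultimately have "eventually (\<lambda>q. norm (euler_prod q) ^ 24 > c) (at 0)"
    by (intro order_tendstoD(1)) (auto simp: c_def)
  then obtain d where d: "d > 0" "\<And>q. q \<noteq> 0 \<Longrightarrow> norm q < d \<Longrightarrow> norm (euler_prod q) ^ 24 > c"
    by (auto simp: eventually_at dist_norm)
  have "((\<lambda>y. exp (- 2 * pi * y)) \<longlongrightarrow> 0) at_top" by real_asymp
  hence "eventually (\<lambda>y. exp (- 2 * pi * y) < d) at_top" by (rule order_tendstoD) (use d in auto)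
  then obtain Y where Y: "\<And>y. y \<ge> Y \<Longrightarrow> exp (- 2 * pi * y) < d"
    by (auto simp: eventually_at_top_linorder)
  have "norm (modular_discriminant z) \<ge> c * norm (nome z)" if "Im z > Y" for z
  proof -
    have "norm (nome z) < d" using Y[of "Im z"] that by (simp add: norm_nome)
    moreover have "nome z \<noteq> 0" by (simp add: nome_def)
    ultimately have 1: "norm (euler_prod (nome z)) ^ 24 \<ge> c" using d(2) by force
    have "exp (of_real pi * \<i> * z / 12) ^ 24 = nome z"
      by (simp add: nome_def exp_of_nat_mult [symmetric] mult_ac)
    hence "modular_discriminant z = nome z * euler_prod (nome z) ^ 24"
      by (simp add: modular_discriminant_def dedekind_eta_conv_euler_prod power_mult_distrib)
    thus ?thesis using mult_left_mono[OF 1, of "norm (nome z)"] by (simp add: norm_mult norm_power mult.commute)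
  qed
  with c that show ?thesis by blast
qed

text \<open>
  The label \<open>\<phi>\<close> has to separate the cosets of \<open>\<Gamma>\<^sub>0(N)\<close>, so that \<open>card X\<close> bounds the index. Let \<open>R\<close> be the
  set of all functions \<open>f\<close> slashed by a matrix in \<open>SL\<^sub>2(\<int>)\<close>. The generators of \<open>SL\<^sub>2(\<int>)\<close> permute \<open>R\<close>, hence the product
  \<open>G\<close> over \<open>R\<close> is a form of weight \<open>k r\<close> for the full modular group, where \<open>r\<close> is the size of \<open>R\<close>. One
  factor vanishes to order \<open>m\<close> at infinity and the others are bounded there, so \<open>G\<^sup>1\<^sup>2\<close> vanishes to order \<open>12 m\<close>, which exceeds
  the order \<open>k r\<close> of the corresponding power of the discriminant. The quotient is invariant and vanishes at
  infinity, so it is zero.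
\<close>
theorem moderate_forms_valence_bound:
  fixes \<phi> :: "int \<Rightarrow> int \<Rightarrow> 'c"
  assumes f: "f \<in> moderate_forms k N" and N: "N > 0"
    and X: "finite X" "\<And>\<gamma>. \<gamma> \<in> SL2Z \<Longrightarrow> \<phi> (\<gamma> $ 2 $ 1) (\<gamma> $ 2 $ 2) \<in> X"
    and \<phi>: "\<And>\<gamma> \<gamma>'. \<gamma> \<in> SL2Z \<Longrightarrow> \<gamma>' \<in> SL2Z \<Longrightarrow>
        \<phi> (\<gamma> $ 2 $ 1) (\<gamma> $ 2 $ 2) = \<phi> (\<gamma>' $ 2 $ 1) (\<gamma>' $ 2 $ 2) \<Longrightarrow>
        int N dvd \<gamma>' $ 2 $ 1 * \<gamma> $ 2 $ 2 - \<gamma>' $ 2 $ 2 * \<gamma> $ 2 $ 1"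
    and van: "\<And>z. Im z > Y \<Longrightarrow> norm (f z) \<le> C * norm (nome z) ^ m"
    and m: "k * card X < 12 * m" and z: "Im z > 0"
  shows "f z = 0"
proof -
  define F where "F = (\<lambda>\<gamma> z. if Im z > 0 then slash (int k) \<gamma> f z else 0)"
  define R where "R = F ` SL2Z"
  define r where "r = card R"
  have F_eq: "F \<gamma> = F \<gamma>'"
    if "\<gamma> \<in> SL2Z" "\<gamma>' \<in> SL2Z" "\<phi> (\<gamma> $ 2 $ 1) (\<gamma> $ 2 $ 2) = \<phi> (\<gamma>' $ 2 $ 1) (\<gamma>' $ 2 $ 2)" for \<gamma> \<gamma>'
    using moderate_forms_slash_coset[OF f that(1,2) \<phi>[OF that]] by (auto simp: F_def fun_eq_iff)
  have R_sub: "R \<subseteq> (\<lambda>x. F (SOME \<gamma>. \<gamma> \<in> SL2Z \<and> \<phi> (\<gamma> $ 2 $ 1) (\<gamma> $ 2 $ 2) = x)) ` X"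
  proof
    fix g assume "g \<in> R"
    then obtain \<gamma> where \<gamma>: "\<gamma> \<in> SL2Z" "g = F \<gamma>" by (auto simp: R_def)
    define x where "x = \<phi> (\<gamma> $ 2 $ 1) (\<gamma> $ 2 $ 2)"
    define \<gamma>' where "\<gamma>' = (SOME \<gamma>. \<gamma> \<in> SL2Z \<and> \<phi> (\<gamma> $ 2 $ 1) (\<gamma> $ 2 $ 2) = x)"
    have "\<gamma>' \<in> SL2Z \<and> \<phi> (\<gamma>' $ 2 $ 1) (\<gamma>' $ 2 $ 2) = x"
      unfolding \<gamma>'_def by (rule someI[of _ \<gamma>]) (simp add: \<gamma> x_def)
    hence "g = F \<gamma>'" using F_eq[of \<gamma> \<gamma>'] \<gamma> by (simp add: x_def)
    moreover have "x \<in> X" unfolding x_def by (rule X(2)[OF \<gamma>(1)])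
    ultimately show "g \<in> (\<lambda>x. F (SOME \<gamma>. \<gamma> \<in> SL2Z \<and> \<phi> (\<gamma> $ 2 $ 1) (\<gamma> $ 2 $ 2) = x)) ` X"
      unfolding \<gamma>'_def by blast
  qed
  have finR: "finite R" using finite_subset[OF R_sub] X(1) by simp
  have rX: "r \<le> card X" unfolding r_def using surj_card_le[OF X(1) R_sub] .

  define I :: "int ^ 2 ^ 2" where "I = mat22 1 0 0 1"
  have I: "I \<in> SL2Z" by (simp add: SL2Z_iff I_def)
  have FI: "F I z = f z" if "Im z > 0" for z
    using that slash_translation[of "int k" 0 f z] by (simp add: F_def I_def)
  have FIR: "F I \<in> R" using I by (simp add: R_def)

  have holR: "g holomorphic_on upper_half_plane" if g: "g \<in> R" for g
  proof -
    obtain \<gamma> where \<gamma>: "\<gamma> \<in> SL2Z" "g = F \<gamma>" using g by (auto simp: R_def)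
    show ?thesis unfolding \<gamma>(2)
      by (rule holomorphic_transform[OF slash_holomorphic[OF \<gamma>(1), of f "int k"]])
         (use f in \<open>auto simp: F_def moderate_forms_def\<close>)
  qed

  define G where "G = (\<lambda>z. \<Prod>g\<in>R. g z)"
  have G_T: "G (z + 1) = G z" if z: "Im z > 0" for z
  proof -
    (* Slashing by a generator is injective on the finite set R and maps it into itself, so it permutes R. *)
    define A where "A = (\<lambda>(g :: complex \<Rightarrow> complex) z. if Im z > 0 then g (z + 1) else 0)"
    have inj: "inj_on A R"
    proof (rule inj_onI, rule ext)
      fix g h z assume gh: "g \<in> R" "h \<in> R" "A g = A h"
      show "g z = h z"
      proof (cases "Im z > 0")
        case True
        thus ?thesis using fun_cong[OF gh(3), of "z - 1"] by (simp add: A_def)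
      qed (use gh in \<open>auto simp: R_def F_def\<close>)
    qed
    have "A (F \<gamma>) = F (\<gamma> ** mat22 1 1 0 1)" if g: "\<gamma> \<in> SL2Z" for \<gamma>
      using slash_mult[OF g, of "mat22 1 1 0 1" _ "int k" f]
      by (auto simp: A_def F_def fun_eq_iff slash_translation SL2Z_iff)
    moreover have "\<gamma> ** mat22 1 1 0 1 \<in> SL2Z" if g: "\<gamma> \<in> SL2Z" for \<gamma>
      by (rule SL2Z_mult[OF g]) (simp add: SL2Z_iff)
    ultimately have "A ` R \<subseteq> R" by (auto simp: R_def)
    hence "bij_betw A R R" using inj endo_inj_surj[OF finR] by (auto simp: bij_betw_def)
    from prod.reindex_bij_betw[OF this, of "\<lambda>g. g z"]
    have "G z = (\<Prod>g\<in>R. A g z)" by (simp add: G_def)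
    thus ?thesis using z by (simp add: A_def G_def)
  qed
  have G_S: "G (- 1 / z) = z ^ (k * r) * G z" if z: "Im z > 0" for z
  proof -
    define A where "A = (\<lambda>(g :: complex \<Rightarrow> complex) z. if Im z > 0 then z powi (- int k) * g (- 1 / z) else 0)"
    have inj: "inj_on A R"
    proof (rule inj_onI, rule ext)
      fix g h z assume gh: "g \<in> R" "h \<in> R" "A g = A h"
      show "g z = h z"
      proof (cases "Im z > 0")
        case True
        hence z0: "z \<noteq> 0" by auto
        show ?thesis using fun_cong[OF gh(3), of "- 1 / z"] Im_minus_inverse_pos[OF True] z0
          by (simp add: A_def)
      qed (use gh in \<open>auto simp: R_def F_def\<close>)
    qed
    have "A (F \<gamma>) = F (\<gamma> ** mat22 0 (-1) 1 0)" if g: "\<gamma> \<in> SL2Z" for \<gamma>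
    proof
      fix w
      show "A (F \<gamma>) w = F (\<gamma> ** mat22 0 (-1) 1 0) w"
      proof (cases "Im w > 0")
        case True
        have "slash (int k) (\<gamma> ** mat22 0 (-1) 1 0) f w = slash (int k) (mat22 0 (-1) 1 0) (slash (int k) \<gamma> f) w"
          by (rule slash_mult[OF g _ True]) (simp add: SL2Z_iff)
        thus ?thesis using True Im_minus_inverse_pos[OF True]
          by (simp add: A_def F_def slash_def[of _ "mat22 0 (-1) 1 0"])
      qed (simp add: A_def F_def)
    qed
    moreover have "\<gamma> ** mat22 0 (-1) 1 0 \<in> SL2Z" if g: "\<gamma> \<in> SL2Z" for \<gamma>
      by (rule SL2Z_mult[OF g]) (simp add: SL2Z_iff)
    ultimately have "A ` R \<subseteq> R" by (auto simp: R_def)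
    hence "bij_betw A R R" using inj endo_inj_surj[OF finR] by (auto simp: bij_betw_def)
    from prod.reindex_bij_betw[OF this, of "\<lambda>g. g z"]
    have "G z = (\<Prod>g\<in>R. A g z)" by (simp add: G_def)
    also have "\<dots> = (\<Prod>g\<in>R. inverse (z ^ k) * g (- 1 / z))"
      using z by (simp add: A_def power_int_minus)
    also have "\<dots> = inverse (z ^ k) ^ r * G (- 1 / z)"
      by (simp add: prod.distrib G_def r_def)
    finally show ?thesis using z by (auto simp: power_mult power_inverse field_simps)
  qed

  define h where "h = (\<lambda>z. G z ^ 12 / modular_discriminant z ^ (k * r))"
  have "h z = 0" if z: "Im z > 0" for z
  proof (rule invariant_vanishing_at_infinity_eq_0[OF _ _ _ _ z])
    show "h holomorphic_on upper_half_plane"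
      unfolding h_def G_def modular_discriminant_def
      by (intro holomorphic_intros holR dedekind_eta_holomorphic) (auto simp: dedekind_eta_nonzero)
    show "h (z + 1) = h z" if "Im z > 0" for z
      using that by (simp add: h_def G_T modular_discriminant_T)
    show "h (- 1 / z) = h z" if "Im z > 0" for z
    proof -
      have "z \<noteq> 0" using that by auto
      moreover have "(z ^ (k * r)) ^ 12 = (z ^ 12) ^ (k * r)" by (simp add: mult.commute flip: power_mult)
      ultimately show ?thesis
        unfolding h_def G_S[OF that] modular_discriminant_S[OF that] power_mult_distrib by simp
    qed
    show "\<exists>Y. \<forall>z. Im z > Y \<longrightarrow> norm (h z) < e" if e: "e > 0" for e
    proof -
      obtain c Y1 where c: "c > 0" "\<And>z. Im z > Y1 \<Longrightarrow> norm (modular_discriminant z) \<ge> c * norm (nome z)"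
        using modular_discriminant_lower_bound by blast
      have "\<exists>B. \<forall>z. Im z \<ge> 1 \<longrightarrow> norm (g z) \<le> B" if g: "g \<in> R" for g
      proof -
        obtain \<gamma> where \<gamma>: "\<gamma> \<in> SL2Z" "g = F \<gamma>" using g by (auto simp: R_def)
        show ?thesis using moderate_forms_slash_bounded[OF f N \<gamma>(1)] unfolding \<gamma>(2) F_def by auto
      qed
      then obtain B where B: "\<And>g z. g \<in> R \<Longrightarrow> Im z \<ge> 1 \<Longrightarrow> norm (g z) \<le> B g" by metis
      define D where "D = (\<Prod>g\<in>R - {F I}. B g)"
      have Gb: "norm (G z) \<le> C * D * norm (nome z) ^ m" if z: "Im z > max 1 Y" for z
      proof -
        have "G z = F I z * (\<Prod>g\<in>R - {F I}. g z)"
          unfolding G_def by (rule prod.remove[OF finR FIR])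
        hence "norm (G z) = norm (f z) * (\<Prod>g\<in>R - {F I}. norm (g z))"
          using z FI[of z] by (simp add: norm_mult prod_norm)
        also have "\<dots> \<le> (C * norm (nome z) ^ m) * D"
        proof (rule mult_mono)
          show "norm (f z) \<le> C * norm (nome z) ^ m" using van z by simp
          thus "0 \<le> C * norm (nome z) ^ m" using norm_ge_zero order.trans by blast
          show "(\<Prod>g\<in>R - {F I}. norm (g z)) \<le> D"
            unfolding D_def by (rule prod_mono) (use B[of _ z] z in auto)
          show "0 \<le> (\<Prod>g\<in>R - {F I}. norm (g z))" by (rule prod_nonneg) simp
        qed
        finally show ?thesis by (simp add: mult_ac)
      qed
      define E where "E = (C * D) ^ 12 / c ^ (k * r)"
      have hb: "norm (h z) \<le> E * norm (nome z)" if z: "Im z > max (max 1 Y) Y1" for z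
      proof -
        define x where "x = norm (nome z)"
        have x: "x > 0" "x < 1" using norm_nome_less_1[of z] z by (auto simp: x_def nome_def)
        have kr: "k * r < 12 * m" using m mult_le_mono2[OF rX, of k] by linarith
        have CD: "0 \<le> (C * D) * x ^ m" using order.trans[OF norm_ge_zero Gb[of z]] z by (simp add: x_def)
        hence CD0: "C * D \<ge> 0" using x mult_neg_pos[of "C * D" "x ^ m"] by (meson not_le zero_less_power)
        have "norm (h z) = norm (G z) ^ 12 / norm (modular_discriminant z) ^ (k * r)"
          by (simp add: h_def norm_divide norm_power)
        also have "\<dots> \<le> (C * D * x ^ m) ^ 12 / (c * x) ^ (k * r)"
          using Gb[of z] c(2)[of z] z x c(1) CD
          by (intro frac_le power_mono) (auto simp: x_def)
        also have "\<dots> = E * (x ^ (12 * m) / x ^ (k * r))"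
          by (simp add: E_def power_mult_distrib mult.commute flip: power_mult)
        also have "x ^ (12 * m) / x ^ (k * r) = x ^ (12 * m - k * r)"
          using kr x by (simp add: power_diff)
        also have "E * \<dots> \<le> E * x ^ 1"
        proof (intro mult_left_mono power_decreasing)
          show "0 \<le> E" using CD0 c(1) by (simp add: E_def)
        qed (use kr x in auto)
        finally show ?thesis by (simp add: x_def)
      qed
      have "((\<lambda>y. E * exp (- 2 * pi * y)) \<longlongrightarrow> E * 0) at_top"
        by (intro tendsto_mult tendsto_const) real_asymp
      hence "eventually (\<lambda>y. E * exp (- 2 * pi * y) < e) at_top"
        by (rule order_tendstoD) (use e in auto)
      then obtain Y2 where Y2: "\<And>y. y \<ge> Y2 \<Longrightarrow> E * exp (- 2 * pi * y) < e"
        by (auto simp: eventually_at_top_linorder)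
      have "norm (h z) < e" if "Im z > max (max (max 1 Y) Y1) Y2" for z
        using hb[of z] Y2[of "Im z"] that by (simp add: norm_nome)
      thus ?thesis by blast
    qed
  qed
  hence "G z = 0" if "Im z > 0" for z
    using that modular_discriminant_nonzero[OF that] by (auto simp: h_def)
  then obtain g where g: "g \<in> R" "\<And>z. Im z > 0 \<Longrightarrow> g z = 0"
    using holomorphic_prod_eq_0[OF finR holR] unfolding G_def by blast
  then obtain \<gamma> where \<gamma>: "\<gamma> \<in> SL2Z" "g = F \<gamma>" by (auto simp: R_def)
  (* Slashing by the inverse matrix recovers f. *)
  define \<gamma>' where "\<gamma>' = mat22 (\<gamma> $ 2 $ 2) (- \<gamma> $ 1 $ 2) (- \<gamma> $ 2 $ 1) (\<gamma> $ 1 $ 1)"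
  have \<gamma>': "\<gamma>' \<in> SL2Z" using \<gamma>(1) by (simp add: SL2Z_iff \<gamma>'_def mult.commute)
  have "\<gamma> ** \<gamma>' = I"
    by (rule mat22_eqI) (use \<gamma>(1) in \<open>simp_all add: matrix_mult_22 \<gamma>'_def I_def SL2Z_iff algebra_simps\<close>)
  hence "f z = slash (int k) \<gamma>' (slash (int k) \<gamma> f) z"
    using slash_mult[OF \<gamma>(1) \<gamma>' z, of "int k" f] FI[OF z] z by (simp add: F_def)
  also have "\<dots> = 0"
    using g(2)[OF Im_moebius_action_pos[OF \<gamma>' z]] Im_moebius_action_pos[OF \<gamma>' z]
    unfolding \<gamma>(2) by (simp add: slash_eq[of _ \<gamma>'] F_def)
  finally show ?thesis .
qed

section \<open>Transformation laws of \<open>L\<close>, \<open>\<phi>\<close> and \<open>A\<close>\<close>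

text \<open>
  Logarithmic differentiation of the law of \<open>\<eta>\<^sup>2\<close>. The additive term is the logarithmic derivative of the
  automorphy factor.
\<close>
lemma eis_L_SL2Z:
  assumes \<gamma>: "\<gamma> \<in> SL2Z" and z: "Im z > 0"
  shows "eis_L (nome (moebius_action \<gamma> z)) =
     autom_factor \<gamma> z ^ 2 * eis_L (nome z) + \<i> * of_int (\<gamma> $ 2 $ 1) * autom_factor \<gamma> z / (4 * pi)"
proof -
  define a b c d where abcd: "a = \<gamma> $ 1 $ 1" "b = \<gamma> $ 1 $ 2" "c = \<gamma> $ 2 $ 1" "d = \<gamma> $ 2 $ 2"
  have det: "a * d - b * c = 1" using \<gamma> by (simp add: SL2Z_iff abcd)
  define Z where "Z = zeta12 (eta_exponent a b c d)"
  have law: "dedekind_eta (moebius_action \<gamma> w) ^ 2 = Z * autom_factor \<gamma> w * dedekind_eta w ^ 2" if "Im w > 0" for w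
    using dedekind_eta_sq_SL2Z[OF det] that
    unfolding eta_sq_law_def by (simp add: moebius_action_def autom_factor_def abcd Z_def)
  define j E E' l l' where "j = autom_factor \<gamma> z" and "E = dedekind_eta z" and "E' = dedekind_eta (moebius_action \<gamma> z)"
    and "l = eis_L (nome z)" and "l' = eis_L (nome (moebius_action \<gamma> z))"
  note defs = this
  have j: "j \<noteq> 0" unfolding defs by (rule autom_factor_nonzero[OF \<gamma> z])
  have E: "E \<noteq> 0" unfolding defs by (rule dedekind_eta_nonzero[OF z])
  have dj: "(autom_factor \<gamma> has_field_derivative of_int c) (at z)"
    unfolding autom_factor_def [abs_def] abcd by (auto intro!: derivative_eq_intros)
  have dm: "(moebius_action \<gamma> has_field_derivative 1 / j^2) (at z)"
  proof -
    have "(moebius_action \<gamma> has_field_derivative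
        (of_int a * j - (of_int a * z + of_int b) * of_int c) / (j * j)) (at z)"
      unfolding moebius_action_def [abs_def] j_def abcd [symmetric]
      by (rule DERIV_divide) (use j dj in \<open>auto simp: j_def intro!: derivative_eq_intros\<close>)
    moreover have "of_int a * j - (of_int a * z + of_int b) * of_int c = of_int (a * d - b * c)"
      by (simp add: j_def autom_factor_def abcd algebra_simps)
    ultimately show ?thesis by (simp add: det power2_eq_square)
  qed
  have dE': "((\<lambda>w. dedekind_eta (moebius_action \<gamma> w)) has_field_derivative (- 2 * pi * \<i> * l' * E') * (1 / j^2)) (at z)"
    unfolding l'_def E'_def
    by (rule DERIV_chain2[where f = dedekind_eta and g = "moebius_action \<gamma>",
          OF dedekind_eta_deriv[OF Im_moebius_action_pos[OF \<gamma> z]] dm])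
  have "((\<lambda>w. dedekind_eta (moebius_action \<gamma> w) ^ 2) has_field_derivative 2 * E' * ((- 2 * pi * \<i> * l' * E') * (1 / j^2))) (at z)"
    by (rule DERIV_cong[OF DERIV_power[OF dE', of 2]]) (simp add: E'_def mult_ac)
  hence 1: "((\<lambda>w. Z * autom_factor \<gamma> w * dedekind_eta w ^ 2) has_field_derivative 2 * E' * ((- 2 * pi * \<i> * l' * E') * (1 / j^2))) (at z)"
    by (rule has_field_derivative_transform_within_open[OF _ open_upper_half_plane]) (use z law in auto)
  have 2: "((\<lambda>w. Z * autom_factor \<gamma> w * dedekind_eta w ^ 2) has_field_derivative
      Z * of_int c * E^2 + (2 * E * (- 2 * pi * \<i> * l * E)) * (Z * j)) (at z)"
    by (rule DERIV_cong[OF DERIV_mult[OF DERIV_cmult[OF dj] DERIV_power[OF dedekind_eta_deriv[OF z], of 2]]])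
       (simp add: defs mult_ac)
  have "2 * E' * ((- 2 * pi * \<i> * l' * E') * (1 / j^2)) = Z * of_int c * E^2 + (2 * E * (- 2 * pi * \<i> * l * E)) * (Z * j)"
    by (rule DERIV_unique[OF 1 2])
  moreover have "2 * E' * ((- 2 * pi * \<i> * l' * E') * (1 / j^2)) = - 4 * pi * \<i> * l' * E'^2 / j^2"
    by (simp add: power2_eq_square)
  moreover have "Z * of_int c * E^2 + (2 * E * (- 2 * pi * \<i> * l * E)) * (Z * j) = Z * E^2 * (of_int c - 4 * pi * \<i> * l * j)"
    by (simp add: power2_eq_square algebra_simps)
  moreover have "E'^2 = Z * j * E^2" using law[OF z] by (simp add: defs)
  ultimately have "- 4 * pi * \<i> * l' * (Z * j * E^2) / j^2 = Z * E^2 * (of_int c - 4 * pi * \<i> * l * j)"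
    by (simp only:)
  moreover have "- 4 * pi * \<i> * l' * (Z * j * E^2) / j^2 = Z * E^2 * (- 4 * pi * \<i> * l' / j)"
    using j by (simp add: power2_eq_square)
  moreover have "Z \<noteq> 0" by (simp add: Z_def zeta12_def)
  moreover note E
  ultimately have "- 4 * pi * \<i> * l' / j = of_int c - 4 * pi * \<i> * l * j"
    by (metis mult_left_cancel mult_eq_0_iff power_not_zero)
  hence "- 4 * pi * \<i> * l' = (of_int c - 4 * pi * \<i> * l * j) * j" by (simp only: nonzero_divide_eq_eq [OF j])
  moreover have "(4 * pi * \<i>) * (\<i> * of_int c * j / (4 * pi)) = - (of_int c * j)"
    by (simp add: field_simps)
  ultimately have "(4 * pi * \<i>) * l' = (4 * pi * \<i>) * (j^2 * l + \<i> * of_int c * j / (4 * pi))"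
    unfolding distrib_left by (simp add: algebra_simps power2_eq_square)
  hence "l' = j^2 * l + \<i> * of_int c * j / (4 * pi)" by simp
  thus ?thesis by (simp add: defs abcd)
qed

text \<open>
  Multiplication by \<open>n\<close> intertwines \<open>\<gamma>\<close> with its conjugate by \<open>diag(n, 1)\<close>, which is integral
  when \<open>n\<close> divides the lower left entry.
\<close>
lemma scaled_action:
  assumes \<gamma>: "\<gamma> \<in> SL2Z" and z: "Im z > 0" and n: "n > 0" "\<gamma> $ 2 $ 1 = int n * m"
  defines "\<gamma>' \<equiv> mat22 (\<gamma> $ 1 $ 1) (int n * \<gamma> $ 1 $ 2) m (\<gamma> $ 2 $ 2)"
  shows "\<gamma>' \<in> SL2Z" "autom_factor \<gamma>' (of_nat n * z) = autom_factor \<gamma> z"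
    "moebius_action \<gamma>' (of_nat n * z) = of_nat n * moebius_action \<gamma> z"
proof -
  show "\<gamma>' \<in> SL2Z" using \<gamma> n by (simp add: SL2Z_iff \<gamma>'_def mult_ac)
  show j: "autom_factor \<gamma>' (of_nat n * z) = autom_factor \<gamma> z"
    using n by (simp add: autom_factor_def \<gamma>'_def mult_ac)
  show "moebius_action \<gamma>' (of_nat n * z) = of_nat n * moebius_action \<gamma> z"
    unfolding moebius_action_def j using n by (simp add: \<gamma>'_def field_simps)
qed

lemma eta_sq_scaled:
  assumes \<gamma>: "\<gamma> \<in> SL2Z" and z: "Im z > 0" and n: "n > 0" "\<gamma> $ 2 $ 1 = int n * m"
  shows "dedekind_eta (of_nat n * moebius_action \<gamma> z) ^ 2 =
    zeta12 (eta_exponent (\<gamma> $ 1 $ 1) (int n * \<gamma> $ 1 $ 2) m (\<gamma> $ 2 $ 2)) * autom_factor \<gamma> z * dedekind_eta (of_nat n * z) ^ 2"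
proof -
  define \<gamma>' where "\<gamma>' = mat22 (\<gamma> $ 1 $ 1) (int n * \<gamma> $ 1 $ 2) m (\<gamma> $ 2 $ 2)"
  note sc = scaled_action[OF assms, folded \<gamma>'_def]
  have "\<gamma>' $ 1 $ 1 * \<gamma>' $ 2 $ 2 - \<gamma>' $ 1 $ 2 * \<gamma>' $ 2 $ 1 = 1" using sc(1) by (simp add: SL2Z_iff)
  from dedekind_eta_sq_SL2Z[OF this]
  have "dedekind_eta (moebius_action \<gamma>' (of_nat n * z)) ^ 2 =
     zeta12 (eta_exponent (\<gamma>' $ 1 $ 1) (\<gamma>' $ 1 $ 2) (\<gamma>' $ 2 $ 1) (\<gamma>' $ 2 $ 2)) * autom_factor \<gamma>' (of_nat n * z)
       * dedekind_eta (of_nat n * z) ^ 2"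
    unfolding eta_sq_law_def moebius_action_def autom_factor_def using z n(1) by simp
  thus ?thesis unfolding sc(2,3) by (simp add: \<gamma>'_def)
qed

lemma eis_L_scaled:
  assumes \<gamma>: "\<gamma> \<in> SL2Z" and z: "Im z > 0" and n: "n > 0" "\<gamma> $ 2 $ 1 = int n * m"
  shows "of_nat n * eis_L (nome (of_nat n * moebius_action \<gamma> z)) =
     autom_factor \<gamma> z ^ 2 * (of_nat n * eis_L (nome (of_nat n * z))) + \<i> * of_int (\<gamma> $ 2 $ 1) * autom_factor \<gamma> z / (4 * pi)"
proof -
  define \<gamma>' where "\<gamma>' = mat22 (\<gamma> $ 1 $ 1) (int n * \<gamma> $ 1 $ 2) m (\<gamma> $ 2 $ 2)"
  note sc = scaled_action[OF assms, folded \<gamma>'_def]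
  have "Im (of_nat n * z) > 0" using z n(1) by simp
  from eis_L_SL2Z[OF sc(1) this] have "eis_L (nome (of_nat n * moebius_action \<gamma> z)) =
     autom_factor \<gamma> z ^ 2 * eis_L (nome (of_nat n * z)) + \<i> * of_int m * autom_factor \<gamma> z / (4 * pi)"
    unfolding sc(2,3) by (simp add: \<gamma>'_def)
  thus ?thesis unfolding n(2) by (simp add: algebra_simps)
qed

lemma one_minus_norm_nome:
  assumes z: "Im z > 0"
  shows "1 / (1 - norm (nome z)) \<le> 1 + 1 / Im z"
proof -
  define t where "t = 2 * pi * Im z"
  have t: "t \<ge> Im z" "t > 0" using mult_right_mono[of 1 "2 * pi" "Im z"] pi_gt3 z by (auto simp: t_def)
  have e: "exp t \<ge> 1 + t" by (rule exp_ge_add_one_self)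
  have n: "norm (nome z) = 1 / exp t" by (simp add: norm_nome t_def exp_minus field_simps)
  have "1 / (1 - norm (nome z)) = exp t / (exp t - 1)" unfolding n using t by (simp add: field_simps)
  also have "\<dots> = 1 + 1 / (exp t - 1)" using t by (simp add: field_simps)
  also have "1 / (exp t - 1) \<le> 1 / Im z"
  proof (rule divide_left_mono)
    show "Im z \<le> exp t - 1" using e t by linarith
    with z show "0 < (exp t - 1) * Im z" by (intro mult_pos_pos) linarith+
  qed simp
  finally show ?thesis by simp
qed

text \<open>
  A geometric series dominates the theta series, and \<open>1 / (1 - \<bar>q\<bar>) \<le> 1 + 1 / Im z\<close>.
\<close>
lemma moderate_growth_theta_phi: "moderate_growth theta_phi"
proof (rule moderate_growthI[where C = 3 and n = 1])
  fix z :: complex assume z: "Im z > 0"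
  define r where "r = norm (nome z)"
  have r: "0 \<le> r" "r < 1" using norm_nome_less_1[OF z] by (auto simp: r_def)
  have s: "summable (\<lambda>n. r ^ n)" using r by (intro summable_geometric) simp
  have "norm (\<Sum>n. nome z ^ (Suc n)\<^sup>2) \<le> (\<Sum>n. r ^ n)"
    by (rule norm_suminf_le[OF _ s]) (use theta_term_bound[OF norm_nome_less_1[OF z]] in \<open>simp add: r_def\<close>)
  also have "\<dots> = 1 / (1 - r)" using r by (intro suminf_geometric) simp
  also have "\<dots> \<le> 1 + 1 / Im z" unfolding r_def by (rule one_minus_norm_nome[OF z])
  finally have 1: "norm (\<Sum>n. nome z ^ (Suc n)\<^sup>2) \<le> 1 + 1 / Im z" .
  have "norm (theta_phi z) \<le> norm (1 :: complex) + norm (2 * (\<Sum>n. nome z ^ (Suc n)\<^sup>2))"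
    unfolding theta_phi_conv_series[OF z] theta_series_def by (rule norm_triangle_ineq)
  also have "\<dots> \<le> 1 + 2 * (1 + 1 / Im z)" using 1 by (simp add: norm_mult)
  also have "\<dots> \<le> 3 * (1 + 1 / Im z) ^ 1" using z by (simp add: field_simps)
  finally show "norm (theta_phi z) \<le> 3 * (1 + 1 / Im z) ^ 1" .
qed

text \<open>
  In the Lambert series for \<open>L\<close> every denominator is at least \<open>1 - \<bar>q\<bar>\<close> in modulus, so the series is at most the cube of
  \<open>1 / (1 - \<bar>q\<bar>)\<close>.
\<close>
lemma moderate_growth_eis_L: "moderate_growth (\<lambda>z. eis_L (nome z))"
proof -
  have "moderate_growth (\<lambda>z. eis_L (nome z) + 1 / 24)"
  proof (rule moderate_growthI[where C = 1 and n = 3])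
    fix z :: complex assume z: "Im z > 0"
    define q where "q = nome z"
    define r where "r = norm q"
    have q: "norm q < 1" using norm_nome_less_1[OF z] by (simp add: q_def)
    have r: "0 \<le> r" "r < 1" using q by (auto simp: r_def)
    have s: "summable (\<lambda>n. r ^ n * (1 / (1 - r))^2)" using r by (intro summable_mult2 summable_geometric) simp
    have "norm (q ^ Suc m / (1 - q ^ Suc m)^2) \<le> r ^ m * (1 / (1 - r))^2" for m
    proof -
      have "norm (q ^ Suc m) \<le> r"
        using power_decreasing[of 1 "Suc m" r] r by (simp add: norm_power norm_mult r_def)
      hence 1: "1 - r \<le> norm (1 - q ^ Suc m)"
        using norm_triangle_ineq2[of 1 "q ^ Suc m"] by simp
      have "norm (q ^ Suc m) / norm (1 - q ^ Suc m)^2 \<le> r ^ m / (1 - r)^2"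
        by (intro frac_le power_mono 1) (use r power_decreasing[of m "Suc m" r] in \<open>auto simp: norm_power norm_mult r_def\<close>)
      thus ?thesis by (simp add: norm_divide norm_power power_divide)
    qed
    hence "norm (\<Sum>m. q ^ Suc m / (1 - q ^ Suc m)^2) \<le> (\<Sum>m. r ^ m * (1 / (1 - r))^2)"
      by (rule norm_suminf_le[OF _ s])
    also have "(\<Sum>m. r ^ m * (1 / (1 - r))^2) = 1 / (1 - r) * (1 / (1 - r))^2"
      using r by (subst suminf_mult2 [symmetric]) (auto simp: suminf_geometric summable_geometric)
    also have "\<dots> = (1 / (1 - r)) ^ 3" by (simp add: eval_nat_numeral)
    also have "\<dots> \<le> (1 + 1 / Im z) ^ 3"
      using one_minus_norm_nome[OF z] r by (intro power_mono) (auto simp: r_def q_def)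
    finally show "norm (eis_L (nome z) + 1 / 24) \<le> 1 * (1 + 1 / Im z) ^ 3"
      using sums_unique[OF lambert_sums_sq[OF q]] by (simp add: q_def)
  qed
  from moderate_growth_add[OF this moderate_growth_const[of "- 1 / 24"]] show ?thesis by simp
qed

lemma eis_L_holomorphic: "(\<lambda>z. eis_L (nome z)) holomorphic_on upper_half_plane"
proof (rule holomorphic_transform)
  show "(\<lambda>z. - deriv dedekind_eta z / (2 * pi * \<i> * dedekind_eta z)) holomorphic_on upper_half_plane"
    by (intro holomorphic_intros dedekind_eta_holomorphic open_upper_half_plane) (auto simp: dedekind_eta_nonzero)
  fix z assume z: "z \<in> upper_half_plane"
  hence "deriv dedekind_eta z = - 2 * pi * \<i> * eis_L (nome z) * dedekind_eta z"
    by (intro DERIV_imp_deriv dedekind_eta_deriv) simp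
  thus "- deriv dedekind_eta z / (2 * pi * \<i> * dedekind_eta z) = eis_L (nome z)"
    using z by (simp add: dedekind_eta_nonzero)
qed

lemma holomorphic_scale:
  assumes f: "f holomorphic_on upper_half_plane" and n: "n > (0 :: nat)"
  shows "(\<lambda>z. f (of_nat n * z)) holomorphic_on upper_half_plane"
proof -
  have "(\<lambda>z. of_nat n * z) ` upper_half_plane \<subseteq> upper_half_plane" using n by auto
  from holomorphic_on_compose_gen[OF _ f this] show ?thesis by (auto simp: o_def intro!: holomorphic_intros)
qed

lemma theta_phi_holomorphic: "theta_phi holomorphic_on upper_half_plane"
proof (rule holomorphic_transform)
  show "(\<lambda>z. dedekind_eta (of_nat 2 * z) ^ 5 / (dedekind_eta z ^ 2 * dedekind_eta (of_nat 4 * z) ^ 2)) holomorphic_on upper_half_plane"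
    by (intro holomorphic_intros holomorphic_scale dedekind_eta_holomorphic) (auto simp: dedekind_eta_nonzero)
qed (use theta_phi_eta_quotient in simp)

lemma slash_eqI:
  assumes "\<gamma> \<in> SL2Z" "Im z > 0" "f (moebius_action \<gamma> z) = autom_factor \<gamma> z ^ k * f z"
  shows "slash (int k) \<gamma> f z = f z"
  using autom_factor_nonzero[OF assms(1,2)] by (simp add: slash_eq assms(3) power_int_minus)

lemma Gamma0_dvdE:
  assumes "\<gamma> \<in> Gamma0 N" "n dvd N"
  obtains m where "\<gamma> $ 2 $ 1 = int n * m"
proof -
  have "int n dvd \<gamma> $ 2 $ 1" using assms by (auto simp: Gamma0_def intro: dvd_trans)
  thus ?thesis using that by (auto elim: dvdE)
qed

text \<open>
  The non-modular term in the law of \<open>n L(n z)\<close> is the same for every \<open>n\<close>, so it cancels in the difference.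
\<close>
theorem eis_Ld_form:
  assumes N: "N > 0" and n: "n dvd N"
  shows "(\<lambda>z. eis_Ld n (nome z)) \<in> moderate_forms 2 N"
proof -
  have n0: "n > 0" using assms by (auto intro: dvd_pos_nat)
  have eq: "eis_Ld n (nome z) = eis_L (nome z) + (- of_nat n) * eis_L (nome (of_nat n * z))" for z
    by (simp add: eis_Ld_def nome_mult_nat)
  show ?thesis unfolding eq moderate_forms_def
  proof (safe intro!: holomorphic_intros eis_L_holomorphic moderate_growth_add moderate_growth_mult
       moderate_growth_const moderate_growth_eis_L)
    show "(\<lambda>z. eis_L (nome (of_nat n * z))) holomorphic_on upper_half_plane"
      by (rule holomorphic_scale[OF eis_L_holomorphic n0])
    show "moderate_growth (\<lambda>z. eis_L (nome (of_nat n * z)))"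
      by (rule moderate_growth_scale[OF moderate_growth_eis_L n0])
    fix \<gamma> z assume \<gamma>: "\<gamma> \<in> Gamma0 N" and z: "Im z > 0"
    obtain m where m: "\<gamma> $ 2 $ 1 = int n * m" using Gamma0_dvdE[OF \<gamma> n] .
    note \<gamma>' = Gamma0_SL2Z[OF \<gamma>]
    show "slash (int 2) \<gamma> (\<lambda>z. eis_L (nome z) + (- of_nat n) * eis_L (nome (of_nat n * z))) z
        = eis_L (nome z) + (- of_nat n) * eis_L (nome (of_nat n * z))"
      by (rule slash_eqI[OF \<gamma>' z])
         (use eis_L_SL2Z[OF \<gamma>' z] eis_L_scaled[OF \<gamma>' z n0 m] in \<open>simp add: algebra_simps\<close>)
  qed
qed

lemma zeta12_nonzero [simp]: "zeta12 n \<noteq> 0"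
  by (simp add: zeta12_def)

lemma zeta12_mult_nat: "zeta12 (int k * n) = zeta12 n ^ k"
  by (induction k) (simp_all add: zeta12_add algebra_simps)

lemma zeta12_diff: "zeta12 (m - n) = zeta12 m / zeta12 n"
  using zeta12_add[of "m - n" n] by (simp add: field_simps)

text \<open>
  The next three congruences are the whole arithmetic of the multipliers. They combine the exponents of
  \<open>\<eta>(n z)\<^sup>2\<close> for the conjugated matrices of \<open>scaled_action\<close>, with lower left entry \<open>4 m\<close> or \<open>24 m\<close> and
  with \<open>t\<close> as upper right entry.
\<close>
lemma eta_exponent_theta:
  assumes "a * d - 4 * (m * t) = 1"
  shows "[5 * eta_exponent a (2 * t) (2 * m) d - (2 * eta_exponent a t (4 * m) d + 2 * eta_exponent a (4 * t) m d)
     = 3 * (d - 1)] (mod 12)"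
  unfolding cong_12_iff
  by (intro conjI; rule cong_by_residues[where R = "\<lambda>a t m d. a * d - 4 * (m * t) - 1"
        and P = "\<lambda>a t m d. 5 * eta_exponent a (2 * t) (2 * m) d - (2 * eta_exponent a t (4 * m) d + 2 * eta_exponent a (4 * t) m d)"
        and Q = "\<lambda>a t m d. 3 * (d - 1)"])
     (use assms in \<open>simp_all only: int_range_3 int_range_4, auto intro!: eta_exponent_cong cong_add cong_mult cong_diff cong_pow
         simp: eta_exponent_def cong_minus_minus_iff\<close>)

lemma eta_exponent_cusp:
  assumes "a * d - 24 * (m * t) = 1"
  shows "[eta_exponent a (2 * t) (12 * m) d + eta_exponent a (4 * t) (6 * m) d +
     eta_exponent a (6 * t) (4 * m) d + eta_exponent a (12 * t) (2 * m) d = 0] (mod 12)"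
  unfolding cong_12_iff
  by (intro conjI; rule cong_by_residues[where R = "\<lambda>a t m d. a * d - 24 * (m * t) - 1"
        and P = "\<lambda>a t m d. eta_exponent a (2 * t) (12 * m) d + eta_exponent a (4 * t) (6 * m) d +
     eta_exponent a (6 * t) (4 * m) d + eta_exponent a (12 * t) (2 * m) d"
        and Q = "\<lambda>a t m d. 0"])
     (use assms in \<open>simp_all only: int_range_3 int_range_4, auto intro!: eta_exponent_cong cong_add cong_mult cong_diff cong_pow
         simp: eta_exponent_def cong_minus_minus_iff\<close>)

lemma eta_exponent_theta_1236:
  assumes "a * d - 24 * (m * t) = 1"
  shows "[eta_exponent a t (24 * m) d + eta_exponent a (3 * t) (8 * m) d +
     eta_exponent a (8 * t) (3 * m) d + eta_exponent a (24 * t) m d = 0] (mod 12)"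
  unfolding cong_12_iff
  by (intro conjI; rule cong_by_residues[where R = "\<lambda>a t m d. a * d - 24 * (m * t) - 1"
        and P = "\<lambda>a t m d. eta_exponent a t (24 * m) d + eta_exponent a (3 * t) (8 * m) d +
     eta_exponent a (8 * t) (3 * m) d + eta_exponent a (24 * t) m d"
        and Q = "\<lambda>a t m d. 0"])
     (use assms in \<open>simp_all only: int_range_3 int_range_4, auto intro!: eta_exponent_cong cong_add cong_mult cong_diff cong_pow
         simp: eta_exponent_def cong_minus_minus_iff\<close>)

text \<open>
  The fractional powers in the law of \<open>\<eta>\<close> disappear in the square of the eta quotient, which is a
  product of powers of \<open>\<eta>\<^sup>2\<close>.
\<close>
theorem theta_phi_sq_transform:
  assumes \<gamma>: "\<gamma> \<in> SL2Z" and z: "Im z > 0" and n: "n > 0" "\<gamma> $ 2 $ 1 = 4 * int n * m"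
  shows "theta_phi (of_nat n * moebius_action \<gamma> z) ^ 2 =
     zeta12 (3 * (\<gamma> $ 2 $ 2 - 1)) * autom_factor \<gamma> z * theta_phi (of_nat n * z) ^ 2"
proof -
  define a b d where abd: "a = \<gamma> $ 1 $ 1" "b = \<gamma> $ 1 $ 2" "d = \<gamma> $ 2 $ 2"
  define t where "t = int n * b"
  define j where "j = autom_factor \<gamma> z"
  have j: "j \<noteq> 0" unfolding j_def by (rule autom_factor_nonzero[OF \<gamma> z])
  have det: "a * d - 4 * (m * t) = 1" using \<gamma> n(2) by (simp add: SL2Z_iff abd t_def mult_ac)
  define e1 e2 e4 where "e1 = eta_exponent a t (4 * m) d" and "e2 = eta_exponent a (2 * t) (2 * m) d"
    and "e4 = eta_exponent a (4 * t) m d"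
  note e_defs = this
  have \<theta>: "theta_phi w ^ 2 = (dedekind_eta (2 * w) ^ 2) ^ 5 / ((dedekind_eta w ^ 2) ^ 2 * (dedekind_eta (4 * w) ^ 2) ^ 2)"
    if "Im w > 0" for w
    using theta_phi_eta_quotient[OF that] by (simp add: power_divide power_mult_distrib flip: power_mult)
  have w: "Im (of_nat n * moebius_action \<gamma> z) > 0" "Im (of_nat n * z) > 0"
    using n(1) z Im_moebius_action_pos[OF \<gamma> z] by simp_all
  have 1: "dedekind_eta (of_nat n * moebius_action \<gamma> z) ^ 2 = zeta12 e1 * j * dedekind_eta (of_nat n * z) ^ 2"
    using eta_sq_scaled[OF \<gamma> z n(1), of "4 * m"] n(2) by (simp add: e_defs abd t_def j_def mult_ac)
  have 2: "dedekind_eta (2 * (of_nat n * moebius_action \<gamma> z)) ^ 2 = zeta12 e2 * j * dedekind_eta (2 * (of_nat n * z)) ^ 2"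
    using eta_sq_scaled[OF \<gamma> z, of "2 * n" "2 * m"] n by (simp add: e_defs abd t_def j_def mult_ac)
  have 4: "dedekind_eta (4 * (of_nat n * moebius_action \<gamma> z)) ^ 2 = zeta12 e4 * j * dedekind_eta (4 * (of_nat n * z)) ^ 2"
    using eta_sq_scaled[OF \<gamma> z, of "4 * n" m] n by (simp add: e_defs abd t_def j_def mult_ac)
  have Z: "zeta12 e2 ^ 5 / (zeta12 e1 ^ 2 * zeta12 e4 ^ 2) = zeta12 (3 * (d - 1))"
  proof -
    have "zeta12 e2 ^ 5 / (zeta12 e1 ^ 2 * zeta12 e4 ^ 2) = zeta12 (int 5 * e2 - (int 2 * e1 + int 2 * e4))"
      by (simp only: zeta12_diff zeta12_add zeta12_mult_nat)
    also have "\<dots> = zeta12 (3 * (d - 1))"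
      using zeta12_cong[OF eta_exponent_theta[OF det]] by (simp add: e_defs)
    finally show ?thesis .
  qed
  have alg: "(A * j * X) ^ 5 / ((B * j * Y) ^ 2 * (C * j * W) ^ 2) = A ^ 5 / (B ^ 2 * C ^ 2) * j * (X ^ 5 / (Y ^ 2 * W ^ 2))"
    for A B C X Y W :: complex
  proof -
    have "(A * j * X) ^ 5 = j ^ 4 * (A ^ 5 * j * X ^ 5)"
         "(B * j * Y) ^ 2 * (C * j * W) ^ 2 = j ^ 4 * ((B ^ 2 * C ^ 2) * (Y ^ 2 * W ^ 2))"
      by (simp_all add: eval_nat_numeral mult_ac)
    thus ?thesis using j by simp
  qed
  show ?thesis
    unfolding \<theta>[OF w(1)] \<theta>[OF w(2)] 1 2 4 alg Z by (simp add: j_def abd)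
qed

text \<open>
  The character of \<open>\<phi>(x z)\<^sup>2\<close> depends only on the lower right entry \<open>d\<close>. It is \<open>1\<close> or \<open>- 1\<close>, as \<open>d\<close> is odd, and
  two such factors cancel.
\<close>
theorem theta_pair_form:
  assumes x: "x dvd 6" "y dvd 6"
  shows "(\<lambda>z. theta_phi (of_nat x * z) ^ 2 * theta_phi (of_nat y * z) ^ 2) \<in> moderate_forms 2 24"
proof -
  have xy0: "x > 0" "y > 0" using x by (auto intro!: Nat.gr0I)
  have xy24: "4 * x dvd 24" "4 * y dvd 24" using mult_dvd_mono[OF dvd_refl x(1), of 4] mult_dvd_mono[OF dvd_refl x(2), of 4] by simp_all
  have inv: "slash (int 2) \<gamma> (\<lambda>z. theta_phi (of_nat x * z) ^ 2 * theta_phi (of_nat y * z) ^ 2) z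
        = theta_phi (of_nat x * z) ^ 2 * theta_phi (of_nat y * z) ^ 2"
    if \<gamma>: "\<gamma> \<in> Gamma0 24" and z: "Im z > 0" for \<gamma> z
  proof -
    note \<gamma>' = Gamma0_SL2Z[OF \<gamma>]
    obtain m1 where m1: "\<gamma> $ 2 $ 1 = int (4 * x) * m1" using Gamma0_dvdE[OF \<gamma> xy24(1)] .
    obtain m2 where m2: "\<gamma> $ 2 $ 1 = int (4 * y) * m2" using Gamma0_dvdE[OF \<gamma> xy24(2)] .
    define d where "d = \<gamma> $ 2 $ 2"
    have "odd d"
    proof
      assume "even d"
      moreover have "even (\<gamma> $ 2 $ 1)" using m1 by simp
      ultimately have "even (\<gamma> $ 1 $ 1 * d - \<gamma> $ 1 $ 2 * \<gamma> $ 2 $ 1)" by simp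
      moreover have "\<gamma> $ 1 $ 1 * d - \<gamma> $ 1 $ 2 * \<gamma> $ 2 $ 1 = 1" using \<gamma>' by (simp add: SL2Z_iff d_def)
      ultimately show False by (simp only: odd_one)
    qed
    hence twice: "[3 * (d - 1) + 3 * (d - 1) = 0] (mod 12)"
      by (auto elim!: oddE simp: cong_def)
    define u where "u = zeta12 (3 * (d - 1))"
    hence "u * u = 1"
      using zeta12_cong[OF twice] by (simp flip: zeta12_add)
    hence Z: "u * (u * X) = X" for X by (simp flip: mult.assoc)
    have t1: "theta_phi (of_nat x * moebius_action \<gamma> z) ^ 2 = u * autom_factor \<gamma> z * theta_phi (of_nat x * z) ^ 2"
      unfolding u_def d_def by (rule theta_phi_sq_transform[OF \<gamma>' z xy0(1), of m1]) (simp add: m1)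
    have t2: "theta_phi (of_nat y * moebius_action \<gamma> z) ^ 2 = u * autom_factor \<gamma> z * theta_phi (of_nat y * z) ^ 2"
      unfolding u_def d_def by (rule theta_phi_sq_transform[OF \<gamma>' z xy0(2), of m2]) (simp add: m2)
    show ?thesis
      by (rule slash_eqI[OF \<gamma>' z]) (simp only: t1 t2 power2_eq_square [of "autom_factor \<gamma> z"] mult_ac Z)
  qed
  show ?thesis unfolding moderate_forms_def
    using inv xy0 by (auto simp: power2_eq_square intro!: holomorphic_intros holomorphic_scale theta_phi_holomorphic
        moderate_growth_mult moderate_growth_scale moderate_growth_theta_phi)
qed

lemma cusp_A_conv: "cusp_A z = dedekind_eta (of_nat 2 * z) * dedekind_eta (of_nat 4 * z) * dedekind_eta (of_nat 6 * z) * dedekind_eta (of_nat 12 * z)"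
  by (simp add: cusp_A_def)

lemma cusp_A_holomorphic: "cusp_A holomorphic_on upper_half_plane"
  unfolding cusp_A_conv [abs_def] by (intro holomorphic_intros holomorphic_scale dedekind_eta_holomorphic) auto

lemma Gamma0_24_split:
  assumes "\<gamma> \<in> Gamma0 24"
  obtains m where "\<gamma> $ 2 $ 1 = 24 * m" "\<gamma> $ 1 $ 1 * \<gamma> $ 2 $ 2 - 24 * (m * \<gamma> $ 1 $ 2) = 1"
proof -
  obtain m where "\<gamma> $ 2 $ 1 = int 24 * m" using Gamma0_dvdE[OF assms dvd_refl] .
  thus ?thesis using that Gamma0_SL2Z[OF assms] by (auto simp: SL2Z_iff mult_ac)
qed

lemma cusp_A_sq_transform:
  assumes \<gamma>: "\<gamma> \<in> Gamma0 24" and z: "Im z > 0"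
  shows "cusp_A (moebius_action \<gamma> z) ^ 2 = autom_factor \<gamma> z ^ 4 * cusp_A z ^ 2"
proof -
  obtain m where m: "\<gamma> $ 2 $ 1 = 24 * m" "\<gamma> $ 1 $ 1 * \<gamma> $ 2 $ 2 - 24 * (m * \<gamma> $ 1 $ 2) = 1"
    using Gamma0_24_split[OF \<gamma>] .
  note S = eta_sq_scaled[OF Gamma0_SL2Z[OF \<gamma>] z]
  note Z = zeta12_cong[OF eta_exponent_cusp[OF m(2)], unfolded zeta12_add zeta12_0]
  have sq: "cusp_A w ^ 2 = dedekind_eta (of_nat 2 * w) ^ 2 * dedekind_eta (of_nat 4 * w) ^ 2 * dedekind_eta (of_nat 6 * w) ^ 2 * dedekind_eta (of_nat 12 * w) ^ 2" for w
    by (simp add: cusp_A_conv power_mult_distrib)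
  have alg: "(A * j * X) * (B * j * Y) * (C * j * V) * (D * j * W) = (A * B * C * D) * (j ^ 4 * (X * Y * V * W))"
    for A B C D X Y V W j :: complex
    by (simp add: eval_nat_numeral mult_ac)
  show ?thesis
    unfolding sq
    using S[of 2 "12 * m"] S[of 4 "6 * m"] S[of 6 "4 * m"] S[of 12 "2 * m"] m(1) Z
    by (simp only: alg) (simp add: alg)
qed

lemma cusp_A_sq_form: "(\<lambda>z. cusp_A z ^ 2) \<in> moderate_forms 4 24"
proof -
  have "slash (int 4) \<gamma> (\<lambda>z. cusp_A z ^ 2) z = cusp_A z ^ 2" if "\<gamma> \<in> Gamma0 24" "Im z > 0" for \<gamma> z
    by (rule slash_eqI[OF Gamma0_SL2Z[OF that(1)] that(2) cusp_A_sq_transform[OF that]])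
  moreover have "moderate_growth cusp_A"
    unfolding cusp_A_conv [abs_def] by (intro moderate_growth_mult moderate_growth_scale moderate_growth_dedekind_eta) auto
  ultimately show ?thesis unfolding moderate_forms_def
    by (auto simp: power2_eq_square intro!: holomorphic_intros cusp_A_holomorphic moderate_growth_mult)
qed

text \<open>
  The factors with odd exponent in the eta quotient of this product are those of \<open>A\<close>, so splitting off one
  factor \<open>A\<close> leaves even powers of \<open>\<eta>\<close>.
\<close>
lemma theta_1236_quotient:
  assumes z: "Im z > 0"
  shows "theta_prod (1, 2, 3, 6) z = cusp_A z * cusp_A z ^ 2 /
     (dedekind_eta (of_nat 1 * z) ^ 2 * dedekind_eta (of_nat 3 * z) ^ 2 * dedekind_eta (of_nat 8 * z) ^ 2 * dedekind_eta (of_nat 24 * z) ^ 2)"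
proof -
  have nz: "dedekind_eta (of_nat n * z) \<noteq> 0" if "n > 0" for n
    using that z by (intro dedekind_eta_nonzero) simp
  have Imz: "Im (of_nat n * z) > 0" if "n > 0" for n using that z by simp
  have e: "2 * z = of_nat 2 * z" "3 * z = of_nat 3 * z" "6 * z = of_nat 6 * z" "4 * z = of_nat 4 * z"
    "12 * z = of_nat 12 * z" "8 * z = of_nat 8 * z" "24 * z = of_nat 24 * z" "z = of_nat 1 * z" by simp_all
  have alg: "(a2 ^ 5 / (a1 ^ 2 * a4 ^ 2)) * (a4 ^ 5 / (a2 ^ 2 * a8 ^ 2)) * (a6 ^ 5 / (a3 ^ 2 * a12 ^ 2)) * (a12 ^ 5 / (a6 ^ 2 * a24 ^ 2))
      = (a2 * a4 * a6 * a12) * (a2 * a4 * a6 * a12) ^ 2 / (a1 ^ 2 * a3 ^ 2 * a8 ^ 2 * a24 ^ 2)"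
    if "a1 \<noteq> 0" "a2 \<noteq> 0" "a3 \<noteq> 0" "a4 \<noteq> 0" "a6 \<noteq> 0" "a8 \<noteq> 0" "a12 \<noteq> 0" "a24 \<noteq> 0"
    for a1 a2 a3 a4 a6 a8 a12 a24 :: complex
    using that by (simp add: divide_simps) (simp add: eval_nat_numeral mult_ac)
  have "theta_prod (1, 2, 3, 6) z = theta_phi (of_nat 1 * z) * theta_phi (of_nat 2 * z) * theta_phi (of_nat 3 * z) * theta_phi (of_nat 6 * z)"
    by (simp add: theta_prod_def)
  also have "\<dots> = (dedekind_eta (of_nat 2 * z) ^ 5 / (dedekind_eta (of_nat 1 * z) ^ 2 * dedekind_eta (of_nat 4 * z) ^ 2)) *
     (dedekind_eta (of_nat 4 * z) ^ 5 / (dedekind_eta (of_nat 2 * z) ^ 2 * dedekind_eta (of_nat 8 * z) ^ 2)) *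
     (dedekind_eta (of_nat 6 * z) ^ 5 / (dedekind_eta (of_nat 3 * z) ^ 2 * dedekind_eta (of_nat 12 * z) ^ 2)) *
     (dedekind_eta (of_nat 12 * z) ^ 5 / (dedekind_eta (of_nat 6 * z) ^ 2 * dedekind_eta (of_nat 24 * z) ^ 2))"
    using theta_phi_eta_quotient[OF Imz, of 1] theta_phi_eta_quotient[OF Imz, of 2]
      theta_phi_eta_quotient[OF Imz, of 3] theta_phi_eta_quotient[OF Imz, of 6]
    by (simp add: mult.assoc [symmetric])
  also have "\<dots> = cusp_A z * cusp_A z ^ 2 /
     (dedekind_eta (of_nat 1 * z) ^ 2 * dedekind_eta (of_nat 3 * z) ^ 2 * dedekind_eta (of_nat 8 * z) ^ 2 * dedekind_eta (of_nat 24 * z) ^ 2)"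
    unfolding cusp_A_conv by (rule alg) (intro nz; simp)+
  finally show ?thesis .
qed

text \<open>
  The law of \<open>A\<close> is given, and the one of the remaining quotient of even powers of \<open>\<eta>\<close> follows
  from the multiplier congruences.
\<close>
theorem theta_1236_form:
  assumes A: "cusp_A \<in> moderate_forms 2 24"
  shows "theta_prod (1, 2, 3, 6) \<in> moderate_forms 2 24"
proof -
  have inv: "slash (int 2) \<gamma> (theta_prod (1, 2, 3, 6)) z = theta_prod (1, 2, 3, 6) z"
    if \<gamma>: "\<gamma> \<in> Gamma0 24" and z: "Im z > 0" for \<gamma> z
  proof (rule slash_eqI[OF Gamma0_SL2Z[OF \<gamma>] z])
    define j where "j = autom_factor \<gamma> z"
    have j: "j \<noteq> 0" unfolding j_def by (rule autom_factor_nonzero[OF Gamma0_SL2Z[OF \<gamma>] z])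
    obtain m where m: "\<gamma> $ 2 $ 1 = 24 * m" "\<gamma> $ 1 $ 1 * \<gamma> $ 2 $ 2 - 24 * (m * \<gamma> $ 1 $ 2) = 1"
      using Gamma0_24_split[OF \<gamma>] .
    note S = eta_sq_scaled[OF Gamma0_SL2Z[OF \<gamma>] z]
    note Z = zeta12_cong[OF eta_exponent_theta_1236[OF m(2)], unfolded zeta12_add zeta12_0]
    have alg: "(A * j * X) * (B * j * Y) * (C * j * V) * (D * j * W) = (A * B * C * D) * (j ^ 4 * (X * Y * V * W))"
      for A B C D X Y V W :: complex
      by (simp add: eval_nat_numeral mult_ac)
    let ?Q = "\<lambda>w. dedekind_eta (of_nat 1 * w) ^ 2 * dedekind_eta (of_nat 3 * w) ^ 2 * dedekind_eta (of_nat 8 * w) ^ 2 * dedekind_eta (of_nat 24 * w) ^ 2"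
    have Q: "?Q (moebius_action \<gamma> z) = j ^ 4 * ?Q z"
      using S[of 1 "24 * m"] S[of 3 "8 * m"] S[of 8 "3 * m"] S[of 24 m] m(1) Z
      by (simp only: alg j_def [symmetric]) (simp add: alg)
    have "slash (int 2) \<gamma> cusp_A z = cusp_A z" using A \<gamma> z by (simp add: moderate_forms_def)
    hence A1: "cusp_A (moebius_action \<gamma> z) = j ^ 2 * cusp_A z"
      using j by (simp add: slash_eq j_def [symmetric] power_int_minus field_simps)
    have A2: "cusp_A (moebius_action \<gamma> z) ^ 2 = j ^ 4 * cusp_A z ^ 2"
      unfolding j_def by (rule cusp_A_sq_transform[OF \<gamma> z])
    have c: "j ^ 2 * a * (j ^ 4 * b) / (j ^ 4 * e) = j ^ 2 * (a * b / e)" for a b e :: complex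
      using j by simp
    show "theta_prod (1, 2, 3, 6) (moebius_action \<gamma> z) = autom_factor \<gamma> z ^ 2 * theta_prod (1, 2, 3, 6) z"
      unfolding theta_1236_quotient[OF z] theta_1236_quotient[OF Im_moebius_action_pos[OF Gamma0_SL2Z[OF \<gamma>] z]]
        Q A2 unfolding A1 c unfolding j_def ..
  qed
  have eq: "theta_prod (1, 2, 3, 6) = (\<lambda>z. theta_phi (of_nat 1 * z) * theta_phi (of_nat 2 * z) * theta_phi (of_nat 3 * z) * theta_phi (of_nat 6 * z))"
    by (simp add: theta_prod_def fun_eq_iff)
  have "theta_prod (1, 2, 3, 6) holomorphic_on upper_half_plane"
    unfolding eq by (intro holomorphic_intros holomorphic_scale theta_phi_holomorphic) auto
  moreover have "moderate_growth (theta_prod (1, 2, 3, 6))"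
    unfolding eq by (intro moderate_growth_mult moderate_growth_scale moderate_growth_theta_phi) auto
  ultimately show ?thesis using inv by (simp add: moderate_forms_def)
qed

section \<open>Truncated power series\<close>

fun list_poly :: "complex list \<Rightarrow> complex \<Rightarrow> complex" where
  "list_poly [] q = 0"
| "list_poly (x # xs) q = x + q * list_poly xs q"

text \<open>
  The product of the polynomials, cut off at the length of the second list.
  Dropping the last entry before each shift keeps the length fixed.
\<close>
fun trunc_mult :: "complex list \<Rightarrow> complex list \<Rightarrow> complex list" where
  "trunc_mult [] ys = map (\<lambda>_. 0) ys"
| "trunc_mult (x # xs) ys = map2 (+) (map ((*) x) ys) (0 # butlast (trunc_mult xs ys))"

definition dilate_list :: "nat \<Rightarrow> complex list \<Rightarrow> complex list" where
  "dilate_list d xs = concat (map (\<lambda>x. x # replicate (d - 1) 0) xs)"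

text \<open>
  The list holds all coefficients below \<open>q\<^sup>N\<close>. A uniform bound on the fixed disc \<open>\<bar>q\<bar> \<le> 1/2\<close> makes
  the relation stable under products and under \<open>q \<mapsto> q\<^sup>d\<close>.
\<close>
definition expansion_upto :: "nat \<Rightarrow> (complex \<Rightarrow> complex) \<Rightarrow> complex list \<Rightarrow> bool" where
  "expansion_upto N f xs \<longleftrightarrow> length xs = N \<and>
     (\<exists>C. \<forall>q. norm q \<le> 1/2 \<longrightarrow> norm (f q - list_poly xs q) \<le> C * norm q ^ N)"

lemma expansion_uptoI:
  assumes "length xs = N" "\<And>q. norm q \<le> 1/2 \<Longrightarrow> norm (f q - list_poly xs q) \<le> C * norm q ^ N"
  shows "expansion_upto N f xs"
  using assms unfolding expansion_upto_def by blast

lemma expansion_uptoE: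
  assumes "expansion_upto N f xs"
  obtains C where "C \<ge> 0" "length xs = N" "\<And>q. norm q \<le> 1/2 \<Longrightarrow> norm (f q - list_poly xs q) \<le> C * norm q ^ N"
proof -
  obtain C where C: "length xs = N" "\<And>q. norm q \<le> 1/2 \<Longrightarrow> norm (f q - list_poly xs q) \<le> C * norm q ^ N"
    using assms unfolding expansion_upto_def by blast
  have "norm (f q - list_poly xs q) \<le> \<bar>C\<bar> * norm q ^ N" if "norm q \<le> 1/2" for q
    by (rule order.trans[OF C(2)[OF that]]) (intro mult_right_mono; simp)
  with C(1) that[of "\<bar>C\<bar>"] show ?thesis by simp
qed

lemma list_poly_append: "list_poly (xs @ ys) q = list_poly xs q + q ^ length xs * list_poly ys q"
  by (induction xs) (simp_all add: algebra_simps)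

lemma list_poly_replicate_0 [simp]: "list_poly (replicate n 0) q = 0"
  by (induction n) auto

lemma list_poly_map_0 [simp]: "list_poly (map (\<lambda>_. 0) ys) q = 0"
  by (induction ys) auto

lemma list_poly_map2_add: "length xs = length ys \<Longrightarrow> list_poly (map2 (+) xs ys) q = list_poly xs q + list_poly ys q"
  by (induction xs ys rule: list_induct2) (simp_all add: algebra_simps)

lemma list_poly_scale: "list_poly (map ((*) c) xs) q = c * list_poly xs q"
  by (induction xs) (simp_all add: algebra_simps)

lemma list_poly_bound:
  assumes "norm q \<le> 1/2" shows "norm (list_poly xs q) \<le> sum_list (map norm xs)"
proof (induction xs)
  case (Cons x xs)
  have "norm (q * list_poly xs q) \<le> 1 * sum_list (map norm xs)"
    unfolding norm_mult by (intro mult_mono Cons.IH) (use assms in auto)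
  thus ?case using norm_triangle_ineq[of x "q * list_poly xs q"] by simp
qed simp

lemma length_trunc_mult: "length (trunc_mult xs ys) = length ys"
  by (induction xs) (auto simp: min_def)

text \<open>
  Each step of the recursion discards one monomial of degree \<open>length ys\<close> and multiplies the previous error
  by \<open>q\<close>.
\<close>
lemma trunc_mult_error:
  "\<exists>C. \<forall>q. norm q \<le> 1/2 \<longrightarrow> norm (list_poly xs q * list_poly ys q - list_poly (trunc_mult xs ys) q) \<le> C * norm q ^ length ys"
proof (cases "ys = []")
  case True
  thus ?thesis by (intro exI[of _ 0]) (simp add: length_trunc_mult[of xs "[]", simplified])
next
  case False
  show ?thesis
  proof (induction xs)
    case Nil
    show ?case by (intro exI[of _ 0]) simp
  next
    case (Cons x xs)
    then obtain C where C: "\<And>q. norm q \<le> 1/2 \<Longrightarrow> norm (list_poly xs q * list_poly ys q - list_poly (trunc_mult xs ys) q) \<le> C * norm q ^ length ys"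
      by blast
    define Z where "Z = trunc_mult xs ys"
    have Z: "length Z = length ys" "Z \<noteq> []" using False length_trunc_mult[of xs ys] by (auto simp: Z_def)
    define v where "v = last Z"
    have Z_split: "Z = butlast Z @ [v]" using Z by (simp add: v_def)
    have lZ: "list_poly Z q = list_poly (butlast Z) q + q ^ (length ys - 1) * v" for q
      by (subst Z_split, subst list_poly_append) (simp add: Z)
    have "norm (list_poly (x # xs) q * list_poly ys q - list_poly (trunc_mult (x # xs) ys) q) \<le> (\<bar>C\<bar> + norm v) * norm q ^ length ys"
      if q: "norm q \<le> 1/2" for q
    proof -
      have len: "length (map ((*) x) ys) = length (0 # butlast Z)" using Z False by (cases ys) auto
      have pw: "q * q ^ (length ys - 1) = q ^ length ys" using False by (cases ys) auto
      have "list_poly (trunc_mult (x # xs) ys) q = x * list_poly ys q + q * list_poly (butlast Z) q"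
        using list_poly_map2_add[OF len] by (simp add: list_poly_scale Z_def)
      hence "list_poly (x # xs) q * list_poly ys q - list_poly (trunc_mult (x # xs) ys) q =
         q * (list_poly xs q * list_poly ys q - list_poly Z q) + q * q ^ (length ys - 1) * v"
        by (simp add: lZ algebra_simps)
      hence "norm (list_poly (x # xs) q * list_poly ys q - list_poly (trunc_mult (x # xs) ys) q) \<le>
         norm q * norm (list_poly xs q * list_poly ys q - list_poly Z q) + norm q ^ length ys * norm v"
        unfolding pw by (simp only: norm_mult [symmetric] norm_power [symmetric]) (rule norm_triangle_ineq)
      also have "norm q * norm (list_poly xs q * list_poly ys q - list_poly Z q) \<le> 1 * (\<bar>C\<bar> * norm q ^ length ys)"
      proof (rule mult_mono)
        have "norm (list_poly xs q * list_poly ys q - list_poly Z q) \<le> C * norm q ^ length ys"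
          unfolding Z_def by (rule C[OF q])
        also have "\<dots> \<le> \<bar>C\<bar> * norm q ^ length ys" by (intro mult_right_mono) auto
        finally show "norm (list_poly xs q * list_poly ys q - list_poly Z q) \<le> \<bar>C\<bar> * norm q ^ length ys" .
      qed (use q in auto)
      finally show ?thesis by (simp add: algebra_simps)
    qed
    thus ?case by blast
  qed
qed

lemma expansion_mult:
  assumes "expansion_upto N f xs" "expansion_upto N g ys"
  shows "expansion_upto N (\<lambda>q. f q * g q) (trunc_mult xs ys)"
proof -
  obtain C where C: "C \<ge> 0" "length xs = N" "\<And>q. norm q \<le> 1/2 \<Longrightarrow> norm (f q - list_poly xs q) \<le> C * norm q ^ N"
    using expansion_uptoE[OF assms(1)] by blast
  obtain D where D: "D \<ge> 0" "length ys = N" "\<And>q. norm q \<le> 1/2 \<Longrightarrow> norm (g q - list_poly ys q) \<le> D * norm q ^ N"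
    using expansion_uptoE[OF assms(2)] by blast
  obtain E where E: "\<And>q. norm q \<le> 1/2 \<Longrightarrow> norm (list_poly xs q * list_poly ys q - list_poly (trunc_mult xs ys) q) \<le> E * norm q ^ N"
    using trunc_mult_error[of xs ys] D(2) by blast
  define X Y where "X = sum_list (map norm xs)" and "Y = sum_list (map norm ys)"
  show ?thesis
  proof (rule expansion_uptoI)
    fix q :: complex assume q: "norm q \<le> 1/2"
    have q1: "norm q ^ N \<le> 1" using q by (intro power_le_one) auto
    have g: "norm (g q) \<le> D + Y"
    proof -
      have "norm (g q) \<le> norm (g q - list_poly ys q) + norm (list_poly ys q)"
        using norm_triangle_ineq[of "g q - list_poly ys q" "list_poly ys q"] by simp
      also have "\<dots> \<le> D * norm q ^ N + Y" using D(3)[OF q] list_poly_bound[OF q, of ys] by (simp add: Y_def)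
      also have "\<dots> \<le> D * 1 + Y" by (intro add_right_mono mult_left_mono q1 D(1))
      finally show ?thesis by simp
    qed
    have "f q * g q - list_poly (trunc_mult xs ys) q =
      ((f q - list_poly xs q) * g q + list_poly xs q * (g q - list_poly ys q)) + (list_poly xs q * list_poly ys q - list_poly (trunc_mult xs ys) q)"
      by (simp add: algebra_simps)
    hence "norm (f q * g q - list_poly (trunc_mult xs ys) q) \<le>
       (norm (f q - list_poly xs q) * norm (g q) + norm (list_poly xs q) * norm (g q - list_poly ys q)) +
       norm (list_poly xs q * list_poly ys q - list_poly (trunc_mult xs ys) q)"
      by (simp only:) (intro norm_triangle_le add_mono order.refl, simp_all add: norm_mult)
    also have "\<dots> \<le> ((C * norm q ^ N) * (D + Y) + X * (D * norm q ^ N)) + E * norm q ^ N"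
      using C D(1) q by (intro add_mono mult_mono C D(3) E g) (auto simp: X_def list_poly_bound intro!: sum_list_nonneg)
    finally show "norm (f q * g q - list_poly (trunc_mult xs ys) q) \<le> (C * (D + Y) + X * D + E) * norm q ^ N"
      by (simp add: algebra_simps)
  qed (simp add: length_trunc_mult D)
qed

lemma expansion_add:
  assumes "expansion_upto N f xs" "expansion_upto N g ys"
  shows "expansion_upto N (\<lambda>q. f q + g q) (map2 (+) xs ys)"
proof -
  obtain C where C: "length xs = N" "\<And>q. norm q \<le> 1/2 \<Longrightarrow> norm (f q - list_poly xs q) \<le> C * norm q ^ N"
    using expansion_uptoE[OF assms(1)] by blast
  obtain D where D: "length ys = N" "\<And>q. norm q \<le> 1/2 \<Longrightarrow> norm (g q - list_poly ys q) \<le> D * norm q ^ N"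
    using expansion_uptoE[OF assms(2)] by blast
  show ?thesis
  proof (rule expansion_uptoI)
    fix q :: complex assume q: "norm q \<le> 1/2"
    have "norm (f q + g q - list_poly (map2 (+) xs ys) q) = norm ((f q - list_poly xs q) + (g q - list_poly ys q))"
      using C(1) D(1) by (simp add: list_poly_map2_add algebra_simps)
    also have "\<dots> \<le> C * norm q ^ N + D * norm q ^ N"
      by (intro norm_triangle_le add_mono C D q)
    finally show "norm (f q + g q - list_poly (map2 (+) xs ys) q) \<le> (C + D) * norm q ^ N"
      by (simp add: algebra_simps)
  qed (use C D in simp)
qed

lemma expansion_cmult:
  assumes "expansion_upto N f xs"
  shows "expansion_upto N (\<lambda>q. c * f q) (map ((*) c) xs)"
proof -
  obtain C where C: "length xs = N" "\<And>q. norm q \<le> 1/2 \<Longrightarrow> norm (f q - list_poly xs q) \<le> C * norm q ^ N"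
    using expansion_uptoE[OF assms(1)] by blast
  show ?thesis
  proof (rule expansion_uptoI)
    fix q :: complex assume q: "norm q \<le> 1/2"
    have "norm (c * f q - list_poly (map ((*) c) xs) q) = norm c * norm (f q - list_poly xs q)"
      by (simp add: list_poly_scale norm_mult flip: right_diff_distrib)
    also have "\<dots> \<le> norm c * (C * norm q ^ N)" by (intro mult_left_mono C q) simp
    finally show "norm (c * f q - list_poly (map ((*) c) xs) q) \<le> (norm c * C) * norm q ^ N" by (simp add: mult.assoc)
  qed (use C in simp)
qed

lemma expansion_take:
  assumes "expansion_upto N f xs" "M \<le> N"
  shows "expansion_upto M f (take M xs)"
proof -
  obtain C where C: "C \<ge> 0" "length xs = N" "\<And>q. norm q \<le> 1/2 \<Longrightarrow> norm (f q - list_poly xs q) \<le> C * norm q ^ N"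
    using expansion_uptoE[OF assms(1)] by blast
  define D where "D = sum_list (map norm (drop M xs))"
  show ?thesis
  proof (rule expansion_uptoI)
    fix q :: complex assume q: "norm q \<le> 1/2"
    have "list_poly xs q = list_poly (take M xs @ drop M xs) q" by simp
    also have "\<dots> = list_poly (take M xs) q + q ^ M * list_poly (drop M xs) q"
      unfolding list_poly_append using C(2) assms(2) by simp
    finally have "f q - list_poly (take M xs) q = (f q - list_poly xs q) + q ^ M * list_poly (drop M xs) q" by simp
    hence "norm (f q - list_poly (take M xs) q) \<le> C * norm q ^ N + norm q ^ M * D"
      using C(3)[OF q] list_poly_bound[OF q, of "drop M xs"]
      by (simp only:) (intro norm_triangle_le add_mono, auto simp: norm_mult norm_power D_def intro!: mult_left_mono)
    also have "C * norm q ^ N \<le> C * norm q ^ M"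
      by (intro mult_left_mono power_decreasing C(1) assms(2)) (use q in auto)
    finally show "norm (f q - list_poly (take M xs) q) \<le> (C + D) * norm q ^ M" by (simp add: algebra_simps)
  qed (use C assms in simp)
qed

lemma list_poly_dilate_list: "d > 0 \<Longrightarrow> list_poly (dilate_list d xs) q = list_poly xs (q ^ d)"
proof (induction xs)
  case (Cons x xs)
  have "list_poly (dilate_list d (x # xs)) q = list_poly ((x # replicate (d - 1) 0) @ dilate_list d xs) q"
    by (simp add: dilate_list_def)
  also have "\<dots> = x + q ^ d * list_poly xs (q ^ d)"
    unfolding list_poly_append using Cons by simp
  finally show ?case by simp
qed (simp add: dilate_list_def)

lemma length_dilate_list: "d > 0 \<Longrightarrow> length (dilate_list d xs) = d * length xs"
  by (induction xs) (simp_all add: dilate_list_def)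

lemma expansion_compose_power:
  assumes "expansion_upto N f xs" "d > 0"
  shows "expansion_upto (d * N) (\<lambda>q. f (q ^ d)) (dilate_list d xs)"
proof -
  obtain C where C: "C \<ge> 0" "length xs = N" "\<And>q. norm q \<le> 1/2 \<Longrightarrow> norm (f q - list_poly xs q) \<le> C * norm q ^ N"
    using expansion_uptoE[OF assms(1)] by blast
  show ?thesis
  proof (rule expansion_uptoI)
    fix q :: complex assume q: "norm q \<le> 1/2"
    have "norm (q ^ d) \<le> norm q ^ 1" unfolding norm_power by (rule power_decreasing) (use assms q in auto)
    hence "norm (q ^ d) \<le> 1/2" using q by simp
    from C(3)[OF this] show "norm (f (q ^ d) - list_poly (dilate_list d xs) q) \<le> C * norm q ^ (d * N)"
      by (simp add: list_poly_dilate_list[OF assms(2)] norm_power power_mult)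
  qed (use C assms in \<open>simp add: length_dilate_list\<close>)
qed

lemma expansion_dilate:
  assumes "expansion_upto N f xs" "d > 0"
  shows "expansion_upto N (\<lambda>q. f (q ^ d)) (take N (dilate_list d xs))"
  by (rule expansion_take[OF expansion_compose_power[OF assms]]) (use assms in auto)

text \<open>
  The tail is bounded by the value of the majorant series at \<open>q = 1/2\<close>.
\<close>
lemma expansion_power_series:
  assumes s: "summable (\<lambda>n. norm (c n) * (1/2) ^ n)"
  shows "expansion_upto N (\<lambda>q. \<Sum>n. c n * q ^ n) (map c [0..<N])"
proof -
  define C where "C = (\<Sum>n. norm (c (n + N)) * (1/2) ^ n)"
  have s': "summable (\<lambda>n. norm (c (n + N)) * (1/2) ^ n)"
  proof -
    have "summable (\<lambda>n. norm (c (n + N)) * (1/2) ^ (n + N) * 2 ^ N)"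
      using summable_mult2[OF summable_ignore_initial_segment[OF s, of N], of "2 ^ N"] .
    thus ?thesis by (simp add: power_add power_divide)
  qed
  have lp: "list_poly (map c [0..<N]) q = (\<Sum>n<N. c n * q ^ n)" for q
    by (induction N) (simp_all add: list_poly_append mult.commute)
  show ?thesis
  proof (rule expansion_uptoI)
    fix q :: complex assume q: "norm q \<le> 1/2"
    have le: "norm (c n * q ^ n) \<le> norm (c n) * (1/2) ^ n" for n
      unfolding norm_mult norm_power by (intro mult_left_mono power_mono q) auto
    have sq: "summable (\<lambda>n. c n * q ^ n)"
      by (rule summable_comparison_test[OF _ s]) (use le in auto)
    have "(\<Sum>n. c n * q ^ n) - list_poly (map c [0..<N]) q = (\<Sum>n. c (n + N) * q ^ (n + N))"
      using suminf_split_initial_segment[OF sq, of N] lp by simp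
    also have "\<dots> = (\<Sum>n. q ^ N * (c (n + N) * q ^ n))"
      by (simp add: power_add mult_ac)
    finally have e: "(\<Sum>n. c n * q ^ n) - list_poly (map c [0..<N]) q = (\<Sum>n. q ^ N * (c (n + N) * q ^ n))" .
    have "norm (\<Sum>n. q ^ N * (c (n + N) * q ^ n)) \<le> (\<Sum>n. norm q ^ N * (norm (c (n + N)) * (1/2) ^ n))"
      by (rule norm_suminf_le[OF _ summable_mult[OF s']])
         (auto simp: norm_mult norm_power intro!: mult_left_mono power_mono q)
    also have "\<dots> = norm q ^ N * C" unfolding C_def by (rule suminf_mult[OF s'])
    finally show "norm ((\<Sum>n. c n * q ^ n) - list_poly (map c [0..<N]) q) \<le> C * norm q ^ N"
      unfolding e by (simp add: mult.commute)
  qed simp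
qed

lemma expansion_id: "expansion_upto (Suc (Suc N)) (\<lambda>q. q) (0 # 1 # replicate N 0)"
  by (rule expansion_uptoI[where C = 0]) auto

lemma expansion_theta: "expansion_upto 17 theta_series [1,2,0,0,2,0,0,0,0,2,0,0,0,0,0,0,2]"
proof (rule expansion_uptoI[where C = 4])
  fix q :: complex assume q: "norm q \<le> 1/2"
  hence q1: "norm q < 1" by simp
  have s: "summable (\<lambda>n. q ^ (Suc n)\<^sup>2)"
    by (rule summable_norm_cancel[OF theta_summable[OF q1]])
  (* The omitted exponents are the squares from 25 on, so the tail is more than small enough. *)
  have e: "theta_series q - list_poly [1,2,0,0,2,0,0,0,0,2,0,0,0,0,0,0,2] q = 2 * (\<Sum>n. q ^ (Suc (n + 4))\<^sup>2)"
    unfolding theta_series_def using suminf_split_initial_segment[OF s, of 4]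
    by (simp add: eval_nat_numeral algebra_simps)
  have g: "summable (\<lambda>n. norm q ^ 17 * (1/2) ^ n)" by (intro summable_mult summable_geometric) simp
  have "norm (\<Sum>n. q ^ (Suc (n + 4))\<^sup>2) \<le> (\<Sum>n. norm q ^ 17 * (1/2) ^ n)"
  proof (rule norm_suminf_le[OF _ g])
    fix n :: nat
    have "norm (q ^ (Suc (n + 4))\<^sup>2) \<le> norm q ^ (17 + n)"
      unfolding norm_power by (rule power_decreasing) (use q in \<open>auto simp: power2_eq_square algebra_simps\<close>)
    also have "\<dots> \<le> norm q ^ 17 * (1/2) ^ n"
      unfolding power_add by (intro mult_left_mono power_mono q) auto
    finally show "norm (q ^ (Suc (n + 4))\<^sup>2) \<le> norm q ^ 17 * (1/2) ^ n" .
  qed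
  also have "\<dots> = norm q ^ 17 * 2"
    by (subst suminf_mult) (auto simp: suminf_geometric summable_geometric)
  finally show "norm (theta_series q - list_poly [1,2,0,0,2,0,0,0,0,2,0,0,0,0,0,0,2] q) \<le> 4 * norm q ^ 17"
    unfolding e by (simp add: norm_mult)
qed simp

lemma sigma_eq_sum_list:
  "n > 0 \<Longrightarrow> sigma n = sum_list (filter (\<lambda>m. m dvd n) [1..<Suc n])"
proof -
  assume n: "n > 0"
  have "sigma n = \<Sum>(set (filter (\<lambda>m. m dvd n) [1..<Suc n]))"
    unfolding sigma_def by (rule sum.cong) (use n in \<open>auto dest: dvd_imp_le\<close>)
  also have "\<dots> = sum_list (filter (\<lambda>m. m dvd n) [1..<Suc n])"
    by (subst sum_list_distinct_conv_sum_set [symmetric, where f = "\<lambda>x. x"]) auto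
  finally show ?thesis .
qed

lemma sigma_values: "map sigma [1..<9] = [1, 3, 4, 7, 6, 12, 8, 15]"
proof -
  have "map sigma [1..<9] = map (\<lambda>n. sum_list (filter (\<lambda>m. m dvd n) [1..<Suc n])) [1..<9]"
    by (rule map_cong) (auto simp: sigma_eq_sum_list)
  also have "\<dots> = [1, 3, 4, 7, 6, 12, 8, 15]" by code_simp
  finally show ?thesis .
qed

lemma expansion_eis_L: "expansion_upto 9 eis_L [- 1/24, 1, 3, 4, 7, 6, 12, 8, 15]"
proof -
  define c :: "nat \<Rightarrow> complex" where "c = (\<lambda>n. if n = 0 then - 1/24 else of_nat (sigma n))"
  have sum1: "summable (\<lambda>n. of_nat (sigma (Suc n)) * (1/2 :: complex) ^ Suc n)"
    by (rule sums_summable[OF lambert_total(2)]) simp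
  have norm_summable: "summable (\<lambda>n. norm (c n) * (1/2) ^ n)"
  proof -
    have "summable (\<lambda>n. complex_of_real (real (sigma (Suc n)) * (1/2) ^ Suc n))"
      using sum1 by simp
    hence "summable (\<lambda>n. real (sigma (Suc n)) * (1/2) ^ Suc n)"
      by (simp only: summable_complex_of_real)
    hence "summable (\<lambda>n. norm (c (Suc n)) * (1/2) ^ Suc n)" by (simp add: c_def)
    thus ?thesis by (subst (asm) summable_Suc_iff)
  qed
  have "(\<Sum>n. c n * q ^ n) = eis_L q" if q: "norm q < 1" for q
  proof -
    have "(\<lambda>n. c (Suc n) * q ^ Suc n) sums (eis_L q + 1/24)"
      using lambert_total(2)[OF q] by (simp add: c_def)
    hence "(\<lambda>n. c n * q ^ n) sums (eis_L q + 1/24 + c 0 * q ^ 0)" by (rule sums_Suc)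
    thus ?thesis by (simp add: sums_iff c_def)
  qed
  hence "norm (eis_L q - list_poly xs q) = norm ((\<Sum>n. c n * q ^ n) - list_poly xs q)" if "norm q \<le> 1/2" for q xs
    using that by simp
  hence "expansion_upto 9 eis_L (map c [0..<9])"
    using expansion_power_series[OF norm_summable, of 9] unfolding expansion_upto_def by (metis (no_types, lifting))
  moreover have "map c [0..<9] = [- 1/24, 1, 3, 4, 7, 6, 12, 8, 15]"
  proof -
    have "map c [0..<9] = (- 1/24) # map c [1..<9]" by (simp add: upt_conv_Cons c_def)
    also have "map c [1..<9] = map of_nat (map sigma [1..<9])" by (simp add: c_def)
    also have "map sigma [1..<9] = [1, 3, 4, 7, 6, 12, 8, 15]" by (rule sigma_values)
    finally show ?thesis by simp
  qed
  ultimately show ?thesis by simp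
qed

text \<open>
  Each factor is at most \<open>exp (2 powr (- k))\<close>, and these exponents add up to at most 1.
\<close>
lemma partial_euler_prod_bound:
  fixes q :: complex
  assumes "norm q \<le> 1/2"
  shows "norm (\<Prod>k<n. 1 - q ^ Suc k) \<le> exp 1"
proof -
  have "norm (\<Prod>k<n. 1 - q ^ Suc k) \<le> (\<Prod>k<n. 1 + norm q ^ Suc k)"
    unfolding prod_norm [symmetric]
    by (rule prod_mono) (auto simp: norm_mult norm_power intro!: norm_triangle_le_diff)
  also have "\<dots> \<le> (\<Prod>k<n. exp ((1/2) ^ Suc k))"
  proof (rule prod_mono, safe)
    fix k
    have "1 + norm q ^ Suc k \<le> 1 + (1/2) ^ Suc k" by (intro add_left_mono power_mono assms) auto
    also have "\<dots> \<le> exp ((1/2) ^ Suc k)" by (rule exp_ge_add_one_self)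
    finally show "1 + norm q ^ Suc k \<le> exp ((1/2) ^ Suc k)" .
  qed simp
  also have "\<dots> = exp (\<Sum>k<n. (1/2) ^ Suc k)" by (simp add: exp_sum)
  also have "(\<Sum>k<n. (1/2 :: real) ^ Suc k) \<le> 1"
  proof -
    have "(\<Sum>k<n. (1/2 :: real) ^ Suc k) = 1 - (1/2) ^ n" by (induction n) (simp_all add: field_simps)
    thus ?thesis by simp
  qed
  finally show ?thesis by simp
qed

text \<open>
  The partial products satisfy \<open>Q\<^sub>n\<^sub>+\<^sub>1 - Q\<^sub>n = - q\<^sup>n\<^sup>+\<^sup>1 Q\<^sub>n\<close> and are bounded, so the differences from index \<open>M\<close> on are
  dominated by a geometric series.
\<close>
lemma euler_prod_tail:
  assumes q: "norm q \<le> 1/2"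
  shows "norm (euler_prod q - (\<Prod>k<M. 1 - q ^ Suc k)) \<le> (2 * exp 1) * norm q ^ Suc M"
proof -
  define Q where "Q = (\<lambda>n. \<Prod>k<n. 1 - q ^ Suc k)"
  have fin: "norm (Q (M + n) - Q M) \<le> exp 1 * norm q ^ Suc M * (\<Sum>k<n. (1/2) ^ k)" for n
  proof (induction n)
    case (Suc n)
    have "Q (M + Suc n) - Q M = (Q (M + n) - Q M) + (- (q ^ Suc (M + n) * Q (M + n)))"
      by (simp add: Q_def algebra_simps)
    hence "norm (Q (M + Suc n) - Q M) \<le> norm (Q (M + n) - Q M) + norm (q ^ Suc (M + n)) * norm (Q (M + n))"
      using norm_triangle_ineq[of "Q (M + n) - Q M" "- (q ^ Suc (M + n) * Q (M + n))"]
      by (simp only: norm_minus_cancel norm_mult)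
    also have "norm (q ^ Suc (M + n)) * norm (Q (M + n)) \<le> (norm q ^ Suc M * (1/2) ^ n) * exp 1"
    proof (rule mult_mono)
      have "norm (q ^ Suc (M + n)) = norm q ^ Suc M * norm q ^ n"
        by (simp add: norm_mult norm_power power_add)
      also have "\<dots> \<le> norm q ^ Suc M * (1/2) ^ n" by (intro mult_left_mono power_mono q) auto
      finally show "norm (q ^ Suc (M + n)) \<le> norm q ^ Suc M * (1/2) ^ n" .
    qed (use partial_euler_prod_bound[OF q] in \<open>auto simp: Q_def\<close>)
    finally show ?case using Suc.IH by (simp add: algebra_simps)
  qed simp
  have "norm (Q (M + n) - Q M) \<le> (2 * exp 1) * norm q ^ Suc M" for n
  proof -
    have "(\<Sum>k<n. (1/2 :: real) ^ k) = 2 - 2 * (1/2) ^ n" by (induction n) (simp_all add: field_simps)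
    hence "(\<Sum>k<n. (1/2 :: real) ^ k) \<le> 2" by simp
    hence "exp 1 * norm q ^ Suc M * (\<Sum>k<n. (1/2) ^ k) \<le> exp 1 * norm q ^ Suc M * 2"
      by (intro mult_left_mono) auto
    thus ?thesis using fin[of n] by (simp add: mult_ac)
  qed
  moreover have "(\<lambda>n. norm (Q (M + n) - Q M)) \<longlonglongrightarrow> norm (euler_prod q - Q M)"
  proof (intro tendsto_intros)
    have "Q \<longlonglongrightarrow> euler_prod q" using euler_prod_LIMSEQ[of q] q by (simp add: Q_def [abs_def])
    thus "(\<lambda>n. Q (M + n)) \<longlonglongrightarrow> euler_prod q" by (subst add.commute) (rule LIMSEQ_ignore_initial_segment)
  qed
  ultimately show ?thesis unfolding Q_def by (intro LIMSEQ_le_const2) auto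
qed

text \<open>
  The successive products of \<open>1 - q, 1 - q\<^sup>2, \<dots>\<close>, cut off at \<open>q\<^sup>9\<close>.
\<close>
fun euler_list :: "nat \<Rightarrow> complex list" where
  "euler_list 0 = 1 # replicate 8 0"
| "euler_list (Suc n) = trunc_mult (1 # replicate n 0 @ -1 # replicate (7 - n) 0) (euler_list n)"

lemma expansion_euler_list: "n \<le> 8 \<Longrightarrow> expansion_upto 9 (\<lambda>q. \<Prod>k<n. 1 - q ^ Suc k) (euler_list n)"
proof (induction n)
  case 0
  show ?case by (rule expansion_uptoI[where C = 0]) auto
next
  case (Suc n)
  have "expansion_upto 9 (\<lambda>q. 1 - q ^ Suc n) (1 # replicate n 0 @ -1 # replicate (7 - n) 0)"
    by (rule expansion_uptoI[where C = 0]) (use Suc.prems in \<open>auto simp: list_poly_append\<close>)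
  from expansion_mult[OF this Suc.IH] show ?case using Suc.prems by (simp add: mult.commute)
qed

lemma euler_list_8: "euler_list 8 = [1,-1,-1,0,0,1,0,1,0]"
  by (simp add: eval_nat_numeral)

text \<open>
  Nine coefficients suffice for the order 17 below, since the product is only used at
  powers of \<open>q\<close> with exponent at least 2.
\<close>
lemma expansion_euler_prod: "expansion_upto 9 euler_prod [1,-1,-1,0,0,1,0,1,0]"
proof -
  have "expansion_upto 9 (\<lambda>q. \<Prod>k<8. 1 - q ^ Suc k) (euler_list 8)"
    by (rule expansion_euler_list) simp
  hence "expansion_upto 9 (\<lambda>q. \<Prod>k<8. 1 - q ^ Suc k) [1,-1,-1,0,0,1,0,1,0]"
    by (simp only: euler_list_8)
  then obtain C where C: "\<And>q. norm q \<le> 1/2 \<Longrightarrow> norm ((\<Prod>k<8. 1 - q ^ Suc k) - list_poly [1,-1,-1,0,0,1,0,1,0] q) \<le> C * norm q ^ 9"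
    unfolding expansion_upto_def by blast
  show ?thesis
  proof (rule expansion_uptoI)
    fix q :: complex assume q: "norm q \<le> 1/2"
    have "norm (euler_prod q - list_poly [1,-1,-1,0,0,1,0,1,0] q) \<le>
      norm (euler_prod q - (\<Prod>k<8. 1 - q ^ Suc k)) + norm ((\<Prod>k<8. 1 - q ^ Suc k) - list_poly [1,-1,-1,0,0,1,0,1,0] q)"
      using norm_triangle_ineq[of "euler_prod q - (\<Prod>k<8. 1 - q ^ Suc k)" "(\<Prod>k<8. 1 - q ^ Suc k) - list_poly [1,-1,-1,0,0,1,0,1,0] q"]
      by (simp only: diff_add_cancel add_diff_eq diff_add_eq)
    also have "\<dots> \<le> (2 * exp 1) * norm q ^ Suc 8 + C * norm q ^ 9"
      by (intro add_mono euler_prod_tail C q)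
    finally show "norm (euler_prod q - list_poly [1,-1,-1,0,0,1,0,1,0] q) \<le> (2 * exp 1 + C) * norm q ^ 9"
      by (simp add: algebra_simps)
  qed simp
qed

section \<open>Vanishing of forms of level 24\<close>

text \<open>
  If \<open>d\<close> and \<open>d'\<close> are their own inverses, then \<open>c d\<close> and \<open>c' d'\<close> are the ratios \<open>c / d\<close> and \<open>c' / d'\<close>.
\<close>
lemma cross_product_cong:
  fixes c d c' d' m :: int
  assumes "[d * d = 1] (mod m)" "[d' * d' = 1] (mod m)" "[c * d = c' * d'] (mod m)"
  shows "[c' * d = d' * c] (mod m)"
proof -
  have 1: "m dvd d * d - 1" "m dvd d' * d' - 1" "m dvd c * d - c' * d'"
    using assms by (simp_all add: cong_iff_dvd_diff)
  have "c' * d - d' * c = (d' * c) * (d * d - 1) - (c' * d) * (d' * d' - 1) - (d * d') * (c * d - c' * d')"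
    by (simp add: algebra_simps)
  moreover have "m dvd \<dots>"
    by (rule dvd_diff[OF dvd_diff[OF dvd_mult[OF 1(1)] dvd_mult[OF 1(2)]] dvd_mult[OF 1(3)]])
  ultimately show ?thesis by (simp add: cong_iff_dvd_diff)
qed

text \<open>
  The coset of a matrix modulo \<open>\<Gamma>\<^sub>0(24)\<close> is the point \<open>(c : d)\<close> of the projective line over \<open>\<int>/24\<close>, which is the
  product of the projective lines over \<open>\<int>/3\<close> and \<open>\<int>/8\<close>, with \<open>4 \<cdot> 12 = 48\<close> points. All units modulo 3
  and modulo 8 are their own inverses, so the product \<open>c d\<close> serves as the affine coordinate, \<open>c / d\<close> or \<open>d / c\<close>.
  The number 3 labels the point at infinity modulo 3, and adding 8 marks the points
  with even \<open>d\<close> modulo 8.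
\<close>
definition coset_label :: "int \<Rightarrow> int \<Rightarrow> int \<times> int" where
  "coset_label c d = (if 3 dvd d then 3 else c * d mod 3, if odd d then c * d mod 8 else 8 + c * d mod 8)"

lemma odd_square_cong_8: "odd (d :: int) \<Longrightarrow> [d * d = 1] (mod 8)"
proof -
  assume "odd d"
  hence "d mod 8 = 1 \<or> d mod 8 = 3 \<or> d mod 8 = 5 \<or> d mod 8 = 7" by presburger
  thus "[d * d = 1] (mod 8)" unfolding cong_def by (subst mod_mult_eq [symmetric]) auto
qed

lemma square_cong_3: "\<not> 3 dvd (d :: int) \<Longrightarrow> [d * d = 1] (mod 3)"
proof -
  assume "\<not> 3 dvd d"
  hence "d mod 3 = 1 \<or> d mod 3 = 2" by presburger
  thus "[d * d = 1] (mod 3)" unfolding cong_def by (subst mod_mult_eq [symmetric]) auto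
qed

lemma coset_label_eqD:
  assumes eq: "coset_label c d = coset_label c' d'"
    and det: "odd c \<or> odd d" "odd c' \<or> odd d'"
  shows "24 dvd c' * d - d' * c"
proof -
  have eq3: "(if 3 dvd d then 3 else c * d mod 3) = (if 3 dvd d' then 3 else c' * d' mod 3)"
    and eq8: "(if odd d then c * d mod 8 else 8 + c * d mod 8) = (if odd d' then c' * d' mod 8 else 8 + c' * d' mod 8)"
    using eq by (simp_all add: coset_label_def)
  have m3: "c * d mod 3 < 3" "c' * d' mod 3 < 3" by simp_all
  have m8: "c * d mod 8 < 8" "c' * d' mod 8 < 8" "c * d mod 8 \<ge> 0" "c' * d' mod 8 \<ge> 0" by simp_all
  have 3: "3 dvd c' * d - d' * c"
  proof (cases "3 dvd d")
    case True
    hence "3 dvd d'" using eq3 m3 by (auto split: if_splits)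
    thus ?thesis using True by simp
  next
    case False
    hence d': "\<not> 3 dvd d'" using eq3 m3 by (auto split: if_splits)
    hence "[c * d = c' * d'] (mod 3)" using eq3 False by (simp add: cong_def)
    from cross_product_cong[OF square_cong_3[OF False] square_cong_3[OF d'] this] show ?thesis
      by (simp add: cong_iff_dvd_diff)
  qed
  have 8: "8 dvd c' * d - d' * c"
  proof (cases "odd d")
    case True
    hence d': "odd d'" using eq8 m8 by (auto split: if_splits)
    hence "[c * d = c' * d'] (mod 8)" using eq8 True by (simp add: cong_def)
    from cross_product_cong[OF odd_square_cong_8[OF True] odd_square_cong_8[OF d'] this] show ?thesis
      by (simp add: cong_iff_dvd_diff)
  next
    case False
    hence d': "even d'" using eq8 m8 by (auto split: if_splits)
    have c: "odd c" "odd c'" using det False d' by auto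
    have "[d * c = d' * c'] (mod 8)" using eq8 False d' by (simp add: cong_def mult.commute)
    from cross_product_cong[OF odd_square_cong_8[OF c(1)] odd_square_cong_8[OF c(2)] this]
    have "8 dvd d' * c - c' * d" by (simp add: cong_iff_dvd_diff)
    thus ?thesis by (simp add: dvd_diff_commute)
  qed
  have "3 dvd x \<Longrightarrow> 8 dvd x \<Longrightarrow> 24 dvd x" for x :: int by presburger
  thus ?thesis using 3 8 .
qed

lemma coset_label_range: "coset_label c d \<in> {0, 1, 2, 3} \<times> {0, 1, 2, 3, 4, 5, 6, 7, 8, 10, 12, 14}"
proof -
  define u v where "u = c * d mod 3" and "v = c * d mod 8"
  have "0 \<le> u" "u < 3" by (simp_all add: u_def)
  hence u: "u = 0 \<or> u = 1 \<or> u = 2" by linarith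
  have "0 \<le> v" "v < 8" by (simp_all add: v_def)
  hence v: "v = 0 \<or> v = 1 \<or> v = 2 \<or> v = 3 \<or> v = 4 \<or> v = 5 \<or> v = 6 \<or> v = 7" by linarith
  have ev: "even v" if "even d"
  proof -
    have "even x \<Longrightarrow> even (x mod 8)" for x :: int by presburger
    thus ?thesis using that by (simp add: v_def)
  qed
  have "(if 3 dvd d then 3 else u) \<in> {0, 1, 2, 3}" using u by auto
  moreover have "(if odd d then v else 8 + v) \<in> {0, 1, 2, 3, 4, 5, 6, 7, 8, 10, 12, 14}"
  proof (cases "odd d")
    case False
    with ev v have "v = 0 \<or> v = 2 \<or> v = 4 \<or> v = 6" by auto
    with False show ?thesis by auto
  qed (use v in auto)
  ultimately show ?thesis by (simp only: coset_label_def u_def v_def mem_Sigma_iff)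
qed

theorem sturm_level_24:
  assumes f: "f \<in> moderate_forms k 24" and g: "\<And>z. Im z > 0 \<Longrightarrow> f z = g (nome z)"
    and van: "expansion_upto m g (replicate m 0)" and m: "4 * k < m" and z: "Im z > 0"
  shows "f z = 0"
proof -
  obtain C where C: "\<And>q. norm q \<le> 1/2 \<Longrightarrow> norm (g q) \<le> C * norm q ^ m"
    using expansion_uptoE[OF van] by (metis list_poly_replicate_0 diff_zero)
  have nome_small: "norm (nome w) \<le> 1/2" if "Im w > 1" for w
  proof -
    (* Already exp (2 pi) is larger than 2. *)
    have "Im w \<le> 2 * pi * Im w" using mult_right_mono[of 1 "2 * pi" "Im w"] pi_gt3 that by simp
    moreover have "1 + 2 * pi * Im w \<le> exp (2 * pi * Im w)" by (rule exp_ge_add_one_self)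
    ultimately have "2 \<le> exp (2 * pi * Im w)" using that by linarith
    thus ?thesis by (simp add: norm_nome exp_minus field_simps)
  qed
  have parity: "odd (\<gamma> $ 2 $ 1) \<or> odd (\<gamma> $ 2 $ 2)" if "\<gamma> \<in> SL2Z" for \<gamma>
  proof (rule ccontr)
    assume "\<not> ?thesis"
    hence "even (\<gamma> $ 1 $ 1 * \<gamma> $ 2 $ 2 - \<gamma> $ 1 $ 2 * \<gamma> $ 2 $ 1)" by simp
    moreover have "\<gamma> $ 1 $ 1 * \<gamma> $ 2 $ 2 - \<gamma> $ 1 $ 2 * \<gamma> $ 2 $ 1 = 1" using that by (simp only: SL2Z_iff)
    ultimately show False by (simp only: odd_one)
  qed
  show ?thesis
  proof (rule moderate_forms_valence_bound[OF f, where \<phi> = coset_label and Y = 1 and C = C and m = m])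
    show "norm (f w) \<le> C * norm (nome w) ^ m" if "Im w > 1" for w
      using C[OF nome_small[OF that]] g[of w] that by simp
    show "k * card ({0, 1, 2, 3 :: int} \<times> {0, 1, 2, 3, 4, 5, 6, 7, 8, 10, 12, 14 :: int}) < 12 * m"
      using m by (simp add: card_cartesian_product)
  qed (use coset_label_range parity coset_label_eqD z in \<open>auto simp del: insert_iff\<close>)
qed

section \<open>Expansions of the forms\<close>

lemma expansion_upto_eq_list: "expansion_upto N f xs \<Longrightarrow> xs = ys \<Longrightarrow> expansion_upto N f ys" by simp

lemma expansion_theta_1: "expansion_upto 17 (\<lambda>q. theta_series (q ^ 1)) [1, 2, 0, 0, 2, 0, 0, 0, 0, 2, 0, 0, 0, 0, 0, 0, 2]"
  by (rule expansion_upto_eq_list[OF expansion_dilate[OF expansion_theta]]) (simp_all add: dilate_list_def eval_nat_numeral)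

lemma expansion_theta_sq_1: "expansion_upto 17 (\<lambda>q. theta_series (q ^ 1) ^ 2) [1, 4, 4, 0, 4, 8, 0, 0, 4, 4, 8, 0, 0, 8, 0, 0, 4]"
  unfolding power2_eq_square[of "theta_series _"]
  by (rule expansion_upto_eq_list[OF expansion_mult[OF expansion_theta_1 expansion_theta_1]]) simp

lemma expansion_theta_2: "expansion_upto 17 (\<lambda>q. theta_series (q ^ 2)) [1, 0, 2, 0, 0, 0, 0, 0, 2, 0, 0, 0, 0, 0, 0, 0, 0]"
  by (rule expansion_upto_eq_list[OF expansion_dilate[OF expansion_theta]]) (simp_all add: dilate_list_def eval_nat_numeral)

lemma expansion_theta_sq_2: "expansion_upto 17 (\<lambda>q. theta_series (q ^ 2) ^ 2) [1, 0, 4, 0, 4, 0, 0, 0, 4, 0, 8, 0, 0, 0, 0, 0, 4]"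
  unfolding power2_eq_square[of "theta_series _"]
  by (rule expansion_upto_eq_list[OF expansion_mult[OF expansion_theta_2 expansion_theta_2]]) simp

lemma expansion_theta_3: "expansion_upto 17 (\<lambda>q. theta_series (q ^ 3)) [1, 0, 0, 2, 0, 0, 0, 0, 0, 0, 0, 0, 2, 0, 0, 0, 0]"
  by (rule expansion_upto_eq_list[OF expansion_dilate[OF expansion_theta]]) (simp_all add: dilate_list_def eval_nat_numeral)

lemma expansion_theta_sq_3: "expansion_upto 17 (\<lambda>q. theta_series (q ^ 3) ^ 2) [1, 0, 0, 4, 0, 0, 4, 0, 0, 0, 0, 0, 4, 0, 0, 8, 0]"
  unfolding power2_eq_square[of "theta_series _"]
  by (rule expansion_upto_eq_list[OF expansion_mult[OF expansion_theta_3 expansion_theta_3]]) simp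

lemma expansion_theta_6: "expansion_upto 17 (\<lambda>q. theta_series (q ^ 6)) [1, 0, 0, 0, 0, 0, 2, 0, 0, 0, 0, 0, 0, 0, 0, 0, 0]"
  by (rule expansion_upto_eq_list[OF expansion_dilate[OF expansion_theta]]) (simp_all add: dilate_list_def eval_nat_numeral)

lemma expansion_theta_sq_6: "expansion_upto 17 (\<lambda>q. theta_series (q ^ 6) ^ 2) [1, 0, 0, 0, 0, 0, 4, 0, 0, 0, 0, 0, 4, 0, 0, 0, 0]"
  unfolding power2_eq_square[of "theta_series _"]
  by (rule expansion_upto_eq_list[OF expansion_mult[OF expansion_theta_6 expansion_theta_6]]) simp

lemma expansion_theta_pair_1_6: "expansion_upto 17 (\<lambda>q. theta_series (q ^ 1) ^ 2 * theta_series (q ^ 6) ^ 2) [1, 4, 4, 0, 4, 8, 4, 16, 20, 4, 24, 32, 4, 24, 32, 16, 52]"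
  by (rule expansion_upto_eq_list[OF expansion_mult[OF expansion_theta_sq_1 expansion_theta_sq_6]]) simp

lemma expansion_theta_pair_2_3: "expansion_upto 17 (\<lambda>q. theta_series (q ^ 2) ^ 2 * theta_series (q ^ 3) ^ 2) [1, 0, 4, 4, 4, 16, 4, 16, 20, 0, 24, 16, 4, 32, 32, 8, 52]"
  by (rule expansion_upto_eq_list[OF expansion_mult[OF expansion_theta_sq_2 expansion_theta_sq_3]]) simp

lemma expansion_euler_2: "expansion_upto 17 (\<lambda>q. euler_prod (q ^ 2)) [1, 0, -1, 0, -1, 0, 0, 0, 0, 0, 1, 0, 0, 0, 1, 0, 0]"
  by (rule expansion_upto_eq_list[OF expansion_take[OF expansion_compose_power[OF expansion_euler_prod]]]) (simp_all add: dilate_list_def eval_nat_numeral)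

lemma expansion_euler_4: "expansion_upto 17 (\<lambda>q. euler_prod (q ^ 4)) [1, 0, 0, 0, -1, 0, 0, 0, -1, 0, 0, 0, 0, 0, 0, 0, 0]"
  by (rule expansion_upto_eq_list[OF expansion_take[OF expansion_compose_power[OF expansion_euler_prod]]]) (simp_all add: dilate_list_def eval_nat_numeral)

lemma expansion_euler_6: "expansion_upto 17 (\<lambda>q. euler_prod (q ^ 6)) [1, 0, 0, 0, 0, 0, -1, 0, 0, 0, 0, 0, -1, 0, 0, 0, 0]"
  by (rule expansion_upto_eq_list[OF expansion_take[OF expansion_compose_power[OF expansion_euler_prod]]]) (simp_all add: dilate_list_def eval_nat_numeral)

lemma expansion_euler_12: "expansion_upto 17 (\<lambda>q. euler_prod (q ^ 12)) [1, 0, 0, 0, 0, 0, 0, 0, 0, 0, 0, 0, -1, 0, 0, 0, 0]"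
  by (rule expansion_upto_eq_list[OF expansion_take[OF expansion_compose_power[OF expansion_euler_prod]]]) (simp_all add: dilate_list_def eval_nat_numeral)

definition cusp_series :: "complex \<Rightarrow> complex" where
  "cusp_series q = q * (euler_prod (q ^ 2) * (euler_prod (q ^ 4) * (euler_prod (q ^ 6) * euler_prod (q ^ 12))))"

lemma expansion_cusp_series: "expansion_upto 17 cusp_series [0, 1, 0, -1, 0, -2, 0, 0, 0, 1, 0, 4, 0, -2, 0, 2, 0]"
proof -
  have id: "expansion_upto 17 (\<lambda>q. q) (0 # 1 # replicate 15 0)" using expansion_id[of 15] by simp
  have 1: "expansion_upto 17 (\<lambda>q. euler_prod (q ^ 6) * euler_prod (q ^ 12)) [1, 0, 0, 0, 0, 0, -1, 0, 0, 0, 0, 0, -2, 0, 0, 0, 0]"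
    by (rule expansion_upto_eq_list[OF expansion_mult[OF expansion_euler_6 expansion_euler_12]]) simp
  have 2: "expansion_upto 17 (\<lambda>q. euler_prod (q ^ 4) * (euler_prod (q ^ 6) * euler_prod (q ^ 12))) [1, 0, 0, 0, -1, 0, -1, 0, -1, 0, 1, 0, -2, 0, 1, 0, 2]"
    by (rule expansion_upto_eq_list[OF expansion_mult[OF expansion_euler_4 1]]) simp
  have 3: "expansion_upto 17 (\<lambda>q. euler_prod (q ^ 2) * (euler_prod (q ^ 4) * (euler_prod (q ^ 6) * euler_prod (q ^ 12)))) [1, 0, -1, 0, -2, 0, 0, 0, 1, 0, 4, 0, -2, 0, 2, 0, 2]"
    by (rule expansion_upto_eq_list[OF expansion_mult[OF expansion_euler_2 2]]) simp
  show ?thesis unfolding cusp_series_def [abs_def]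
    by (rule expansion_upto_eq_list[OF expansion_mult[OF id 3]]) (simp add: eval_nat_numeral)
qed

lemma expansion_eis_2: "expansion_upto 9 (eis_Ld 2) [1/24, 1, 1, 4, 1, 6, 4, 8, 1]"
  unfolding eis_Ld_def [abs_def] diff_conv_add_uminus mult_minus_left [symmetric]
  by (rule expansion_upto_eq_list[OF expansion_add[OF expansion_eis_L expansion_cmult[OF expansion_dilate[OF expansion_eis_L]]]])
     (simp_all add: dilate_list_def eval_nat_numeral)

lemma expansion_eis_3: "expansion_upto 9 (eis_Ld 3) [1/12, 1, 3, 1, 7, 6, 3, 8, 15]"
  unfolding eis_Ld_def [abs_def] diff_conv_add_uminus mult_minus_left [symmetric]
  by (rule expansion_upto_eq_list[OF expansion_add[OF expansion_eis_L expansion_cmult[OF expansion_dilate[OF expansion_eis_L]]]])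
     (simp_all add: dilate_list_def eval_nat_numeral)

lemma expansion_eis_4: "expansion_upto 9 (eis_Ld 4) [1/8, 1, 3, 4, 3, 6, 12, 8, 3]"
  unfolding eis_Ld_def [abs_def] diff_conv_add_uminus mult_minus_left [symmetric]
  by (rule expansion_upto_eq_list[OF expansion_add[OF expansion_eis_L expansion_cmult[OF expansion_dilate[OF expansion_eis_L]]]])
     (simp_all add: dilate_list_def eval_nat_numeral)

lemma expansion_eis_6: "expansion_upto 9 (eis_Ld 6) [5/24, 1, 3, 4, 7, 6, 6, 8, 15]"
  unfolding eis_Ld_def [abs_def] diff_conv_add_uminus mult_minus_left [symmetric]
  by (rule expansion_upto_eq_list[OF expansion_add[OF expansion_eis_L expansion_cmult[OF expansion_dilate[OF expansion_eis_L]]]])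
     (simp_all add: dilate_list_def eval_nat_numeral)

lemma expansion_eis_8: "expansion_upto 9 (eis_Ld 8) [7/24, 1, 3, 4, 7, 6, 12, 8, 7]"
  unfolding eis_Ld_def [abs_def] diff_conv_add_uminus mult_minus_left [symmetric]
  by (rule expansion_upto_eq_list[OF expansion_add[OF expansion_eis_L expansion_cmult[OF expansion_dilate[OF expansion_eis_L]]]])
     (simp_all add: dilate_list_def eval_nat_numeral)

lemma expansion_eis_12: "expansion_upto 9 (eis_Ld 12) [11/24, 1, 3, 4, 7, 6, 12, 8, 15]"
  unfolding eis_Ld_def [abs_def] diff_conv_add_uminus mult_minus_left [symmetric]
  by (rule expansion_upto_eq_list[OF expansion_add[OF expansion_eis_L expansion_cmult[OF expansion_dilate[OF expansion_eis_L]]]])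
     (simp_all add: dilate_list_def eval_nat_numeral)

lemma expansion_eis_24: "expansion_upto 9 (eis_Ld 24) [23/24, 1, 3, 4, 7, 6, 12, 8, 15]"
  unfolding eis_Ld_def [abs_def] diff_conv_add_uminus mult_minus_left [symmetric]
  by (rule expansion_upto_eq_list[OF expansion_add[OF expansion_eis_L expansion_cmult[OF expansion_dilate[OF expansion_eis_L]]]])
     (simp_all add: dilate_list_def eval_nat_numeral)

text \<open>
  The first nine coefficients of the linear combination with the given coefficients; the lists are those
  of \<open>L\<^sub>2, L\<^sub>3, L\<^sub>4, L\<^sub>6, L\<^sub>8, L\<^sub>1\<^sub>2, L\<^sub>2\<^sub>4\<close> and \<open>A\<close>.
\<close>
definition rhs_list :: "complex \<Rightarrow> complex \<Rightarrow> complex \<Rightarrow> complex \<Rightarrow> complex \<Rightarrow> complex \<Rightarrow> complex \<Rightarrow> complex \<Rightarrow> complex list" where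
  "rhs_list b2 b3 b4 b6 b8 b12 b24 x = map2 (+) (map2 (+) (map2 (+) (map2 (+) (map2 (+) (map2 (+) (map2 (+)
     (map ((*) b2) [1/24, 1, 1, 4, 1, 6, 4, 8, 1])
     (map ((*) b3) [1/12, 1, 3, 1, 7, 6, 3, 8, 15]))
     (map ((*) b4) [1/8, 1, 3, 4, 3, 6, 12, 8, 3]))
     (map ((*) b6) [5/24, 1, 3, 4, 7, 6, 6, 8, 15]))
     (map ((*) b8) [7/24, 1, 3, 4, 7, 6, 12, 8, 7]))
     (map ((*) b12) [11/24, 1, 3, 4, 7, 6, 12, 8, 15]))
     (map ((*) b24) [23/24, 1, 3, 4, 7, 6, 12, 8, 15]))
     (map ((*) x) [0, 1, 0, -1, 0, -2, 0, 0, 0])"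

lemma expansion_rhs:
  "expansion_upto 9 (\<lambda>q. b2 * eis_Ld 2 q + b3 * eis_Ld 3 q + b4 * eis_Ld 4 q + b6 * eis_Ld 6 q + b8 * eis_Ld 8 q + b12 * eis_Ld 12 q + b24 * eis_Ld 24 q + x * cusp_series q)
     (rhs_list b2 b3 b4 b6 b8 b12 b24 x)"
proof -
  have A: "expansion_upto 9 cusp_series [0, 1, 0, -1, 0, -2, 0, 0, 0]"
    by (rule expansion_upto_eq_list[OF expansion_take[OF expansion_cusp_series]]) simp_all
  show ?thesis unfolding rhs_list_def
    by (intro expansion_add expansion_cmult A expansion_eis_2 expansion_eis_3 expansion_eis_4 expansion_eis_6 expansion_eis_8 expansion_eis_12 expansion_eis_24)
qed

section \<open>The identities\<close>

lemma cusp_A_nome: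
  "cusp_A z = cusp_series (nome z)"
proof -
  have e: "exp (of_real pi * \<i> * (2 * z) / 12) * (exp (of_real pi * \<i> * (4 * z) / 12) *
     (exp (of_real pi * \<i> * (6 * z) / 12) * exp (of_real pi * \<i> * (12 * z) / 12))) = nome z"
    unfolding nome_def exp_add [symmetric] by (rule arg_cong[of _ _ exp]) (simp add: field_simps)
  have "nome (2 * z) = nome z ^ 2" "nome (4 * z) = nome z ^ 4" "nome (6 * z) = nome z ^ 6" "nome (12 * z) = nome z ^ 12"
    using nome_mult_nat[of 2 z] nome_mult_nat[of 4 z] nome_mult_nat[of 6 z] nome_mult_nat[of 12 z] by simp_all
  thus ?thesis unfolding cusp_A_def dedekind_eta_conv_euler_prod cusp_series_def e [symmetric]
    by (simp only: mult_ac)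
qed

lemma theta_phi_nome:
  assumes "Im z > 0" "n > 0"
  shows "theta_phi (of_nat n * z) = theta_series (nome z ^ n)"
  using theta_phi_conv_series[of "of_nat n * z"] assms by (simp add: nome_mult_nat)

lemma moderate_forms_cong:
  assumes f: "f \<in> moderate_forms k N" and eq: "\<And>z. Im z > 0 \<Longrightarrow> f z = g z"
  shows "g \<in> moderate_forms k N"
proof -
  have "g holomorphic_on upper_half_plane"
    by (rule holomorphic_transform[of f]) (use f eq in \<open>auto simp: moderate_forms_def\<close>)
  moreover have "moderate_growth g"
    using f eq by (auto simp: moderate_forms_def moderate_growth_def)
  moreover have "slash (int k) \<gamma> g z = g z" if "\<gamma> \<in> Gamma0 N" "Im z > 0" for \<gamma> z
  proof -
    have "slash (int k) \<gamma> f z = f z" using f that by (simp add: moderate_forms_def)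
    thus ?thesis using eq[OF that(2)] eq[OF Im_moebius_action_pos[OF Gamma0_SL2Z[OF that(1)] that(2)]]
      by (simp add: slash_eq)
  qed
  ultimately show ?thesis by (simp add: moderate_forms_def)
qed

text \<open>
  With \<open>B\<close> for the right-hand side, \<open>B\<^sup>2 - 16 A\<^sup>2 = (B + 4 A) (B - 4 A)\<close> is a form of weight 4. The second factor
  vanishes to order 17, which is enough, so one of the factors is identically zero. It is not the first
  one, since \<open>B + 4 A\<close> starts with \<open>8 q\<close>.
\<close>
theorem cusp_A_theta:
  assumes z: "Im z > 0"
  shows "4 * cusp_A z = theta_phi z ^ 2 * theta_phi (6 * z) ^ 2 - theta_phi (2 * z) ^ 2 * theta_phi (3 * z) ^ 2"
proof -
  define B where "B = (\<lambda>z. (theta_phi (of_nat 1 * z) ^ 2 * theta_phi (of_nat 6 * z) ^ 2 - theta_phi (of_nat 2 * z) ^ 2 * theta_phi (of_nat 3 * z) ^ 2))"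
  define b where "b = (\<lambda>q. (theta_series (q ^ 1) ^ 2 * theta_series (q ^ 6) ^ 2 + (- 1) * (theta_series (q ^ 2) ^ 2 * theta_series (q ^ 3) ^ 2)))"
  have Bb: "B z = b (nome z)" if "Im z > 0" for z
    using theta_phi_nome[OF that, of 1] theta_phi_nome[OF that, of 2] theta_phi_nome[OF that, of 3] theta_phi_nome[OF that, of 6]
    by (simp add: B_def b_def)
  have B: "B \<in> moderate_forms 2 24"
    unfolding B_def by (intro moderate_forms_diff theta_pair_form) simp_all
  have b: "expansion_upto 17 b (map ((*) 4) [0, 1, 0, -1, 0, -2, 0, 0, 0, 1, 0, 4, 0, -2, 0, 2, 0])"
    unfolding b_def by (rule expansion_upto_eq_list[OF expansion_add[OF expansion_theta_pair_1_6 expansion_cmult[OF expansion_theta_pair_2_3]]]) simp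
  have plus: "expansion_upto 17 (\<lambda>q. b q + 4 * cusp_series q) (map ((*) 8) [0, 1, 0, -1, 0, -2, 0, 0, 0, 1, 0, 4, 0, -2, 0, 2, 0])"
    by (rule expansion_upto_eq_list[OF expansion_add[OF b expansion_cmult[OF expansion_cusp_series]]]) simp
  have minus: "expansion_upto 17 (\<lambda>q. b q + (- 4) * cusp_series q) (replicate 17 0)"
    by (rule expansion_upto_eq_list[OF expansion_add[OF b expansion_cmult[OF expansion_cusp_series]]]) (simp add: eval_nat_numeral)
  have prod0: "(B z + 4 * cusp_A z) * (B z - 4 * cusp_A z) = 0" if "Im z > 0" for z
  proof (rule sturm_level_24[OF _ _ _ _ that, where k = 4 and m = 17])
    have "(\<lambda>z. B z * B z - 16 * (cusp_A z ^ 2)) \<in> moderate_forms 4 24"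
      using moderate_forms_diff[OF moderate_forms_mult[OF B B, simplified] moderate_forms_cmult[OF cusp_A_sq_form]] by simp
    thus "(\<lambda>z. (B z + 4 * cusp_A z) * (B z - 4 * cusp_A z)) \<in> moderate_forms 4 24"
      by (rule moderate_forms_cong) (simp add: algebra_simps power2_eq_square)
    show "(B z + 4 * cusp_A z) * (B z - 4 * cusp_A z) = (b (nome z) + (- 4) * cusp_series (nome z)) * (b (nome z) + 4 * cusp_series (nome z))"
      if "Im z > 0" for z using Bb[OF that] by (simp add: cusp_A_nome)
    show "expansion_upto 17 (\<lambda>q. (b q + (- 4) * cusp_series q) * (b q + 4 * cusp_series q)) (replicate 17 0)"
      by (rule expansion_upto_eq_list[OF expansion_mult[OF minus plus]]) (simp add: eval_nat_numeral)
  qed simp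
  have holB: "B holomorphic_on upper_half_plane" using B by (simp add: moderate_forms_def)
  (* Otherwise the coefficient 8 of q would be bounded by a multiple of q for small positive q. *)
  have notplus: "\<not> (\<forall>z. Im z > 0 \<longrightarrow> B z + 4 * cusp_A z = 0)"
  proof
    assume 0: "\<forall>z. Im z > 0 \<longrightarrow> B z + 4 * cusp_A z = 0"
    have "expansion_upto 2 (\<lambda>q. b q + 4 * cusp_series q) [0, 8]"
      by (rule expansion_upto_eq_list[OF expansion_take[OF plus]]) simp_all
    then obtain C where C: "\<And>q. norm q \<le> 1/2 \<Longrightarrow> norm (b q + 4 * cusp_series q - list_poly [0, 8] q) \<le> C * norm q ^ 2"
      unfolding expansion_upto_def by blast
    have "((\<lambda>y. C * exp (- 2 * pi * y)) \<longlongrightarrow> C * 0) at_top" and "((\<lambda>y. exp (- 2 * pi * y)) \<longlongrightarrow> 0) at_top"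
    proof -
      show 0: "((\<lambda>y. exp (- 2 * pi * y)) \<longlongrightarrow> 0) at_top" by real_asymp
      show "((\<lambda>y. C * exp (- 2 * pi * y)) \<longlongrightarrow> C * 0) at_top" by (intro tendsto_mult tendsto_const 0)
    qed
    note this(1)[THEN order_tendstoD(2), of 8] this(2)[THEN order_tendstoD(2), of "1/2"]
    hence "eventually (\<lambda>y. C * exp (- 2 * pi * y) < 8) at_top" "eventually (\<lambda>y. exp (- 2 * pi * y) < 1/2) at_top"
      by simp_all
    moreover have "eventually (\<lambda>y :: real. y > 0) at_top" by (rule eventually_gt_at_top)
    ultimately have "eventually (\<lambda>y :: real. False) at_top"
    proof eventually_elim
      case (elim y)
      define w where "w = \<i> * of_real y"
      have w: "Im w > 0" "norm (nome w) = exp (- 2 * pi * y)" using elim by (auto simp: w_def norm_nome)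
      have "b (nome w) + 4 * cusp_series (nome w) = 0" using 0[rule_format, OF w(1)] Bb[OF w(1)] by (simp add: cusp_A_nome)
      hence "8 * exp (- 2 * pi * y) \<le> C * exp (- 2 * pi * y) * exp (- 2 * pi * y)"
        using C[of "nome w"] w elim(2) by (simp add: norm_mult power2_eq_square)
      hence "8 \<le> C * exp (- 2 * pi * y)" by (simp only: mult_le_cancel_right) (auto simp: not_less)
      thus False using elim(1) by simp
    qed
    thus False by simp
  qed
  have "B z - 4 * cusp_A z = 0" if "Im z > 0" for z
  proof (cases "(\<lambda>z. B z + 4 * cusp_A z) = (\<lambda>z. B z - 4 * cusp_A z)")
    case True
    thus ?thesis using prod0[OF that] fun_cong[OF True, of z] by auto
  next
    case False
    obtain g where g: "g \<in> {\<lambda>z. B z + 4 * cusp_A z, \<lambda>z. B z - 4 * cusp_A z}" "\<And>z. Im z > 0 \<Longrightarrow> g z = 0"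
    proof (rule holomorphic_prod_eq_0)
      show "g holomorphic_on upper_half_plane" if "g \<in> {\<lambda>z. B z + 4 * cusp_A z, \<lambda>z. B z - 4 * cusp_A z}" for g
        using that holB cusp_A_holomorphic by (auto intro!: holomorphic_intros)
      show "(\<Prod>g\<in>{\<lambda>z. B z + 4 * cusp_A z, \<lambda>z. B z - 4 * cusp_A z}. g z) = 0" if "Im z > 0" for z
        using False prod0[OF that] by simp
    qed auto
    thus ?thesis using notplus that by auto
  qed
  from this[OF z] show ?thesis by (simp add: B_def)
qed

lemma cusp_A_form: "cusp_A \<in> moderate_forms 2 24"
proof -
  have "(\<lambda>z. (1/4) * (theta_phi (of_nat 1 * z) ^ 2 * theta_phi (of_nat 6 * z) ^ 2 - theta_phi (of_nat 2 * z) ^ 2 * theta_phi (of_nat 3 * z) ^ 2)) \<in> moderate_forms 2 24"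
    by (intro moderate_forms_cmult moderate_forms_diff theta_pair_form) simp_all
  thus ?thesis by (rule moderate_forms_cong) (simp add: cusp_A_theta [symmetric])
qed

text \<open>
  Both sides are forms of weight 2, so nine coefficients suffice.
\<close>
lemma theta_identity:
  assumes T: "T \<in> moderate_forms 2 24" and t: "\<And>z. Im z > 0 \<Longrightarrow> T z = t (nome z)"
    and ts: "expansion_upto 9 t ts" "ts = rhs_list b2 b3 b4 b6 b8 b12 b24 x"
  shows "T \<in> modular_forms 2 24 \<and> (\<forall>z\<in>upper_half_plane. T z =
    b2 * eis_Ld 2 (nome z) + b3 * eis_Ld 3 (nome z) + b4 * eis_Ld 4 (nome z) + b6 * eis_Ld 6 (nome z) + b8 * eis_Ld 8 (nome z) + b12 * eis_Ld 12 (nome z) + b24 * eis_Ld 24 (nome z) + x * cusp_A z)"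
proof (intro conjI ballI)
  show "T \<in> modular_forms 2 24" using moderate_forms_modular[OF T] by simp
  fix z assume "z \<in> upper_half_plane"
  hence z: "Im z > 0" by simp
  define R where "R = (\<lambda>z. b2 * eis_Ld 2 (nome z) + b3 * eis_Ld 3 (nome z) + b4 * eis_Ld 4 (nome z) + b6 * eis_Ld 6 (nome z) + b8 * eis_Ld 8 (nome z) + b12 * eis_Ld 12 (nome z) + b24 * eis_Ld 24 (nome z) + x * cusp_A z)"
  have R: "R \<in> moderate_forms 2 24"
    unfolding R_def by (intro moderate_forms_add moderate_forms_cmult eis_Ld_form cusp_A_form) simp_all
  have "T z - R z = 0"
  proof (rule sturm_level_24[OF moderate_forms_diff[OF T R] _ _ _ z, where m = 9])
    show "T z - R z = t (nome z) + (- 1) * ((\<lambda>q. b2 * eis_Ld 2 q + b3 * eis_Ld 3 q + b4 * eis_Ld 4 q + b6 * eis_Ld 6 q + b8 * eis_Ld 8 q + b12 * eis_Ld 12 q + b24 * eis_Ld 24 q + x * cusp_series q) (nome z))" if "Im z > 0" for z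
      using t[OF that] by (simp add: R_def cusp_A_nome)
    have z9: "map2 (+) xs (map ((*) (- 1)) xs) = replicate (length xs) (0 :: complex)" for xs
      by (induction xs) auto
    have len: "length ts = 9" using ts(1) by (simp add: expansion_upto_def)
    have "expansion_upto 9 (\<lambda>q. t q + (- 1) * ((\<lambda>q. b2 * eis_Ld 2 q + b3 * eis_Ld 3 q + b4 * eis_Ld 4 q + b6 * eis_Ld 6 q + b8 * eis_Ld 8 q + b12 * eis_Ld 12 q + b24 * eis_Ld 24 q + x * cusp_series q) q)) (map2 (+) ts (map ((*) (- 1)) ts))"
      by (rule expansion_add[OF ts(1) expansion_cmult]) (unfold ts(2), rule expansion_rhs)
    thus "expansion_upto 9 (\<lambda>q. t q + (- 1) * ((\<lambda>q. b2 * eis_Ld 2 q + b3 * eis_Ld 3 q + b4 * eis_Ld 4 q + b6 * eis_Ld 6 q + b8 * eis_Ld 8 q + b12 * eis_Ld 12 q + b24 * eis_Ld 24 q + x * cusp_series q) q)) (replicate 9 0)"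
      by (simp only: z9 len)
  qed simp
  thus "T z = b2 * eis_Ld 2 (nome z) + b3 * eis_Ld 3 (nome z) + b4 * eis_Ld 4 (nome z) + b6 * eis_Ld 6 (nome z) + b8 * eis_Ld 8 (nome z) + b12 * eis_Ld 12 (nome z) + b24 * eis_Ld 24 (nome z) + x * cusp_A z" by (simp add: R_def)
qed

lemma theta_pair_identity:
  assumes xy: "x dvd 6" "y dvd 6" and ts: "expansion_upto 9 (\<lambda>q. theta_series (q ^ x) ^ 2 * theta_series (q ^ y) ^ 2) ts"
    "ts = rhs_list b2 b3 b4 b6 b8 b12 b24 c"
  shows "theta_prod (x, x, y, y) \<in> modular_forms 2 24 \<and> (\<forall>z\<in>upper_half_plane. theta_prod (x, x, y, y) z =
    b2 * eis_Ld 2 (nome z) + b3 * eis_Ld 3 (nome z) + b4 * eis_Ld 4 (nome z) + b6 * eis_Ld 6 (nome z) + b8 * eis_Ld 8 (nome z) + b12 * eis_Ld 12 (nome z) + b24 * eis_Ld 24 (nome z) + c * cusp_A z)"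
proof -
  have eq: "theta_prod (x, x, y, y) = (\<lambda>z. theta_phi (of_nat x * z) ^ 2 * theta_phi (of_nat y * z) ^ 2)"
    by (simp add: theta_prod_def fun_eq_iff power2_eq_square mult_ac)
  have "x > 0" "y > 0" using xy by (auto intro!: Nat.gr0I)
  thus ?thesis unfolding eq
    by (intro theta_identity[OF theta_pair_form[OF xy] _ ts]) (simp add: theta_phi_nome)
qed

lemma expansion_theta9_1_1: "expansion_upto 9 (\<lambda>q. theta_series (q ^ 1) ^ 2 * theta_series (q ^ 1) ^ 2) [1, 8, 24, 32, 24, 48, 96, 64, 24]"
  by (rule expansion_upto_eq_list[OF expansion_mult[OF expansion_take[OF expansion_theta_sq_1] expansion_take[OF expansion_theta_sq_1]]]) simp_all

lemma expansion_theta9_1_2: "expansion_upto 9 (\<lambda>q. theta_series (q ^ 1) ^ 2 * theta_series (q ^ 2) ^ 2) [1, 4, 8, 16, 24, 24, 32, 32, 24]"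
  by (rule expansion_upto_eq_list[OF expansion_mult[OF expansion_take[OF expansion_theta_sq_1] expansion_take[OF expansion_theta_sq_2]]]) simp_all

lemma expansion_theta9_1_3: "expansion_upto 9 (\<lambda>q. theta_series (q ^ 1) ^ 2 * theta_series (q ^ 3) ^ 2) [1, 4, 4, 4, 20, 24, 4, 32, 52]"
  by (rule expansion_upto_eq_list[OF expansion_mult[OF expansion_take[OF expansion_theta_sq_1] expansion_take[OF expansion_theta_sq_3]]]) simp_all

lemma expansion_theta9_1_6: "expansion_upto 9 (\<lambda>q. theta_series (q ^ 1) ^ 2 * theta_series (q ^ 6) ^ 2) [1, 4, 4, 0, 4, 8, 4, 16, 20]"
  by (rule expansion_upto_eq_list[OF expansion_take[OF expansion_theta_pair_1_6]]) simp_all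

lemma expansion_theta9_2_2: "expansion_upto 9 (\<lambda>q. theta_series (q ^ 2) ^ 2 * theta_series (q ^ 2) ^ 2) [1, 0, 8, 0, 24, 0, 32, 0, 24]"
  by (rule expansion_upto_eq_list[OF expansion_mult[OF expansion_take[OF expansion_theta_sq_2] expansion_take[OF expansion_theta_sq_2]]]) simp_all

lemma expansion_theta9_2_3: "expansion_upto 9 (\<lambda>q. theta_series (q ^ 2) ^ 2 * theta_series (q ^ 3) ^ 2) [1, 0, 4, 4, 4, 16, 4, 16, 20]"
  by (rule expansion_upto_eq_list[OF expansion_take[OF expansion_theta_pair_2_3]]) simp_all

lemma expansion_theta9_2_6: "expansion_upto 9 (\<lambda>q. theta_series (q ^ 2) ^ 2 * theta_series (q ^ 6) ^ 2) [1, 0, 4, 0, 4, 0, 4, 0, 20]"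
  by (rule expansion_upto_eq_list[OF expansion_mult[OF expansion_take[OF expansion_theta_sq_2] expansion_take[OF expansion_theta_sq_6]]]) simp_all

lemma expansion_theta9_3_3: "expansion_upto 9 (\<lambda>q. theta_series (q ^ 3) ^ 2 * theta_series (q ^ 3) ^ 2) [1, 0, 0, 8, 0, 0, 24, 0, 0]"
  by (rule expansion_upto_eq_list[OF expansion_mult[OF expansion_take[OF expansion_theta_sq_3] expansion_take[OF expansion_theta_sq_3]]]) simp_all

lemma expansion_theta9_3_6: "expansion_upto 9 (\<lambda>q. theta_series (q ^ 3) ^ 2 * theta_series (q ^ 6) ^ 2) [1, 0, 0, 4, 0, 0, 8, 0, 0]"
  by (rule expansion_upto_eq_list[OF expansion_mult[OF expansion_take[OF expansion_theta_sq_3] expansion_take[OF expansion_theta_sq_6]]]) simp_all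

lemma expansion_theta9_6_6: "expansion_upto 9 (\<lambda>q. theta_series (q ^ 6) ^ 2 * theta_series (q ^ 6) ^ 2) [1, 0, 0, 0, 0, 0, 8, 0, 0]"
  by (rule expansion_upto_eq_list[OF expansion_mult[OF expansion_take[OF expansion_theta_sq_6] expansion_take[OF expansion_theta_sq_6]]]) simp_all

lemma expansion_theta9_1236: "expansion_upto 9 (\<lambda>q. (theta_series (q ^ 1) * theta_series (q ^ 2)) * (theta_series (q ^ 3) * theta_series (q ^ 6))) [1, 2, 2, 6, 6, 4, 14, 8, 6]"
  by (rule expansion_upto_eq_list[OF expansion_mult[OF expansion_mult[OF expansion_take[OF expansion_theta_1] expansion_take[OF expansion_theta_2]]
      expansion_mult[OF expansion_take[OF expansion_theta_3] expansion_take[OF expansion_theta_6]]]]) simp_all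

lemma theta_1236_nome:
  assumes "Im z > 0"
  shows "theta_prod (1, 2, 3, 6) z = (theta_series (nome z ^ 1) * theta_series (nome z ^ 2)) * (theta_series (nome z ^ 3) * theta_series (nome z ^ 6))"
  using theta_phi_nome[OF assms, of 1] theta_phi_nome[OF assms, of 2] theta_phi_nome[OF assms, of 3] theta_phi_nome[OF assms, of 6]
  by (simp add: theta_prod_def)

theorem theorem3p1:
  fixes a1 a2 a3 a4 :: nat
    and b2 b3 b4 b6 b8 b12 b24 x :: complex
  assumes "((a1, a2, a3, a4), (b2, b3, b4, b6, b8, b12, b24, x)) \<in> coeff_table"
  shows "theta_prod (a1, a2, a3, a4) \<in> modular_forms 2 24 \<and>
    (\<forall>z\<in>upper_half_plane.
       theta_prod (a1, a2, a3, a4) z =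
         b2 * eis_Ld 2 (nome z) + b3 * eis_Ld 3 (nome z) + b4 * eis_Ld 4 (nome z) +
         b6 * eis_Ld 6 (nome z) + b8 * eis_Ld 8 (nome z) + b12 * eis_Ld 12 (nome z) +
         b24 * eis_Ld 24 (nome z) + x * cusp_A z)"
proof -
  consider
    "a1 = 1" "a2 = 1" "a3 = 1" "a4 = 1" "b2 = 0" "b3 = 0" "b4 = 8" "b6 = 0" "b8 = 0" "b12 = 0" "b24 = 0" "x = 0"
  | "a1 = 1" "a2 = 1" "a3 = 2" "a4 = 2" "b2 = 2" "b3 = 0" "b4 = -2" "b6 = 0" "b8 = 4" "b12 = 0" "b24 = 0" "x = 0"
  | "a1 = 1" "a2 = 1" "a3 = 3" "a4 = 3" "b2 = 4" "b3 = 4" "b4 = -4" "b6 = -4" "b8 = 0" "b12 = 4" "b24 = 0" "x = 0"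
  | "a1 = 1" "a2 = 1" "a3 = 6" "a4 = 6" "b2 = 1" "b3 = 2" "b4 = 1" "b6 = -1" "b8 = -2" "b12 = -1" "b24 = 2" "x = 2"
  | "a1 = 1" "a2 = 2" "a3 = 3" "a4 = 6" "b2 = 1/2" "b3 = -1" "b4 = -1/2" "b6 = 1/2" "b8 = 1" "b12 = -1/2" "b24 = 1" "x = 1"
  | "a1 = 2" "a2 = 2" "a3 = 2" "a4 = 2" "b2 = -4" "b3 = 0" "b4 = 0" "b6 = 0" "b8 = 4" "b12 = 0" "b24 = 0" "x = 0"
  | "a1 = 2" "a2 = 2" "a3 = 3" "a4 = 3" "b2 = 1" "b3 = 2" "b4 = 1" "b6 = -1" "b8 = -2" "b12 = -1" "b24 = 2" "x = -2"
  | "a1 = 2" "a2 = 2" "a3 = 6" "a4 = 6" "b2 = -2" "b3 = 0" "b4 = 2" "b6 = 2" "b8 = -2" "b12 = -2" "b24 = 2" "x = 0"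
  | "a1 = 3" "a2 = 3" "a3 = 3" "a4 = 3" "b2 = 0" "b3 = -8/3" "b4 = 0" "b6 = 0" "b8 = 0" "b12 = 8/3" "b24 = 0" "x = 0"
  | "a1 = 3" "a2 = 3" "a3 = 6" "a4 = 6" "b2 = 0" "b3 = -4/3" "b4 = 0" "b6 = 2/3" "b8 = 0" "b12 = -2/3" "b24 = 4/3" "x = 0"
  | "a1 = 6" "a2 = 6" "a3 = 6" "a4 = 6" "b2 = 0" "b3 = 0" "b4 = 0" "b6 = -4/3" "b8 = 0" "b12 = 0" "b24 = 4/3" "x = 0"
    using assms unfolding coeff_table_def by (elim insertE emptyE) (simp_all only: prod.inject)
  thus ?thesis
  proof cases
    case 1
    show ?thesis unfolding 1
      by (rule theta_pair_identity[OF _ _ expansion_theta9_1_1]) (simp_all add: rhs_list_def)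
  next
    case 2
    show ?thesis unfolding 2
      by (rule theta_pair_identity[OF _ _ expansion_theta9_1_2]) (simp_all add: rhs_list_def)
  next
    case 3
    show ?thesis unfolding 3
      by (rule theta_pair_identity[OF _ _ expansion_theta9_1_3]) (simp_all add: rhs_list_def)
  next
    case 4
    show ?thesis unfolding 4
      by (rule theta_pair_identity[OF _ _ expansion_theta9_1_6]) (simp_all add: rhs_list_def)
  next
    case 5
    show ?thesis unfolding 5
      by (rule theta_identity[OF theta_1236_form[OF cusp_A_form] theta_1236_nome expansion_theta9_1236])
         (simp_all add: rhs_list_def)
  next
    case 6
    show ?thesis unfolding 6
      by (rule theta_pair_identity[OF _ _ expansion_theta9_2_2]) (simp_all add: rhs_list_def)
  next
    case 7
    show ?thesis unfolding 7
      by (rule theta_pair_identity[OF _ _ expansion_theta9_2_3]) (simp_all add: rhs_list_def)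
  next
    case 8
    show ?thesis unfolding 8
      by (rule theta_pair_identity[OF _ _ expansion_theta9_2_6]) (simp_all add: rhs_list_def)
  next
    case 9
    show ?thesis unfolding 9
      by (rule theta_pair_identity[OF _ _ expansion_theta9_3_3]) (simp_all add: rhs_list_def)
  next
    case 10
    show ?thesis unfolding 10
      by (rule theta_pair_identity[OF _ _ expansion_theta9_3_6]) (simp_all add: rhs_list_def)
  next
    case 11
    show ?thesis unfolding 11
      by (rule theta_pair_identity[OF _ _ expansion_theta9_6_6]) (simp_all add: rhs_list_def)
  qed
qed

end
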